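(* Let $H$ be a cocommutative Hopf algebra over a field $\mathbf{k}$, let $\Gamma$ be a finite group acting on $H$ by Hopf algebra automorphisms, and let $\widetilde{H}=H\#\mathbf{k}[\Gamma]$ be the smash product. Then an $L_\infty$ $\widetilde{H}$-pseudoalgebra is the same as an $L_\infty$ $H$-pseudoalgebra $(\mathcal{L},\{\beta_k\}_{k\ge1})$ equipped with an action of $\Gamma$ on the graded left $H$-module $\mathcal{L}$ (compatible with the $H$-action) satisfying $$\beta_k(gx_1,\dots,gx_k)=g\cdot\beta_k(x_1,\dots,x_k)\qquad\text{for all }k\ge1,\ x_1,\dots,x_k\in\mathcal{L},\ g\in\Gamma.$$ Precisely: for every graded left $\widetilde{H}$-module $\mathcal{L}$, the assignment $\{\widetilde{\beta}_k\}_{k\ge1}\mapsto\{\delta(\widetilde{\beta}_k)\}_{k\ge1}$ is a bijection from the set of $L_\infty$ $\widetilde{H}$-pseudoalgebra structures on $\mathcal{L}$ onto the set of $L_\infty$ $H$-pseudoalgebra structures on $\mathcal{L}$ satisfying the displayed condition.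
   Context: Smash product. $\Gamma$ acts on $H$ by $(g,f)\mapsto g\cdot f$. As an algebra $\widetilde{H}$ is $H\otimes\mathbf{k}[\Gamma]$ with $gfg^{-1}=g\cdot f$; as a coalgebra it is the tensor product of $H$ and $\mathbf{k}[\Gamma]$ ($g\in\Gamma$ group-like). It is a cocommutative Hopf algebra. A graded left $\widetilde{H}$-module is the same as a graded left $H$-module $\mathcal{L}$ with a degree-preserving $\Gamma$-action such that $g(fx)=(g\cdot f)(gx)$. $\Gamma$ acts on $H^{\otimes k}\otimes_H\mathcal{L}$ by $g\cdot\big((f_1\otimes\cdots\otimes f_k)\otimes_He\big)=(g\cdot f_1\otimes\cdots\otimes g\cdot f_k)\otimes_Hge$. The map $\delta$. Let $\delta_k:\widetilde{H}^{\otimes k}\to H^{\otimes k}\otimes_H\widetilde{H}$ be given, for $f_i\in H$, $g_i\in\Gamma$, by $\delta_k(f_1g_1\otimes\cdots\otimes f_kg_k)=(f_1\otimes\cdots\otimes f_k)\otimes_Hg$ if $g_1=\cdots=g_k=g$, and $0$ otherwise. For $\varphi:\mathcal{L}^{\otimes k}\to\widetilde{H}^{\otimes k}\otimes_{\widetilde{H}}\mathcal{L}$, $\delta(\varphi)$ is the composite $\mathcal{L}^{\otimes k}\xrightarrow{\varphi}\widetilde{H}^{\otimes k}\otimes_{\widetilde{H}}\mathcal{L}\xrightarrow{\delta_k\otimes\mathrm{id}}(H^{\otimes k}\otimes_H\widetilde{H})\otimes_{\widetilde{H}}\mathcal{L}\cong H^{\otimes k}\otimes_H\mathcal{L}$.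 $L_\infty$ $K$-pseudoalgebras, for a cocommutative Hopf algebra $K$ (used for $K=H$ and $K=\widetilde{H}$). $K^{\otimes n}$ is a right $K$-module via $(h_1\otimes\cdots\otimes h_n)h=h_1h_{(1)}\otimes\cdots\otimes h_nh_{(n)}$. $\mathrm{Hom}^p_{K^{\otimes n}}(\mathcal{L}^{\boxtimes n},K^{\otimes n}\otimes_K\mathcal{L})$ is the space of degree $p$, $K^{\otimes n}$-linear maps $\mathcal{L}^{\otimes n}\to K^{\otimes n}\otimes_K\mathcal{L}$ (factorwise action on the source, left multiplication on the target). Composition: if $\psi(y_1,\dots,y_l)=\sum_i(h_i^1\otimes\cdots\otimes h_i^l)\otimes_Ke_i$ and $\varphi(e_i,x_2,\dots,x_k)=\sum_j(f_{ij}^1\otimes\cdots\otimes f_{ij}^k)\otimes_Ke_{ij}$, then $\varphi(\psi(y_1,\dots,y_l),x_2,\dots,x_k)=\sum_{i,j}(h_i^1f^1_{ij(1)}\otimes\cdots\otimes h_i^lf^1_{ij(l)}\otimes f_{ij}^2\otimes\cdots\otimes f_{ij}^k)\otimes_Ke_{ij}$. For $\sigma\in S_N$, $P_\sigma$ moves the $j$-th factor of $K^{\otimes N}$ to position $\sigma(j)$; $(-1)^\sigma$ is the signature and $\epsilon(\sigma)$ the Koszul sign of $(x_1,\dots,x_N)\mapsto(x_{\sigma(1)},\dots,x_{\sigma(N)})$; $\mathrm{Sh}(l,k-1)$ is the set of $\sigma\in S_{l+k-1}$ increasing on $\{1,\dots,l\}$ and on $\{l+1,\dots,l+k-1\}$.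 An $L_\infty$ $K$-pseudoalgebra structure on a graded left $K$-module $\mathcal{L}$ is a family $\beta_k\in\mathrm{Hom}^{k-2}_{K^{\otimes k}}(\mathcal{L}^{\boxtimes k},K^{\otimes k}\otimes_K\mathcal{L})$, $k\ge1$, with $\beta_k(x_1,\dots,x_k)=(-1)^\sigma\epsilon(\sigma)(P_\sigma\otimes_K1)\beta_k(x_{\sigma(1)},\dots,x_{\sigma(k)})$ for all $\sigma\in S_k$ and, for all $N\ge1$ and homogeneous $x_1,\dots,x_N$, $$\sum_{k+l=N+1}\sum_{\sigma\in\mathrm{Sh}(l,k-1)}(-1)^\sigma\epsilon(\sigma)(-1)^{l(k-1)}(P_\sigma\otimes_K1)\beta_k\big(\beta_l(x_{\sigma(1)},\dots,x_{\sigma(l)}),x_{\sigma(l+1)},\dots,x_{\sigma(N)}\big)=0.$$ *)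

theory Defs
  imports Complex_Main "HOL-Library.Poly_Mapping" "HOL-Library.FuncSet"
    "HOL-Combinatorics.Permutations"
begin

section \<open>Quotients of free vector spaces\<close>

text \<open>The free vector space on a type of generators is the type of finitely supported functions.
  All tensor products below are quotients of such spaces: an element of a tensor product is
  a coset of formal sums of pure tensors.\<close>

definition fscale :: "'k::field \<Rightarrow> ('x \<Rightarrow>\<^sub>0 'k) \<Rightarrow> ('x \<Rightarrow>\<^sub>0 'k)" where
  "fscale c t = Poly_Mapping.map (\<lambda>b. c * b) t"

lemma lookup_fscale [simp]: "Poly_Mapping.lookup (fscale c t) x = c * Poly_Mapping.lookup t x"
  by (simp add: fscale_def Poly_Mapping.map.rep_eq when_def)

interpretation free: vector_space "fscale :: 'k::field \<Rightarrow> ('x \<Rightarrow>\<^sub>0 'k) \<Rightarrow> ('x \<Rightarrow>\<^sub>0 'k)"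
  by unfold_locales (auto intro!: poly_mapping_eqI simp: lookup_add algebra_simps)

abbreviation gen :: "'x \<Rightarrow> ('x \<Rightarrow>\<^sub>0 'k::field)" where
  "gen x \<equiv> Poly_Mapping.single x 1"

definition lin_ext :: "('k::field \<Rightarrow> 'v \<Rightarrow> 'v) \<Rightarrow> ('x \<Rightarrow> 'v::ab_group_add) \<Rightarrow> ('x \<Rightarrow>\<^sub>0 'k) \<Rightarrow> 'v" where
  "lin_ext s f t = (\<Sum>x\<in>Poly_Mapping.keys t. s (Poly_Mapping.lookup t x) (f x))"

abbreviation fbind :: "('x \<Rightarrow>\<^sub>0 'k::field) \<Rightarrow> ('x \<Rightarrow> ('y \<Rightarrow>\<^sub>0 'k)) \<Rightarrow> ('y \<Rightarrow>\<^sub>0 'k)" where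
  "fbind t f \<equiv> lin_ext fscale f t"

definition qclass :: "('x \<Rightarrow>\<^sub>0 'k::field) set \<Rightarrow> ('x \<Rightarrow>\<^sub>0 'k) \<Rightarrow> ('x \<Rightarrow>\<^sub>0 'k) set" where
  "qclass R t = {u. u - t \<in> free.span R}"

text \<open>Operations on cosets are computed on an arbitrary representative; they are only used
  where the outcome does not depend on the choice.\<close>

definition rep :: "('x \<Rightarrow>\<^sub>0 'k::field) set \<Rightarrow> ('x \<Rightarrow>\<^sub>0 'k)" where
  "rep A = (SOME t. t \<in> A)"

definition qadd :: "('x \<Rightarrow>\<^sub>0 'k::field) set \<Rightarrow> ('x \<Rightarrow>\<^sub>0 'k) set \<Rightarrow> ('x \<Rightarrow>\<^sub>0 'k) set \<Rightarrow> ('x \<Rightarrow>\<^sub>0 'k) set" where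
  "qadd R A B = qclass R (rep A + rep B)"

definition qscale :: "('x \<Rightarrow>\<^sub>0 'k::field) set \<Rightarrow> 'k \<Rightarrow> ('x \<Rightarrow>\<^sub>0 'k) set \<Rightarrow> ('x \<Rightarrow>\<^sub>0 'k) set" where
  "qscale R c A = qclass R (fscale c (rep A))"

definition qsum :: "('x \<Rightarrow>\<^sub>0 'k::field) set \<Rightarrow> ('i \<Rightarrow> ('x \<Rightarrow>\<^sub>0 'k) set) \<Rightarrow> 'i set \<Rightarrow> ('x \<Rightarrow>\<^sub>0 'k) set" where
  "qsum R f I = qclass R (\<Sum>i\<in>I. rep (f i))"

text \<open>The linear map into the quotient by \<^term>\<open>R\<close> with the values \<^term>\<open>f\<close> on generators.\<close>

definition qmap :: "('y \<Rightarrow>\<^sub>0 'k::field) set \<Rightarrow> ('x \<Rightarrow> ('y \<Rightarrow>\<^sub>0 'k)) \<Rightarrow> ('x \<Rightarrow>\<^sub>0 'k) set \<Rightarrow> ('y \<Rightarrow>\<^sub>0 'k) set" where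
  "qmap R f A = qclass R (fbind (rep A) f)"


section \<open>Tensor powers and Hopf algebras\<close>

text \<open>The list \<^term>\<open>[h\<^sub>1, h\<^sub>2]\<close> stands for the pure tensor of its entries.\<close>

definition tensor_rels :: "('k::field \<Rightarrow> 'a::ab_group_add \<Rightarrow> 'a) \<Rightarrow> nat \<Rightarrow> ('a list \<Rightarrow>\<^sub>0 'k) set" where
  "tensor_rels s n =
     {gen (hs[i := a + b]) - gen (hs[i := a]) - gen (hs[i := b]) | hs i a b. length hs = n \<and> i < n}
   \<union> {gen (hs[i := s c a]) - fscale c (gen (hs[i := a])) | hs i c a. length hs = n \<and> i < n}"

definition tensor_power :: "('k::field \<Rightarrow> 'a::ab_group_add \<Rightarrow> 'a) \<Rightarrow> nat \<Rightarrow> ('a list \<Rightarrow>\<^sub>0 'k) set set" where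
  "tensor_power s n = qclass (tensor_rels s n) ` {t. \<forall>hs\<in>Poly_Mapping.keys t. length hs = n}"

record (overloaded) ('k, 'a) hopf =
  hscale :: "'k \<Rightarrow> 'a \<Rightarrow> 'a"
  hmult :: "'a \<Rightarrow> 'a \<Rightarrow> 'a"
  hone :: 'a
  comult :: "'a \<Rightarrow> ('a list \<Rightarrow>\<^sub>0 'k) set"
  counit :: "'a \<Rightarrow> 'k"
  antipode :: "'a \<Rightarrow> 'a"

abbreviation hrels :: "('k::field, 'a::ab_group_add) hopf \<Rightarrow> nat \<Rightarrow> ('a list \<Rightarrow>\<^sub>0 'k) set" where
  "hrels K n \<equiv> tensor_rels (hscale K) n"

locale hopf_algebra =
  fixes K :: "('k::field, 'a::ab_group_add) hopf"
  assumes vector_space: "vector_space (hscale K)"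
    and mult_add_left: "hmult K (a + b) c = hmult K a c + hmult K b c"
    and mult_add_right: "hmult K a (b + c) = hmult K a b + hmult K a c"
    and mult_scale_left: "hmult K (hscale K r a) b = hscale K r (hmult K a b)"
    and mult_scale_right: "hmult K a (hscale K r b) = hscale K r (hmult K a b)"
    and mult_assoc: "hmult K (hmult K a b) c = hmult K a (hmult K b c)"
    and mult_one_left: "hmult K (hone K) a = a"
    and mult_one_right: "hmult K a (hone K) = a"
    and comult_closed: "comult K a \<in> tensor_power (hscale K) 2"
    and comult_add: "comult K (a + b) = qadd (hrels K 2) (comult K a) (comult K b)"
    and comult_scale: "comult K (hscale K r a) = qscale (hrels K 2) r (comult K a)"
    and coassoc:
      "qmap (hrels K 3) (\<lambda>xs. fbind (rep (comult K (xs ! 0))) (\<lambda>ys. gen (ys @ [xs ! 1]))) (comult K a) =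
       qmap (hrels K 3) (\<lambda>xs. fbind (rep (comult K (xs ! 1))) (\<lambda>ys. gen ((xs ! 0) # ys))) (comult K a)"
    and counit_linear: "Vector_Spaces.linear (hscale K) (*) (counit K)"
    and counit_left: "lin_ext (hscale K) (\<lambda>xs. hscale K (counit K (xs ! 0)) (xs ! 1)) (rep (comult K a)) = a"
    and counit_right: "lin_ext (hscale K) (\<lambda>xs. hscale K (counit K (xs ! 1)) (xs ! 0)) (rep (comult K a)) = a"
    and comult_one: "comult K (hone K) = qclass (hrels K 2) (gen [hone K, hone K])"
    and comult_mult: "comult K (hmult K a b) =
      qmap (hrels K 2) (\<lambda>xs. fbind (rep (comult K b)) (\<lambda>ys. gen (map2 (hmult K) xs ys))) (comult K a)"
    and counit_one: "counit K (hone K) = 1"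
    and counit_mult: "counit K (hmult K a b) = counit K a * counit K b"
    and antipode_linear: "Vector_Spaces.linear (hscale K) (hscale K) (antipode K)"
    and antipode_left: "lin_ext (hscale K) (\<lambda>xs. hmult K (antipode K (xs ! 0)) (xs ! 1)) (rep (comult K a)) =
      hscale K (counit K a) (hone K)"
    and antipode_right: "lin_ext (hscale K) (\<lambda>xs. hmult K (xs ! 0) (antipode K (xs ! 1))) (rep (comult K a)) =
      hscale K (counit K a) (hone K)"

locale cocommutative_hopf_algebra = hopf_algebra +
  assumes cocommutative: "qmap (hrels K 2) (\<lambda>xs. gen (rev xs)) (comult K a) = comult K a"

text \<open>A formal sum representing the iterated coproduct
  \<open>h \<mapsto> h\<^sub>(\<^sub>1\<^sub>) \<otimes> \<dots> \<otimes> h\<^sub>(\<^sub>n\<^sub>)\<close>.\<close>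

fun icomult :: "('k::field, 'a) hopf \<Rightarrow> nat \<Rightarrow> 'a \<Rightarrow> ('a list \<Rightarrow>\<^sub>0 'k)" where
  "icomult K 0 h = Poly_Mapping.single [] (counit K h)"
| "icomult K (Suc 0) h = gen [h]"
| "icomult K (Suc (Suc n)) h =
     fbind (rep (comult K h)) (\<lambda>xs. fbind (icomult K (Suc n) (xs ! 1)) (\<lambda>ys. gen ((xs ! 0) # ys)))"


section \<open>Graded modules and balanced tensor products\<close>

record ('k, 'a, 'l) gmod =
  mscale :: "'k \<Rightarrow> 'l \<Rightarrow> 'l"
  mact :: "'a \<Rightarrow> 'l \<Rightarrow> 'l"
  mcomp :: "int \<Rightarrow> 'l set"

locale graded_left_module =
  fixes K :: "('k::field, 'a::ab_group_add) hopf" and M :: "('k, 'a, 'l::ab_group_add) gmod"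
  assumes vector_space: "vector_space (mscale M)"
    and act_add_left: "mact M (a + b) x = mact M a x + mact M b x"
    and act_add_right: "mact M a (x + y) = mact M a x + mact M a y"
    and act_scale_left: "mact M (hscale K r a) x = mscale M r (mact M a x)"
    and act_scale_right: "mact M a (mscale M r x) = mscale M r (mact M a x)"
    and act_one: "mact M (hone K) x = x"
    and act_mult: "mact M (hmult K a b) x = mact M a (mact M b x)"
    and comp_subspace: "module.subspace (mscale M) (mcomp M p)"
    and act_comp: "x \<in> mcomp M p \<Longrightarrow> mact M a x \<in> mcomp M p"
    and direct_sum: "\<exists>!y :: int \<Rightarrow>\<^sub>0 'l. (\<forall>p. Poly_Mapping.lookup y p \<in> mcomp M p) \<and>
          x = (\<Sum>p\<in>Poly_Mapping.keys y. Poly_Mapping.lookup y p)"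

definition regular_module :: "('k, 'a::zero) hopf \<Rightarrow> ('k, 'a, 'a) gmod" where
  "regular_module K =
     \<lparr>mscale = hscale K, mact = hmult K, mcomp = (\<lambda>p. if p = 0 then UNIV else {0})\<rparr>"

text \<open>The tensor product of the right \<^term>\<open>K\<close>-module given by the \<^term>\<open>n\<close>-th tensor power of
  \<^term>\<open>K\<close> with the left \<^term>\<open>K\<close>-module \<^term>\<open>M\<close>: generators are pairs \<^term>\<open>(hs, e)\<close>, the relations are
  multilinearity and balancedness over \<^term>\<open>K\<close>.\<close>

definition ptensor_rels ::
    "('k::field, 'a::ab_group_add) hopf \<Rightarrow> ('k, 'a, 'l::ab_group_add) gmod \<Rightarrow> nat
      \<Rightarrow> ('a list \<times> 'l \<Rightarrow>\<^sub>0 'k) set" where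
  "ptensor_rels K M n =
     {gen (hs[i := a + b], e) - gen (hs[i := a], e) - gen (hs[i := b], e) | hs i a b e. length hs = n \<and> i < n}
   \<union> {gen (hs[i := hscale K c a], e) - fscale c (gen (hs[i := a], e)) | hs i c a e. length hs = n \<and> i < n}
   \<union> {gen (hs, x + y) - gen (hs, x) - gen (hs, y) | hs x y. length hs = n}
   \<union> {gen (hs, mscale M c x) - fscale c (gen (hs, x)) | hs c x. length hs = n}
   \<union> {fbind (icomult K n h) (\<lambda>fs. gen (map2 (hmult K) hs fs, e)) - gen (hs, mact M h e) | hs h e. length hs = n}"

definition ptensor ::
    "('k::field, 'a::ab_group_add) hopf \<Rightarrow> ('k, 'a, 'l::ab_group_add) gmod \<Rightarrow> nat
      \<Rightarrow> ('a list \<times> 'l \<Rightarrow>\<^sub>0 'k) set set" where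
  "ptensor K M n = qclass (ptensor_rels K M n) ` {t. \<forall>(hs, e)\<in>Poly_Mapping.keys t. length hs = n}"

text \<open>\<^term>\<open>K\<close> itself sits in degree 0.\<close>

definition ptensor_comp ::
    "('k::field, 'a::ab_group_add) hopf \<Rightarrow> ('k, 'a, 'l::ab_group_add) gmod \<Rightarrow> nat \<Rightarrow> int
      \<Rightarrow> ('a list \<times> 'l \<Rightarrow>\<^sub>0 'k) set set" where
  "ptensor_comp K M n p = qclass (ptensor_rels K M n) `
     {t. \<forall>(hs, e)\<in>Poly_Mapping.keys t. length hs = n \<and> e \<in> mcomp M p}"

definition ptensor_lmult ::
    "('k::field, 'a::ab_group_add) hopf \<Rightarrow> ('k, 'a, 'l::ab_group_add) gmod \<Rightarrow> nat \<Rightarrow> 'a list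
      \<Rightarrow> ('a list \<times> 'l \<Rightarrow>\<^sub>0 'k) set \<Rightarrow> ('a list \<times> 'l \<Rightarrow>\<^sub>0 'k) set" where
  "ptensor_lmult K M n hs = qmap (ptensor_rels K M n) (\<lambda>(fs, e). gen (map2 (hmult K) hs fs, e))"

text \<open>The \<^term>\<open>j\<close>-th factor moves to position \<^term>\<open>\<sigma> j\<close>, hence the inverse.\<close>

definition ptensor_perm ::
    "('k::field, 'a::ab_group_add) hopf \<Rightarrow> ('k, 'a, 'l::ab_group_add) gmod \<Rightarrow> nat \<Rightarrow> (nat \<Rightarrow> nat)
      \<Rightarrow> ('a list \<times> 'l \<Rightarrow>\<^sub>0 'k) set \<Rightarrow> ('a list \<times> 'l \<Rightarrow>\<^sub>0 'k) set" where
  "ptensor_perm K M n \<sigma> = qmap (ptensor_rels K M n) (\<lambda>(fs, e). gen (permute_list (inv \<sigma>) fs, e))"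


section \<open>\<open>L\<^sub>\<infinity>\<close> pseudoalgebras\<close>

text \<open>Linear maps out of the \<^term>\<open>n\<close>-th tensor power of \<^term>\<open>M\<close> are given as multilinear maps on
  lists of length \<^term>\<open>n\<close>.\<close>

definition pHom ::
    "('k::field, 'a::ab_group_add) hopf \<Rightarrow> ('k, 'a, 'l::ab_group_add) gmod \<Rightarrow> int \<Rightarrow> nat
      \<Rightarrow> ('l list \<Rightarrow> ('a list \<times> 'l \<Rightarrow>\<^sub>0 'k) set) set" where
  "pHom K M p n = {\<phi>.
     \<phi> \<in> {xs. length xs = n} \<rightarrow>\<^sub>E ptensor K M n
   \<and> (\<forall>xs i x y. length xs = n \<and> i < n \<longrightarrow>
        \<phi> (xs[i := x + y]) = qadd (ptensor_rels K M n) (\<phi> (xs[i := x])) (\<phi> (xs[i := y])))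
   \<and> (\<forall>xs i c x. length xs = n \<and> i < n \<longrightarrow>
        \<phi> (xs[i := mscale M c x]) = qscale (ptensor_rels K M n) c (\<phi> (xs[i := x])))
   \<and> (\<forall>hs xs. length hs = n \<and> length xs = n \<longrightarrow>
        \<phi> (map2 (mact M) hs xs) = ptensor_lmult K M n hs (\<phi> xs))
   \<and> (\<forall>d xs. length xs = n \<and> (\<forall>i<n. xs ! i \<in> mcomp M (d i)) \<longrightarrow>
        \<phi> xs \<in> ptensor_comp K M n (p + (\<Sum>i<n. d i)))}"

text \<open>\<open>\<phi>(\<psi>(y\<^sub>1, \<dots>, y\<^sub>l), x\<^sub>2, \<dots>, x\<^sub>k)\<close> with \<^term>\<open>ys\<close> and \<^term>\<open>xs\<close> the lists of the \<open>y\<^sub>i\<close> and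
  the \<open>x\<^sub>i\<close>.\<close>

definition pcomp ::
    "('k::field, 'a::ab_group_add) hopf \<Rightarrow> ('k, 'a, 'l::ab_group_add) gmod
      \<Rightarrow> ('l list \<Rightarrow> ('a list \<times> 'l \<Rightarrow>\<^sub>0 'k) set) \<Rightarrow> ('l list \<Rightarrow> ('a list \<times> 'l \<Rightarrow>\<^sub>0 'k) set)
      \<Rightarrow> 'l list \<Rightarrow> 'l list \<Rightarrow> ('a list \<times> 'l \<Rightarrow>\<^sub>0 'k) set" where
  "pcomp K M \<phi> \<psi> ys xs = qmap (ptensor_rels K M (length ys + length xs))
     (\<lambda>(hs, e). fbind (rep (\<phi> (e # xs)))
       (\<lambda>(fs, e'). fbind (icomult K (length ys) (hd fs))
         (\<lambda>gs. gen (map2 (hmult K) hs gs @ tl fs, e'))))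
     (\<psi> ys)"

text \<open>Positions are counted from 0; \<^term>\<open>d i\<close> is the degree of the \<^term>\<open>i\<close>-th argument, so that
  \<^term>\<open>koszul_sign N d \<sigma>\<close> is the sign of reordering \<open>x\<^sub>0, \<dots>, x\<^bsub>N-1\<^esub>\<close> to
  \<open>x\<^bsub>\<sigma> 0\<^esub>, \<dots>, x\<^bsub>\<sigma> (N-1)\<^esub>\<close>, which is the list \<^term>\<open>permute_list \<sigma> xs\<close>.\<close>

definition koszul_sign :: "nat \<Rightarrow> (nat \<Rightarrow> int) \<Rightarrow> (nat \<Rightarrow> nat) \<Rightarrow> 'k::field" where
  "koszul_sign N d \<sigma> =
     (\<Prod>(i, j)\<in>{(i, j). i < j \<and> j < N \<and> \<sigma> j < \<sigma> i}. (-1) powi (d (\<sigma> i) * d (\<sigma> j)))"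

definition Sh :: "nat \<Rightarrow> nat \<Rightarrow> (nat \<Rightarrow> nat) set" where
  "Sh l m = {\<sigma>. \<sigma> permutes {..<l + m} \<and> strict_mono_on {..<l} \<sigma> \<and> strict_mono_on {l..<l + m} \<sigma>}"

definition L_infinity_structures ::
    "('k::field, 'a::ab_group_add) hopf \<Rightarrow> ('k, 'a, 'l::ab_group_add) gmod
      \<Rightarrow> (nat \<Rightarrow> 'l list \<Rightarrow> ('a list \<times> 'l \<Rightarrow>\<^sub>0 'k) set) set" where
  "L_infinity_structures K M = {\<beta>.
     \<beta> \<in> (\<Pi>\<^sub>E k\<in>{1..}. pHom K M (int k - 2) k)
   \<and> (\<forall>k\<ge>1. \<forall>\<sigma> d xs. \<sigma> permutes {..<k} \<and> length xs = k \<and> (\<forall>i<k. xs ! i \<in> mcomp M (d i)) \<longrightarrow>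
        \<beta> k xs = qscale (ptensor_rels K M k) (of_int (sign \<sigma>) * koszul_sign k d \<sigma>)
                   (ptensor_perm K M k \<sigma> (\<beta> k (permute_list \<sigma> xs))))
   \<and> (\<forall>N\<ge>1. \<forall>d xs. length xs = N \<and> (\<forall>i<N. xs ! i \<in> mcomp M (d i)) \<longrightarrow>
        qsum (ptensor_rels K M N)
          (\<lambda>((k, l), \<sigma>). qscale (ptensor_rels K M N)
             (of_int (sign \<sigma>) * koszul_sign N d \<sigma> * (-1) ^ (l * (k - 1)))
             (ptensor_perm K M N \<sigma>
               (pcomp K M (\<beta> k) (\<beta> l) (take l (permute_list \<sigma> xs)) (drop l (permute_list \<sigma> xs)))))
          (SIGMA (k, l) : {(k, l). 1 \<le> k \<and> 1 \<le> l \<and> k + l = N + 1}. Sh l (k - 1))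
        = qclass (ptensor_rels K M N) 0)}"


section \<open>The smash product\<close>

text \<open>Groups are types of class \<^class>\<open>group_add\<close>, which are not assumed to be commutative:
  \<^term>\<open>g + h\<close> is the product, \<^term>\<open>0\<close> the neutral element and \<^term>\<open>- g\<close> the inverse.\<close>

locale hopf_action = hopf_algebra H
  for H :: "('k::field, 'h::ab_group_add) hopf" +
  fixes act :: "'g::group_add \<Rightarrow> 'h \<Rightarrow> 'h"
  assumes act_zero: "act 0 f = f"
    and act_plus: "act (g + g') f = act g (act g' f)"
    and act_linear: "Vector_Spaces.linear (hscale H) (hscale H) (act g)"
    and act_hone: "act g (hone H) = hone H"
    and act_hmult: "act g (hmult H f f') = hmult H (act g f) (act g f')"
    and act_comult: "comult H (act g f) = qmap (hrels H 2) (\<lambda>xs. gen (map (act g) xs)) (comult H f)"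
    and act_counit: "counit H (act g f) = counit H f"
    and act_antipode: "antipode H (act g f) = act g (antipode H f)"

text \<open>The finitely supported function \<^term>\<open>Poly_Mapping.single g f\<close> is the element \<open>f g\<close>
  of the smash product.\<close>

definition smash ::
    "('k::field, 'h::ab_group_add) hopf \<Rightarrow> ('g::{group_add,finite} \<Rightarrow> 'h \<Rightarrow> 'h)
      \<Rightarrow> ('k, 'g \<Rightarrow>\<^sub>0 'h) hopf" where
  "smash H act =
     \<lparr>hscale = (\<lambda>c. Poly_Mapping.map (hscale H c)),
      hmult = (\<lambda>u v. \<Sum>g\<in>UNIV. \<Sum>g'\<in>UNIV. Poly_Mapping.single (g + g')
        (hmult H (Poly_Mapping.lookup u g) (act g (Poly_Mapping.lookup v g')))),
      hone = Poly_Mapping.single 0 (hone H),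
      comult = (\<lambda>u. qclass (tensor_rels (\<lambda>c. Poly_Mapping.map (hscale H c)) 2)
        (\<Sum>g\<in>UNIV. fbind (rep (comult H (Poly_Mapping.lookup u g)))
          (\<lambda>xs. gen (map (Poly_Mapping.single g) xs)))),
      counit = (\<lambda>u. \<Sum>g\<in>UNIV. counit H (Poly_Mapping.lookup u g)),
      antipode = (\<lambda>u. \<Sum>g\<in>UNIV. Poly_Mapping.single (- g)
        (act (- g) (antipode H (Poly_Mapping.lookup u g))))\<rparr>"

definition underlying_module ::
    "('k, 'g::group_add \<Rightarrow>\<^sub>0 'h::zero, 'l) gmod \<Rightarrow> ('k, 'h, 'l) gmod" where
  "underlying_module M =
     \<lparr>mscale = mscale M, mact = (\<lambda>f. mact M (Poly_Mapping.single 0 f)), mcomp = mcomp M\<rparr>"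

definition group_act ::
    "('k, 'h::zero) hopf \<Rightarrow> ('k, 'g \<Rightarrow>\<^sub>0 'h, 'l) gmod \<Rightarrow> 'g \<Rightarrow> 'l \<Rightarrow> 'l" where
  "group_act H M g x = mact M (Poly_Mapping.single g (hone H)) x"

definition ptensor_group_act ::
    "('k::field, 'h::ab_group_add) hopf \<Rightarrow> ('g::group_add \<Rightarrow> 'h \<Rightarrow> 'h)
      \<Rightarrow> ('k, 'g \<Rightarrow>\<^sub>0 'h, 'l::ab_group_add) gmod \<Rightarrow> nat \<Rightarrow> 'g
      \<Rightarrow> ('h list \<times> 'l \<Rightarrow>\<^sub>0 'k) set \<Rightarrow> ('h list \<times> 'l \<Rightarrow>\<^sub>0 'k) set" where
  "ptensor_group_act H act M k g = qmap (ptensor_rels H (underlying_module M) k)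
     (\<lambda>(fs, e). gen (map (act g) fs, group_act H M g e))"

definition equivariant ::
    "('k::field, 'h::ab_group_add) hopf \<Rightarrow> ('g::group_add \<Rightarrow> 'h \<Rightarrow> 'h)
      \<Rightarrow> ('k, 'g \<Rightarrow>\<^sub>0 'h, 'l::ab_group_add) gmod
      \<Rightarrow> (nat \<Rightarrow> 'l list \<Rightarrow> ('h list \<times> 'l \<Rightarrow>\<^sub>0 'k) set) \<Rightarrow> bool" where
  "equivariant H act M \<beta> \<longleftrightarrow> (\<forall>k\<ge>1. \<forall>xs g. length xs = k \<longrightarrow>
     \<beta> k (map (group_act H M g) xs) = ptensor_group_act H act M k g (\<beta> k xs))"


section \<open>The map \<open>\<delta>\<close>\<close>

text \<open>Values on pure tensors \<open>u\<^sub>1 \<otimes> \<dots> \<otimes> u\<^sub>k\<close> of arbitrary elements of the smash product, \<open>k \<ge> 1\<close>.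
  Expanding each \<open>u\<^sub>i\<close> as \<open>\<Sum>g. u\<^sub>i(g) g\<close>, only the terms with equal group elements survive.\<close>

definition delta_pure ::
    "('k::field, 'h::ab_group_add) hopf \<Rightarrow> ('g::{group_add,finite} \<Rightarrow> 'h \<Rightarrow> 'h) \<Rightarrow> ('g \<Rightarrow>\<^sub>0 'h) list
      \<Rightarrow> ('h list \<times> ('g \<Rightarrow>\<^sub>0 'h) \<Rightarrow>\<^sub>0 'k) set" where
  "delta_pure H act us =
     qclass (ptensor_rels H (underlying_module (regular_module (smash H act))) (length us))
       (\<Sum>g\<in>UNIV. gen (map (\<lambda>u. Poly_Mapping.lookup u g) us, Poly_Mapping.single g (hone H)))"

text \<open>The composite of \<open>\<phi>\<close>, \<open>\<delta>\<^sub>k \<otimes> id\<close> and the isomorphism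
  \<open>(F \<otimes> u) \<otimes> e \<mapsto> F \<otimes> u e\<close>.\<close>

definition delta ::
    "('k::field, 'h::ab_group_add) hopf \<Rightarrow> ('g::{group_add,finite} \<Rightarrow> 'h \<Rightarrow> 'h)
      \<Rightarrow> ('k, 'g \<Rightarrow>\<^sub>0 'h, 'l::ab_group_add) gmod \<Rightarrow> nat
      \<Rightarrow> ('l list \<Rightarrow> (('g \<Rightarrow>\<^sub>0 'h) list \<times> 'l \<Rightarrow>\<^sub>0 'k) set)
      \<Rightarrow> ('l list \<Rightarrow> ('h list \<times> 'l \<Rightarrow>\<^sub>0 'k) set)" where
  "delta H act M k \<phi> = (\<lambda>xs\<in>{xs. length xs = k}.
     qmap (ptensor_rels H (underlying_module M) k)
       (\<lambda>(us, e). fbind (rep (delta_pure H act us)) (\<lambda>(fs, u). gen (fs, mact M u e)))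
       (\<phi> xs))"

end

theory Submission
  imports Defs
begin

text \<open>Two cosets of a quotient of a free vector space are equal iff all linear forms that annihilate
  the relations agree on them. Tested against such forms, Sweedler notation becomes iterated
  evaluation of a scalar-valued multilinear function, and the choice of representatives disappears.

  A balanced form \<open>F\<close> over \<open>H\<close> pulls back along \<open>\<delta>\<close> to
  \<open>(u\<^sub>1 \<otimes> \<dots> \<otimes> u\<^sub>n) \<otimes> e \<mapsto> \<Sum>g. F ((u\<^sub>1(g) \<otimes> \<dots> \<otimes> u\<^sub>n(g)) \<otimes> g e)\<close>. Let \<open>\<iota>\<close> be the map
  induced by the inclusion of \<open>H\<close> into the smash product. Every \<open>v\<close> over the smash product satisfies
  \<open>v = \<Sum> (g\<^sub>1 \<otimes> \<dots> \<otimes> g\<^sub>n) \<iota> \<delta> ((g\<^sub>1\<^sup>-\<^sup>1 \<otimes> \<dots> \<otimes> g\<^sub>n\<^sup>-\<^sup>1) v)\<close>, summed over the tuples with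
  \<open>g\<^sub>1 = 1\<close>; so \<open>v\<close> is determined by the elements \<open>\<delta> ((g\<^sub>1 \<otimes> \<dots> \<otimes> g\<^sub>n) v)\<close>. For a multilinear map
  \<open>\<phi>\<close> over the smash product these are the values of \<open>\<delta> \<phi>\<close> at \<open>(g\<^sub>1 x\<^sub>1, \<dots>, g\<^sub>n x\<^sub>n)\<close>, hence
  \<open>\<delta>\<close> is injective and its inverse is
  \<open>(x\<^sub>1, \<dots>, x\<^sub>n) \<mapsto> \<Sum> (g\<^sub>1 \<otimes> \<dots> \<otimes> g\<^sub>n) \<iota> (\<beta> (g\<^sub>1\<^sup>-\<^sup>1 x\<^sub>1, \<dots>, g\<^sub>n\<^sup>-\<^sup>1 x\<^sub>n))\<close>. As \<open>\<delta>\<close> commutes with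
  composition and permutations, the identities over \<open>H\<close> and over the smash product are equivalent.\<close>

section \<open>Linear forms on quotients of free vector spaces\<close>

text \<open>Every operation on cosets goes through \<open>rep\<close>, an arbitrary choice, so a
  composite such as \<open>pcomp\<close> has no usable algebra of its own. A form may be evaluated
  on any representative once it is balanced; the work for each operation is therefore to show that
  the form pulled back along it is again balanced. Cocommutativity enters there for permutations,
  multiplicativity and coassociativity of the coproduct for compositions.

  The tuples with first entry 1 come from balancedness: translating all factors on the right by a
  group element a is the same as letting a act on e, so only the orbits of \<Gamma>^n under diagonal
  right translation matter. A sum over all tuples would give the wanted element multiplied by the
  order of \<Gamma>, which may be zero in the field. Equivariance makes each term of the inverse
  independent of the representative of its orbit; this is why the inverse is linear over the smash
  product exactly on the side where it is needed.

  Linear forms do not see degrees, so the degree conditions are handled with explicit homogeneous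
  representatives.\<close>

definition ev :: "('x \<Rightarrow>\<^sub>0 'k::field) \<Rightarrow> ('x \<Rightarrow> 'k) \<Rightarrow> 'k" where
  "ev t F = lin_ext (*) F t"

lemma ev_superset:
  assumes "finite S" "Poly_Mapping.keys t \<subseteq> S"
  shows "ev t F = (\<Sum>x\<in>S. Poly_Mapping.lookup t x * F x)"
  unfolding ev_def lin_ext_def
  by (rule sum.mono_neutral_left[OF assms]) (auto simp: in_keys_iff)

lemma ev_zero [simp]: "ev 0 F = 0"
  by (simp add: ev_def lin_ext_def)

lemma ev_single [simp]: "ev (Poly_Mapping.single x c) F = c * F x"
  by (subst ev_superset[of "{x}"]) auto

lemma ev_add: "ev (s + t) F = ev s F + ev t F"
proof -
  let ?S = "Poly_Mapping.keys s \<union> Poly_Mapping.keys t"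
  have "Poly_Mapping.keys (s + t) \<subseteq> ?S" by (rule Poly_Mapping.keys_add)
  then show ?thesis
    by (simp add: ev_superset[of ?S] lookup_add algebra_simps sum.distrib)
qed

lemma keys_fscale: "Poly_Mapping.keys (fscale c t) \<subseteq> Poly_Mapping.keys t"
  by (auto simp: in_keys_iff)

lemma ev_fscale: "ev (fscale c t) F = c * ev t F"
  unfolding ev_superset[OF finite_keys keys_fscale, of c t F]
    ev_superset[OF finite_keys subset_refl, of t F]
  by (simp add: sum_distrib_left mult.assoc)

lemma fscale_minus_one: "fscale (- 1) t = - t"
  by (rule poly_mapping_eqI) simp

lemma ev_minus: "ev (- t) F = - ev t F"
  using ev_fscale[of "- 1" t F] by (simp add: fscale_minus_one)

lemma ev_diff: "ev (s - t) F = ev s F - ev t F"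
  using ev_add[of s "- t" F] by (simp add: ev_minus)

lemma ev_sum: "ev (\<Sum>i\<in>I. t i) F = (\<Sum>i\<in>I. ev (t i) F)"
  by (induction I rule: infinite_finite_induct) (auto simp: ev_add)

lemma ev_fbind: "ev (fbind t f) F = ev t (\<lambda>x. ev (f x) F)"
  unfolding lin_ext_def ev_sum ev_fscale by (simp add: ev_def lin_ext_def)

lemma ev_cong: "(\<And>x. x \<in> Poly_Mapping.keys t \<Longrightarrow> F x = G x) \<Longrightarrow> ev t F = ev t G"
  by (simp add: ev_def lin_ext_def)

lemma ev_add_fun: "ev t (\<lambda>x. F x + G x) = ev t F + ev t G"
  by (simp add: ev_def lin_ext_def algebra_simps sum.distrib)

lemma ev_scale_fun: "ev t (\<lambda>x. c * F x) = c * ev t F"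
  by (simp add: ev_def lin_ext_def sum_distrib_left algebra_simps)

lemma ev_sum_fun: "ev t (\<lambda>x. \<Sum>i\<in>I. F i x) = (\<Sum>i\<in>I. ev t (F i))"
  unfolding ev_def lin_ext_def sum_distrib_left by (rule sum.swap)

lemma ev_swap: "ev t (\<lambda>x. ev u (\<lambda>y. F x y)) = ev u (\<lambda>y. ev t (\<lambda>x. F x y))"
  unfolding ev_def lin_ext_def sum_distrib_left
  by (subst sum.swap) (simp add: algebra_simps)

lemma keys_fbind:
  "Poly_Mapping.keys (fbind t f) \<subseteq> (\<Union>x\<in>Poly_Mapping.keys t. Poly_Mapping.keys (f x))"
proof -
  have "Poly_Mapping.keys (fbind t f)
      \<subseteq> (\<Union>x\<in>Poly_Mapping.keys t. Poly_Mapping.keys (fscale (Poly_Mapping.lookup t x) (f x)))"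
    unfolding lin_ext_def by (rule Poly_Mapping.keys_sum)
  then show ?thesis using keys_fscale by fastforce
qed

section \<open>Separation of the points of a quotient by linear forms\<close>

definition annihilates :: "('x \<Rightarrow>\<^sub>0 'k::field) set \<Rightarrow> ('x \<Rightarrow> 'k) \<Rightarrow> bool" where
  "annihilates R F \<longleftrightarrow> (\<forall>t\<in>R. ev t F = 0)"

lemma annihilates_span:
  assumes "annihilates R F" "t \<in> free.span R"
  shows "ev t F = 0"
  using assms(2)
proof (induction rule: free.span_induct_alt)
  case base
  show ?case by simp
next
  case (step c x y)
  then show ?case using assms(1) by (simp add: annihilates_def ev_add ev_fscale)
qed

text \<open>A maximal independent subset B of \<open>R\<close> has the same span, so a vector t
  outside it makes \<open>insert t B\<close> independent, and a linear form can be prescribed to be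
  1 at t and 0 on B. Composed with \<open>gen\<close> it annihilates \<open>R\<close> without
  vanishing at t.\<close>

lemma span_separation:
  assumes "\<And>F. annihilates R F \<Longrightarrow> ev t F = 0"
  shows "t \<in> free.span R"
proof (rule ccontr)
  assume t: "t \<notin> free.span R"
  interpret pair: vector_space_pair "fscale :: 'b \<Rightarrow> ('a \<Rightarrow>\<^sub>0 'b) \<Rightarrow> _" "(*) :: 'b \<Rightarrow> _"
    by unfold_locales (auto simp: algebra_simps)
  obtain B where B: "B \<subseteq> R" "free.independent B" "R \<subseteq> free.span B"
    using free.maximal_independent_subset[of R] by blast
  have "free.span R = free.span B"
    using B by (metis free.span_mono free.span_span subset_antisym)
  then have "free.independent (insert t B)"
    using B t by (simp add: free.independent_insertI)
  then obtain g where g: "Vector_Spaces.linear fscale (*) g"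
    and gB: "\<And>x. x \<in> insert t B \<Longrightarrow> g x = (if x = t then 1 else 0)"
    using pair.linear_independent_extend[of "insert t B" "\<lambda>x. if x = t then 1 else 0"] by blast
  interpret g: Vector_Spaces.linear fscale "(*)" g by (rule g)
  \<comment> \<open>A linear form on a free space is evaluation against its values on generators, so
    the abstract form g is of the kind that \<open>ev\<close> handles.\<close>
  have ev_g: "ev u (\<lambda>x. g (gen x)) = g u" for u
  proof -
    have "u = (\<Sum>x\<in>Poly_Mapping.keys u. fscale (Poly_Mapping.lookup u x) (gen x))"
      by (rule poly_mapping_eqI)
        (simp add: lookup_sum lookup_single when_def in_keys_iff if_distrib[of "\<lambda>c. _ * c"] cong: if_cong)
    then have "g u = g (\<Sum>x\<in>Poly_Mapping.keys u. fscale (Poly_Mapping.lookup u x) (gen x))"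
      by simp
    then show ?thesis by (simp only: g.sum g.scale ev_def lin_ext_def)
  qed
  have tB: "t \<notin> B" using t B(1) free.span_base by blast
  have "g u = 0" if "u \<in> free.span B" for u
    using that
  proof (induction rule: free.span_induct_alt)
    case base
    show ?case by (rule g.zero)
  next
    case (step c x y)
    then show ?case using gB[of x] tB by (auto simp: g.add g.scale)
  qed
  then have "annihilates R (\<lambda>x. g (gen x))"
    using B(3) unfolding annihilates_def ev_g by blast
  from assms[OF this] show False
    unfolding ev_g using gB[of t] by simp
qed

lemma qclass_eq_iff: "qclass R t = qclass R u \<longleftrightarrow> t - u \<in> free.span R"
proof
  assume "qclass R t = qclass R u"
  moreover have "t \<in> qclass R t" by (simp add: qclass_def free.span_zero)
  ultimately show "t - u \<in> free.span R" by (auto simp: qclass_def)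
next
  assume *: "t - u \<in> free.span R"
  have "v - t \<in> free.span R \<longleftrightarrow> v - u \<in> free.span R" for v
  proof -
    have "v - u = (v - t) + (t - u)" "v - t = (v - u) - (t - u)" by simp_all
    then show ?thesis using * free.span_add free.span_diff by metis
  qed
  then show "qclass R t = qclass R u" by (simp add: qclass_def)
qed

lemma rep_qclass: "rep (qclass R t) - t \<in> free.span R"
proof -
  have "rep (qclass R t) \<in> qclass R t"
    unfolding rep_def by (rule someI[of _ t]) (simp add: qclass_def free.span_zero)
  then show ?thesis by (simp add: qclass_def)
qed

text \<open>\<^term>\<open>qev A F\<close> is the value at the coset \<^term>\<open>A\<close> of the linear form on the quotient that
  \<^term>\<open>F\<close> induces; it is only meaningful when \<^term>\<open>F\<close> annihilates the relations.\<close>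

definition qev :: "('x \<Rightarrow>\<^sub>0 'k::field) set \<Rightarrow> ('x \<Rightarrow> 'k) \<Rightarrow> 'k" where
  "qev A F = ev (rep A) F"

lemma qev_qclass: "annihilates R F \<Longrightarrow> qev (qclass R t) F = ev t F"
  using annihilates_span[OF _ rep_qclass[of R t], of F] by (simp add: qev_def ev_diff)

lemma qev_qadd: "annihilates R F \<Longrightarrow> qev (qadd R A B) F = qev A F + qev B F"
  by (simp add: qadd_def qev_qclass ev_add) (simp add: qev_def)

lemma qev_qscale: "annihilates R F \<Longrightarrow> qev (qscale R c A) F = c * qev A F"
  by (simp add: qscale_def qev_qclass ev_fscale) (simp add: qev_def)

lemma qev_qsum: "annihilates R F \<Longrightarrow> qev (qsum R f I) F = (\<Sum>i\<in>I. qev (f i) F)"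
  by (simp add: qsum_def qev_qclass ev_sum) (simp add: qev_def)

lemma qev_qmap: "annihilates R F \<Longrightarrow> qev (qmap R f A) F = qev A (\<lambda>x. ev (f x) F)"
  by (simp add: qmap_def qev_qclass ev_fbind) (simp add: qev_def)

text \<open>The way in which identities between cosets are proved below. The range conditions are
  there because a set that is not a coset cannot be recovered from the values of
  \<open>qev\<close>.\<close>

lemma qclass_eqI:
  assumes "A \<in> range (qclass R)" "B \<in> range (qclass R)"
    and "\<And>F. annihilates R F \<Longrightarrow> qev A F = qev B F"
  shows "A = B"
proof -
  obtain t u where tu: "A = qclass R t" "B = qclass R u" using assms by blast
  have "t - u \<in> free.span R"
  proof (rule span_separation)
    fix F assume "annihilates R F"
    then show "ev (t - u) F = 0" using assms(3)[of F] by (simp add: tu qev_qclass ev_diff)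
  qed
  then show ?thesis by (simp add: tu qclass_eq_iff)
qed

lemma qop_range [simp]:
  "qclass R t \<in> range (qclass R)" "qadd R A B \<in> range (qclass R)" "qscale R c A \<in> range (qclass R)"
  "qsum R f I \<in> range (qclass R)" "qmap R g C \<in> range (qclass R)"
  by (auto simp: qadd_def qscale_def qsum_def qmap_def)

text \<open>\<open>rep\<close> is an arbitrary choice, but two representatives differ by a
  combination of relations; when these involve only generators in S, no other generator can enter.
  This is how the lengths of lists in chosen representatives are known.\<close>

lemma keys_rep_qclass:
  assumes "\<And>r. r \<in> R \<Longrightarrow> Poly_Mapping.keys r \<subseteq> S" "Poly_Mapping.keys t \<subseteq> S"
  shows "Poly_Mapping.keys (rep (qclass R t)) \<subseteq> S"
proof -
  have span: "Poly_Mapping.keys u \<subseteq> S" if "u \<in> free.span R" for u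
    using that
  proof (induction rule: free.span_induct_alt)
    case base
    show ?case by simp
  next
    case (step c x y)
    then show ?case
      using assms(1)[of x] keys_fscale[of c x] Poly_Mapping.keys_add[of "fscale c x" y] by blast
  qed
  have "rep (qclass R t) = (rep (qclass R t) - t) + t" by simp
  then show ?thesis
    using span[OF rep_qclass[of R t]] assms(2) Poly_Mapping.keys_add[of "rep (qclass R t) - t" t]
    by (metis (no_types, lifting) Un_least subset_trans)
qed


section \<open>Multilinear forms\<close>

definition linear_form :: "('k::field \<Rightarrow> 'a::ab_group_add \<Rightarrow> 'a) \<Rightarrow> ('a \<Rightarrow> 'k) \<Rightarrow> bool" where
  "linear_form s f \<longleftrightarrow> (\<forall>x y. f (x + y) = f x + f y) \<and> (\<forall>c x. f (s c x) = c * f x)"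

text \<open>Slots are singled out by splitting the list instead of updating it, which fits the
  \<open>Cons\<close> recursion of \<open>icomult\<close>; \<open>multilinear_iff_update\<close>
  gives the form in which the tensor relations are stated. For n = 0 every function
  qualifies.\<close>

definition multilinear :: "('k::field \<Rightarrow> 'a::ab_group_add \<Rightarrow> 'a) \<Rightarrow> nat \<Rightarrow> ('a list \<Rightarrow> 'k) \<Rightarrow> bool" where
  "multilinear s n F \<longleftrightarrow>
     (\<forall>as bs. length as + Suc (length bs) = n \<longrightarrow> linear_form s (\<lambda>x. F (as @ x # bs)))"

lemma linear_formI:
  "(\<And>x y. f (x + y) = f x + f y) \<Longrightarrow> (\<And>c x. f (s c x) = c * f x) \<Longrightarrow> linear_form s f"
  by (simp add: linear_form_def)

lemma linear_form_add: "linear_form s f \<Longrightarrow> f (x + y) = f x + f y"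
  and linear_form_scale: "linear_form s f \<Longrightarrow> f (s c x) = c * f x"
  by (auto simp: linear_form_def)

lemma linear_form_zero: "linear_form s f \<Longrightarrow> f 0 = 0"
  by (metis add_cancel_left_right linear_form_add)

lemma linear_form_sum: "linear_form s f \<Longrightarrow> f (\<Sum>i\<in>I. x i) = (\<Sum>i\<in>I. f (x i))"
  by (induction I rule: infinite_finite_induct) (auto simp: linear_form_add linear_form_zero)

text \<open>Linearity is assumed only on the support of t, because the inner functions are known to
  be linear only for lists of the right length, and lengths are known only on the support.\<close>

lemma linear_form_ev:
  assumes "\<And>y. y \<in> Poly_Mapping.keys t \<Longrightarrow> linear_form s (\<lambda>x. G x y)"
  shows "linear_form s (\<lambda>x. ev t (G x))"
proof (rule linear_formI)
  fix a b
  have "ev t (G (a + b)) = ev t (\<lambda>y. G a y + G b y)"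
    by (rule ev_cong) (rule linear_form_add[OF assms])
  then show "ev t (G (a + b)) = ev t (G a) + ev t (G b)" by (simp add: ev_add_fun)
next
  fix c a
  have "ev t (G (s c a)) = ev t (\<lambda>y. c * G a y)"
    by (rule ev_cong) (rule linear_form_scale[OF assms])
  then show "ev t (G (s c a)) = c * ev t (G a)" by (simp add: ev_scale_fun)
qed

lemma linear_form_sum_fun:
  "(\<And>i. i \<in> I \<Longrightarrow> linear_form s (F i)) \<Longrightarrow> linear_form s (\<lambda>x. \<Sum>i\<in>I. F i x)"
  by (simp add: linear_form_def sum.distrib sum_distrib_left)

lemma multilinearI:
  "(\<And>as bs. length as + Suc (length bs) = n \<Longrightarrow> linear_form s (\<lambda>x. F (as @ x # bs))) \<Longrightarrow> multilinear s n F"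
  by (simp add: multilinear_def)

lemma multilinearD:
  "multilinear s n F \<Longrightarrow> length as + Suc (length bs) = n \<Longrightarrow> linear_form s (\<lambda>x. F (as @ x # bs))"
  by (simp add: multilinear_def)

lemma multilinear_update:
  "multilinear s n F \<Longrightarrow> length hs = n \<Longrightarrow> i < n \<Longrightarrow> linear_form s (\<lambda>x. F (hs[i := x]))"
  by (simp add: multilinear_def upd_conv_take_nth_drop)

lemma multilinear_iff_update:
  fixes F :: "'a::ab_group_add list \<Rightarrow> 'k::field"
  shows "multilinear s n F \<longleftrightarrow> (\<forall>hs i. length hs = n \<and> i < n \<longrightarrow> linear_form s (\<lambda>x. F (hs[i := x])))"
  (is "_ \<longleftrightarrow> ?R")
proof
  assume ?R
  show "multilinear s n F"
  proof (rule multilinearI)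
    fix as bs :: "'a list" assume *: "length as + Suc (length bs) = n"
    then have "linear_form s (\<lambda>x. F ((as @ 0 # bs)[length as := x]))"
      using \<open>?R\<close>[rule_format, of "as @ 0 # bs" "length as"] by simp
    then show "linear_form s (\<lambda>x. F (as @ x # bs))" by simp
  qed
qed (simp add: multilinear_update)

lemma multilinear_two_I:
  fixes F :: "'a::ab_group_add list \<Rightarrow> 'k::field"
  assumes "\<And>b. linear_form s (\<lambda>a. F [a, b])" "\<And>a. linear_form s (\<lambda>b. F [a, b])"
  shows "multilinear s 2 F"
proof (rule multilinearI)
  fix as bs :: "'a list" assume "length as + Suc (length bs) = 2"
  then consider b where "as = []" "bs = [b]" | a where "as = [a]" "bs = []"
    by (cases as; cases bs) (auto simp: length_Suc_conv)
  then show "linear_form s (\<lambda>x. F (as @ x # bs))" by cases (use assms in simp_all)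
qed

lemma multilinear_three_I:
  fixes F :: "'a::ab_group_add list \<Rightarrow> 'k::field"
  assumes "\<And>b c. linear_form s (\<lambda>a. F [a, b, c])" "\<And>a c. linear_form s (\<lambda>b. F [a, b, c])"
    "\<And>a b. linear_form s (\<lambda>c. F [a, b, c])"
  shows "multilinear s 3 F"
proof (rule multilinearI)
  fix as bs :: "'a list" assume *: "length as + Suc (length bs) = 3"
  then consider b c where "as = []" "bs = [b, c]" | a c where "as = [a]" "bs = [c]"
    | a b where "as = [a, b]" "bs = []"
    by (cases as; cases bs; cases "tl as"; cases "tl bs") auto
  then show "linear_form s (\<lambda>x. F (as @ x # bs))" by cases (use assms in simp_all)
qed

lemma multilinear_Cons: "multilinear s (Suc n) F \<Longrightarrow> multilinear s n (\<lambda>xs. F (a # xs))"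
  by (rule multilinearI, drule multilinearD[where as = "a # _"]) auto

lemma multilinear_append1:
  fixes F :: "'a::ab_group_add list \<Rightarrow> 'k::field"
  shows "multilinear s (m + length zs) F \<Longrightarrow> multilinear s m (\<lambda>xs. F (xs @ zs))"
proof (rule multilinearI)
  fix as bs :: "'a list" assume "multilinear s (m + length zs) F" "length as + Suc (length bs) = m"
  then show "linear_form s (\<lambda>x. F ((as @ x # bs) @ zs))"
    using multilinearD[of s "m + length zs" F as "bs @ zs"] by simp
qed

lemma multilinear_append2:
  fixes F :: "'a::ab_group_add list \<Rightarrow> 'k::field"
  shows "multilinear s (length ys + m) F \<Longrightarrow> multilinear s m (\<lambda>xs. F (ys @ xs))"
proof (rule multilinearI)
  fix as bs :: "'a list" assume "multilinear s (length ys + m) F" "length as + Suc (length bs) = m"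
  then show "linear_form s (\<lambda>x. F (ys @ as @ x # bs))"
    using multilinearD[of s "length ys + m" F "ys @ as" bs] by simp
qed

lemma multilinear_hd: "multilinear s (Suc n) F \<Longrightarrow> length xs = n \<Longrightarrow> linear_form s (\<lambda>a. F (a # xs))"
  using multilinearD[of s "Suc n" F "[]" xs] by simp

lemma multilinear_one: "multilinear s 1 F \<Longrightarrow> linear_form s (\<lambda>a. F [a])"
  using multilinear_hd[of s 0 F "[]"] by simp

lemma multilinear_ev:
  assumes "\<And>y. y \<in> Poly_Mapping.keys t \<Longrightarrow> multilinear s n (\<lambda>xs. G xs y)"
  shows "multilinear s n (\<lambda>xs. ev t (G xs))"
  by (rule multilinearI, rule linear_form_ev, rule multilinearD[OF assms])

lemma multilinear_sum_fun:
  "(\<And>i. i \<in> I \<Longrightarrow> multilinear s n (F i)) \<Longrightarrow> multilinear s n (\<lambda>x. \<Sum>i\<in>I. F i x)"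
  by (rule multilinearI, rule linear_form_sum_fun, rule multilinearD)

lemma multilinear_map:
  fixes F :: "'b::ab_group_add list \<Rightarrow> 'k::field" and s :: "'k \<Rightarrow> 'a::ab_group_add \<Rightarrow> 'a"
  assumes "multilinear s' n F" "\<And>x y. p (x + y) = p x + p y" "\<And>c x. p (s c x) = s' c (p x)"
  shows "multilinear s n (\<lambda>xs. F (map p xs))"
proof (rule multilinearI)
  fix as bs :: "'a list" assume "length as + Suc (length bs) = n"
  then have "linear_form s' (\<lambda>x. F (map p as @ x # map p bs))"
    by (intro multilinearD[OF assms(1)]) simp
  then have "linear_form s (\<lambda>x. F (map p as @ p x # map p bs))"
    unfolding linear_form_def assms(2,3) by blast
  then show "linear_form s (\<lambda>x. F (map p (as @ x # bs)))" by simp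
qed

lemma multilinear_map2:
  fixes F :: "'b::ab_group_add list \<Rightarrow> 'k::field" and s :: "'k \<Rightarrow> 'a::ab_group_add \<Rightarrow> 'a"
  assumes "multilinear s' n F" "length hs = n"
    and "\<And>h x y. p h (x + y) = p h x + p h y" "\<And>h c x. p h (s c x) = s' c (p h x)"
  shows "multilinear s n (\<lambda>xs. F (map2 p hs xs))"
proof (rule multilinearI)
  fix as bs :: "'a list" assume *: "length as + Suc (length bs) = n"
  then have hs: "hs = take (length as) hs @ hs ! length as # drop (Suc (length as)) hs"
    using assms(2) by (simp add: id_take_nth_drop)
  have eq: "map2 p hs (as @ x # bs) =
      map2 p (take (length as) hs) as @ p (hs ! length as) x # map2 p (drop (Suc (length as)) hs) bs" for x
    using * assms(2) by (subst hs) (simp add: zip_append)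
  have "linear_form s' (\<lambda>x. F (map2 p (take (length as) hs) as @ x # map2 p (drop (Suc (length as)) hs) bs))"
    using * assms(2) by (intro multilinearD[OF assms(1)]) auto
  then show "linear_form s (\<lambda>x. F (map2 p hs (as @ x # bs)))"
    unfolding eq linear_form_def assms(3,4) by blast
qed

lemma map2_swap: "map2 p xs ys = map2 (\<lambda>y x. p x y) ys xs"
  by (induction xs ys rule: list_induct2') auto

lemma multilinear_map2_left:
  assumes "multilinear s' n F" "length hs = n"
    and "\<And>h x y. p (x + y) h = p x h + p y h" "\<And>h c x. p (s c x) h = s' c (p x h)"
  shows "multilinear s n (\<lambda>xs. F (map2 p xs hs))"
  unfolding map2_swap[of p] by (rule multilinear_map2[OF assms(1,2)]) (simp_all add: assms)

text \<open>\<open>permute_list \<sigma> xs\<close> has the entry \<open>xs ! \<sigma> j\<close> at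
  position j, so entry i of \<open>xs\<close> ends up at position
  \<open>inv \<sigma> i\<close>.\<close>

lemma permute_list_update:
  assumes "\<sigma> permutes {..<length xs}" "i < length xs"
  shows "permute_list \<sigma> (xs[i := x]) = (permute_list \<sigma> xs)[inv \<sigma> i := x]"
proof (rule nth_equalityI)
  fix j assume "j < length (permute_list \<sigma> (xs[i := x]))"
  then have j: "j < length xs" by simp
  have "\<sigma> j < length xs" using permutes_in_image[OF assms(1)] j by simp
  moreover have "inv \<sigma> i = j \<longleftrightarrow> i = \<sigma> j" using permutes_inv_eq[OF assms(1), of i j] by auto
  ultimately show "permute_list \<sigma> (xs[i := x]) ! j = (permute_list \<sigma> xs)[inv \<sigma> i := x] ! j"
    using j assms by (auto simp: permute_list_nth nth_list_update)
qed simp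

lemma multilinear_permute:
  assumes "multilinear s n F" "\<sigma> permutes {..<n}"
  shows "multilinear s n (\<lambda>xs. F (permute_list \<sigma> xs))"
  unfolding multilinear_iff_update
proof (intro allI impI)
  fix hs :: "'b list" and i assume *: "length hs = n \<and> i < n"
  have "inv \<sigma> i < n" using permutes_in_image[OF permutes_inv[OF assms(2)]] * by simp
  then show "linear_form s (\<lambda>x. F (permute_list \<sigma> (hs[i := x])))"
    using multilinear_update[OF assms(1), of "permute_list \<sigma> hs" "inv \<sigma> i"] * assms(2)
    by (simp add: permute_list_update)
qed

text \<open>The universal property of the tensor power in dual form; it allows coset identities of
  coproducts to be tested against multilinear functions.\<close>

lemma annihilates_tensor_rels: "annihilates (tensor_rels s n) F \<longleftrightarrow> multilinear s n F"
proof -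
  have "annihilates (tensor_rels s n) F \<longleftrightarrow>
     (\<forall>hs i a b. length hs = n \<and> i < n \<longrightarrow>
        ev (gen (hs[i := a + b]) - gen (hs[i := a]) - gen (hs[i := b])) F = 0) \<and>
     (\<forall>hs i c a. length hs = n \<and> i < n \<longrightarrow>
        ev (gen (hs[i := s c a]) - fscale c (gen (hs[i := a]))) F = 0)"
    unfolding annihilates_def tensor_rels_def ball_Un by blast
  also have "\<dots> \<longleftrightarrow>
     (\<forall>hs i a b. length hs = n \<and> i < n \<longrightarrow> F (hs[i := a + b]) = F (hs[i := a]) + F (hs[i := b])) \<and>
     (\<forall>hs i c a. length hs = n \<and> i < n \<longrightarrow> F (hs[i := s c a]) = c * F (hs[i := a]))"
    unfolding ev_diff ev_fscale ev_single by (simp add: diff_diff_eq)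
  also have "\<dots> \<longleftrightarrow> multilinear s n F"
    unfolding multilinear_iff_update linear_form_def by blast
  finally show ?thesis .
qed

lemma keys_subset_diff:
  "Poly_Mapping.keys a \<subseteq> S \<Longrightarrow> Poly_Mapping.keys b \<subseteq> S \<Longrightarrow> Poly_Mapping.keys (a - b) \<subseteq> S"
  using Poly_Mapping.keys_diff[of a b] by blast

lemma keys_subset_gen: "x \<in> S \<Longrightarrow> Poly_Mapping.keys (Poly_Mapping.single x c) \<subseteq> S"
  using keys_single[of x c] by auto

lemmas keys_subset_intros = keys_subset_diff keys_subset_gen keys_fscale[THEN order_trans]

lemma keys_tensor_rels: "r \<in> tensor_rels s n \<Longrightarrow> Poly_Mapping.keys r \<subseteq> {hs. length hs = n}"
  unfolding tensor_rels_def by (elim UnE CollectE exE conjE; hypsubst; intro keys_subset_intros) simp_all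

lemma rep_tensor_power: "A \<in> tensor_power s n \<Longrightarrow> Poly_Mapping.keys (rep A) \<subseteq> {hs. length hs = n}"
  unfolding tensor_power_def
  by (elim imageE, hypsubst, rule keys_rep_qclass[OF keys_tensor_rels]) auto


section \<open>Iterated coproducts\<close>

text \<open>The coalgebra laws are stated after pairing with multilinear forms, so each law is an
  equation between scalars that rewrites nested evaluations. The locale is instantiated both by
  \<open>H\<close> and by the smash product.\<close>

locale cocomm_bialgebra =
  fixes K :: "('k::field, 'a::ab_group_add) hopf"
  assumes mult_add_left: "hmult K (a + b) c = hmult K a c + hmult K b c"
    and mult_add_right: "hmult K a (b + c) = hmult K a b + hmult K a c"
    and mult_scale_left: "hmult K (hscale K r a) b = hscale K r (hmult K a b)"
    and mult_scale_right: "hmult K a (hscale K r b) = hscale K r (hmult K a b)"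
    and mult_assoc: "hmult K (hmult K a b) c = hmult K a (hmult K b c)"
    and mult_one_left: "hmult K (hone K) a = a"
    and comult_length: "xs \<in> Poly_Mapping.keys (rep (comult K a)) \<Longrightarrow> length xs = 2"
    and comult_linear: "multilinear (hscale K) 2 F \<Longrightarrow> linear_form (hscale K) (\<lambda>a. ev (rep (comult K a)) F)"
    and comult_coassoc: "multilinear (hscale K) 3 F \<Longrightarrow>
      ev (rep (comult K a)) (\<lambda>xs. ev (rep (comult K (xs ! 0))) (\<lambda>ys. F (ys @ [xs ! 1]))) =
      ev (rep (comult K a)) (\<lambda>xs. ev (rep (comult K (xs ! 1))) (\<lambda>ys. F (xs ! 0 # ys)))"
    and comult_mult: "multilinear (hscale K) 2 F \<Longrightarrow> ev (rep (comult K (hmult K a b))) F =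
      ev (rep (comult K a)) (\<lambda>xs. ev (rep (comult K b)) (\<lambda>ys. F (map2 (hmult K) xs ys)))"
    and comult_cocomm: "multilinear (hscale K) 2 F \<Longrightarrow>
      ev (rep (comult K a)) (\<lambda>xs. F (rev xs)) = ev (rep (comult K a)) F"
begin

abbreviation cop :: "'a \<Rightarrow> ('a list \<Rightarrow> 'k) \<Rightarrow> 'k" where
  "cop a F \<equiv> ev (rep (comult K a)) F"

abbreviation icop :: "nat \<Rightarrow> 'a \<Rightarrow> ('a list \<Rightarrow> 'k) \<Rightarrow> 'k" where
  "icop n a F \<equiv> ev (icomult K n a) F"

abbreviation mlin :: "nat \<Rightarrow> ('a list \<Rightarrow> 'k) \<Rightarrow> bool" where
  "mlin \<equiv> multilinear (hscale K)"

abbreviation lmul :: "'a list \<Rightarrow> 'a list \<Rightarrow> 'a list" where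
  "lmul \<equiv> map2 (hmult K)"

lemma mlin_lmul_right: "mlin n F \<Longrightarrow> length hs = n \<Longrightarrow> mlin n (\<lambda>xs. F (lmul hs xs))"
  by (rule multilinear_map2) (simp_all add: mult_add_right mult_scale_right)

lemma mlin_lmul_left: "mlin n F \<Longrightarrow> length hs = n \<Longrightarrow> mlin n (\<lambda>xs. F (lmul xs hs))"
  by (rule multilinear_map2_left) (simp_all add: mult_add_left mult_scale_left)

lemma lmul_assoc: "lmul (lmul xs ys) zs = lmul xs (lmul ys zs)"
proof (induction xs arbitrary: ys zs)
  case (Cons x xs)
  then show ?case by (cases ys; cases zs) (auto simp: mult_assoc)
qed simp

lemma lmul_ones: "length xs = n \<Longrightarrow> lmul (replicate n (hone K)) xs = xs"
  by (induction xs arbitrary: n) (auto simp: mult_one_left)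

lemma comult_keysE:
  assumes "xs \<in> Poly_Mapping.keys (rep (comult K a))"
  obtains x y where "xs = [x, y]"
  using comult_length[OF assms] by (auto simp: numeral_2_eq_2 length_Suc_conv)

lemma icomult_length: "ws \<in> Poly_Mapping.keys (icomult K n h) \<Longrightarrow> length ws = n"
proof (induction n arbitrary: h ws)
  case (Suc n)
  show ?case
  proof (cases n)
    case (Suc m)
    with Suc.prems obtain xs where
      "ws \<in> Poly_Mapping.keys (fbind (icomult K n (xs ! 1)) (\<lambda>ys. gen (xs ! 0 # ys)))"
      using keys_fbind[where t = "rep (comult K h)"] by (fastforce simp del: One_nat_def)
    then obtain ys where "ys \<in> Poly_Mapping.keys (icomult K n (xs ! 1))" "ws = xs ! 0 # ys"
      using keys_fbind[where t = "icomult K n (xs ! 1)"] by (fastforce simp del: One_nat_def)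
    then show ?thesis using Suc.IH by auto
  qed (use Suc.prems in simp)
qed (simp split: if_splits)

lemma icop_one: "icop 1 h F = F [h]"
  by simp

lemma icop_Suc: "1 \<le> n \<Longrightarrow> icop (Suc n) h F = cop h (\<lambda>xs. icop n (xs ! 1) (\<lambda>ys. F (xs ! 0 # ys)))"
  by (cases n) (simp_all add: ev_fbind)

lemma icop_linear: "1 \<le> n \<Longrightarrow> mlin n F \<Longrightarrow> linear_form (hscale K) (\<lambda>h. icop n h F)"
proof (induction n arbitrary: F rule: nat_induct_at_least)
  case base
  then show ?case unfolding icop_one by (rule multilinear_one)
next
  case (Suc n)
  show ?case unfolding icop_Suc[OF Suc.hyps]
  proof (intro comult_linear multilinear_two_I)
    fix b
    show "linear_form (hscale K) (\<lambda>a. icop n ([a, b] ! 1) (\<lambda>ys. F ([a, b] ! 0 # ys)))"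
      unfolding nth_Cons_0 by (simp, intro linear_form_ev multilinear_hd[OF Suc.prems] icomult_length)
  next
    fix a
    show "linear_form (hscale K) (\<lambda>b. icop n ([a, b] ! 1) (\<lambda>ys. F ([a, b] ! 0 # ys)))"
      by (simp add: Suc.IH multilinear_Cons[OF Suc.prems])
  qed
qed

text \<open>This is the function of two legs whose evaluation at a single coproduct is
  \<open>icop (Suc n)\<close>; its bilinearity lets the laws of a single coproduct be applied in
  inductions over n.\<close>

lemma mlin_icop_Cons:
  assumes "1 \<le> n" "mlin (Suc n) F"
  shows "mlin 2 (\<lambda>xs. icop n (xs ! 1) (\<lambda>ys. F (xs ! 0 # ys)))"
proof (rule multilinear_two_I)
  fix b
  show "linear_form (hscale K) (\<lambda>a. icop n ([a, b] ! 1) (\<lambda>ys. F ([a, b] ! 0 # ys)))"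
    by (simp, intro linear_form_ev multilinear_hd[OF assms(2)] icomult_length)
next
  fix a
  show "linear_form (hscale K) (\<lambda>b. icop n ([a, b] ! 1) (\<lambda>ys. F ([a, b] ! 0 # ys)))"
    by (simp add: icop_linear[OF assms(1)] multilinear_Cons[OF assms(2)])
qed

text \<open>After one leg is peeled off, \<open>comult_mult\<close> handles the outer coproduct and
  the induction hypothesis the remaining legs; the two independent sums are then exchanged by
  \<open>ev_swap\<close>.\<close>

lemma icop_mult:
  "1 \<le> n \<Longrightarrow> mlin n F \<Longrightarrow>
    icop n (hmult K a b) F = icop n a (\<lambda>xs. icop n b (\<lambda>ys. F (lmul xs ys)))"
proof (induction n arbitrary: a b F rule: nat_induct_at_least)
  case base
  show ?case by simp
next
  case (Suc n)
  let ?G = "\<lambda>xs. icop n (xs ! 1) (\<lambda>zs. F (xs ! 0 # zs))"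
  have "icop (Suc n) (hmult K a b) F = cop a (\<lambda>xs. cop b (\<lambda>ys. ?G (lmul xs ys)))"
    unfolding icop_Suc[OF Suc.hyps] by (rule comult_mult[OF mlin_icop_Cons[OF Suc.hyps Suc.prems]])
  also have "\<dots> = cop a (\<lambda>xs. cop b (\<lambda>ys. icop n (xs ! 1) (\<lambda>us. icop n (ys ! 1)
      (\<lambda>vs. F (lmul (xs ! 0 # us) (ys ! 0 # vs))))))"
  proof (intro ev_cong, elim comult_keysE)
    fix xs ys :: "'a list" and x y x' y' assume "xs = [x, y]" "ys = [x', y']"
    then show "?G (lmul xs ys) = icop n (xs ! 1) (\<lambda>us. icop n (ys ! 1)
        (\<lambda>vs. F (lmul (xs ! 0 # us) (ys ! 0 # vs))))"
      by (simp add: Suc.IH multilinear_Cons[OF Suc.prems])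
  qed
  also have "\<dots> = icop (Suc n) a (\<lambda>xs. icop (Suc n) b (\<lambda>ys. F (lmul xs ys)))"
    unfolding icop_Suc[OF Suc.hyps] by (subst ev_swap) simp
  finally show ?case .
qed

text \<open>Generalised coassociativity. \<open>icomult\<close> is nested to the right, so the first
  leg has to be moved from outside the split into its left part; this is one use of coassociativity,
  applied to the trilinear form T that distributes the legs as 1 + m + n.\<close>

lemma icop_add:
  "1 \<le> m \<Longrightarrow> 1 \<le> n \<Longrightarrow> mlin (m + n) F \<Longrightarrow>
    icop (m + n) h F = cop h (\<lambda>xs. icop m (xs ! 0) (\<lambda>ys. icop n (xs ! 1) (\<lambda>zs. F (ys @ zs))))"
proof (induction m arbitrary: h F rule: nat_induct_at_least)
  case base
  then show ?case by (simp add: icop_Suc)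
next
  case (Suc m)
  define T where "T = (\<lambda>ts. icop m (ts ! 1) (\<lambda>us. icop n (ts ! 2) (\<lambda>zs. F (ts ! 0 # us @ zs))))"
  have mn: "1 \<le> m + n" using Suc.prems by simp
  have F: "mlin (Suc (m + n)) F" using Suc.prems by simp
  have T: "mlin 3 T"
  proof (rule multilinear_three_I)
    fix b c
    show "linear_form (hscale K) (\<lambda>a. T [a, b, c])"
      unfolding T_def by (simp, intro linear_form_ev multilinear_hd[OF F]) (simp add: icomult_length)
  next
    fix a c
    have "mlin m (\<lambda>us. icop n c (\<lambda>zs. F (a # us @ zs)))"
    proof (rule multilinear_ev)
      fix zs assume "zs \<in> Poly_Mapping.keys (icomult K n c)"
      then show "mlin m (\<lambda>us. F (a # us @ zs))"
        using multilinear_append1[of "hscale K" m zs "\<lambda>us. F (a # us)"] multilinear_Cons[OF F]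
        by (simp add: icomult_length)
    qed
    then show "linear_form (hscale K) (\<lambda>b. T [a, b, c])"
      unfolding T_def using icop_linear[OF Suc.hyps] by simp
  next
    fix a b
    have "linear_form (hscale K) (\<lambda>c. icop m b (\<lambda>us. icop n c (\<lambda>zs. F (a # us @ zs))))"
    proof (rule linear_form_ev)
      fix us assume "us \<in> Poly_Mapping.keys (icomult K m b)"
      then have "mlin n (\<lambda>zs. F (a # us @ zs))"
        using multilinear_append2[of "hscale K" us n "\<lambda>us. F (a # us)"] multilinear_Cons[OF F]
        by (simp add: icomult_length)
      then show "linear_form (hscale K) (\<lambda>c. icop n c (\<lambda>zs. F (a # us @ zs)))"
        by (rule icop_linear[OF Suc.prems(1)])
    qed
    then show "linear_form (hscale K) (\<lambda>c. T [a, b, c])" unfolding T_def by simp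
  qed
  have "icop (Suc m + n) h F = cop h (\<lambda>xs. icop (m + n) (xs ! 1) (\<lambda>ws. F (xs ! 0 # ws)))"
    using icop_Suc[OF mn] by simp
  also have "\<dots> = cop h (\<lambda>xs. cop (xs ! 1) (\<lambda>ys. T (xs ! 0 # ys)))"
    by (simp add: Suc.IH[OF Suc.prems(1) multilinear_Cons[OF F]] T_def numeral_2_eq_2)
  also have "\<dots> = cop h (\<lambda>xs. cop (xs ! 0) (\<lambda>ys. T (ys @ [xs ! 1])))"
    by (rule comult_coassoc[OF T, symmetric])
  also have "\<dots> = cop h (\<lambda>xs. cop (xs ! 0) (\<lambda>ys. icop m (ys ! 1) (\<lambda>us. icop n (xs ! 1)
      (\<lambda>zs. F (ys ! 0 # us @ zs)))))"
    by (intro ev_cong, elim comult_keysE) (simp add: T_def)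
  also have "\<dots> = cop h (\<lambda>xs. icop (Suc m) (xs ! 0) (\<lambda>ys. icop n (xs ! 1) (\<lambda>zs. F (ys @ zs))))"
    using icop_Suc[OF Suc.hyps] by simp
  finally show ?case .
qed

section \<open>Symmetry of the iterated coproduct under permutations of its legs\<close>

lemma permute_list_swap_Cons:
  "Suc i < length xs \<Longrightarrow>
    permute_list (Transposition.transpose (Suc i) (Suc (Suc i))) (x # xs) =
    x # permute_list (Transposition.transpose i (Suc i)) xs"
proof (rule nth_equalityI)
  fix j assume "Suc i < length xs" "j < length (permute_list (Transposition.transpose (Suc i) (Suc (Suc i))) (x # xs))"
  then show "permute_list (Transposition.transpose (Suc i) (Suc (Suc i))) (x # xs) ! j =
      (x # permute_list (Transposition.transpose i (Suc i)) xs) ! j"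
    by (cases j) (auto simp: permute_list_def Transposition.transpose_def nth_Cons' simp del: upt_Suc)
qed simp

lemma permute_list_swap_0: "permute_list (Transposition.transpose 0 1) (x # y # zs) = y # x # zs"
proof (rule nth_equalityI)
  fix j assume "j < length (permute_list (Transposition.transpose 0 1) (x # y # zs))"
  then show "permute_list (Transposition.transpose 0 1) (x # y # zs) ! j = (y # x # zs) ! j"
    by (auto simp: permute_list_def Transposition.transpose_def nth_Cons' simp del: upt_Suc)
qed simp

text \<open>For i = 0 the first two legs are gathered into a single coproduct by
  \<open>icop_add\<close>, where cocommutativity reverses them; for larger i the first leg is peeled
  off and the swap moves one place down.\<close>

lemma icop_swap:
  "Suc i < n \<Longrightarrow> mlin n F \<Longrightarrow>
    icop n h (\<lambda>xs. F (permute_list (Transposition.transpose i (Suc i)) xs)) = icop n h F"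
proof (induction i arbitrary: n h F)
  case 0
  have two: "icop 2 h G = cop h G" for G h
    using icop_Suc[of 1 h G] by (auto simp: numeral_2_eq_2 intro!: ev_cong elim!: comult_keysE)
  \<comment> \<open>\<open>icop_add\<close> needs a nonempty second block, so n = 2 is treated
    directly.\<close>
  show ?case
  proof (cases "n = 2")
    case True
    have "cop h (\<lambda>xs. F (permute_list (Transposition.transpose 0 1) xs)) = cop h (\<lambda>xs. F (rev xs))"
      by (intro ev_cong, elim comult_keysE) (simp add: permute_list_swap_0 del: One_nat_def)
    then show ?thesis using comult_cocomm[of F h] 0 by (simp add: True two)
  next
    case False
    then obtain m where n: "n = 2 + m" and m: "1 \<le> m"
      using "0.prems" by (metis One_nat_def Suc_1 Suc_leI le_add_diff_inverse less_one linorder_not_less add_0_right)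
    have T: "Transposition.transpose 0 (Suc 0) permutes {..<n}"
      using n by (intro permutes_swap_id) auto
    have "icop n h (\<lambda>xs. F (permute_list (Transposition.transpose 0 (Suc 0)) xs)) =
      cop h (\<lambda>xs. cop (xs ! 0) (\<lambda>ys. icop m (xs ! 1)
        (\<lambda>zs. F (permute_list (Transposition.transpose 0 (Suc 0)) (ys @ zs)))))"
      using icop_add[OF _ m, of 2 "\<lambda>xs. F (permute_list (Transposition.transpose 0 (Suc 0)) xs)" h]
        multilinear_permute[OF "0.prems"(2) T]
      unfolding n two by simp
    also have "\<dots> = cop h (\<lambda>xs. cop (xs ! 0) (\<lambda>ys. icop m (xs ! 1) (\<lambda>zs. F (rev ys @ zs))))"
      by (intro ev_cong, elim comult_keysE) (simp add: permute_list_swap_0[simplified])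
    also have "\<dots> = cop h (\<lambda>xs. cop (xs ! 0) (\<lambda>ys. icop m (xs ! 1) (\<lambda>zs. F (ys @ zs))))"
    proof (rule ev_cong, rule comult_cocomm, rule multilinear_ev)
      fix xs zs assume "zs \<in> Poly_Mapping.keys (icomult K m (xs ! 1))"
      then show "mlin 2 (\<lambda>ys. F (ys @ zs))"
        using "0.prems"(2) n by (intro multilinear_append1) (simp add: icomult_length)
    qed
    also have "\<dots> = icop n h F"
      using icop_add[OF _ m, of 2 F h] "0.prems"(2) unfolding n two by simp
    finally show ?thesis .
  qed
next
  case (Suc i)
  then obtain m where n: "n = Suc m" "1 \<le> m" by (cases n) auto
  have "icop n h (\<lambda>xs. F (permute_list (Transposition.transpose (Suc i) (Suc (Suc i))) xs)) =
    cop h (\<lambda>xs. icop m (xs ! 1) (\<lambda>ys. F (xs ! 0 # permute_list (Transposition.transpose i (Suc i)) ys)))"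
    unfolding n(1) icop_Suc[OF n(2)]
    using Suc.prems n by (intro ev_cong) (simp add: permute_list_swap_Cons icomult_length)
  also have "\<dots> = icop n h F"
    unfolding n(1) icop_Suc[OF n(2)]
    using Suc.prems n by (intro ev_cong Suc.IH multilinear_Cons) auto
  finally show ?case .
qed

text \<open>Adjacent transpositions generate the symmetric group, and the permutations that leave
  all evaluations unchanged are closed under composition. Q also records that the permutation acts
  on \<open>{..<n}\<close>, which composing list permutations requires.\<close>

lemma icop_permute:
  assumes "\<sigma> permutes {..<n}" "mlin n F"
  shows "icop n h (\<lambda>xs. F (permute_list \<sigma> xs)) = icop n h F"
proof -
  define Q where "Q \<sigma> \<longleftrightarrow> \<sigma> permutes {..<n} \<and>
    (\<forall>F. mlin n F \<longrightarrow> icop n h (\<lambda>xs. F (permute_list \<sigma> xs)) = icop n h F)" for \<sigma>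
  have comp: "Q (\<sigma> \<circ> \<tau>)" if "Q \<sigma>" "Q \<tau>" for \<sigma> \<tau>
    unfolding Q_def
  proof (intro conjI allI impI)
    show "\<sigma> \<circ> \<tau> permutes {..<n}" using that by (simp add: Q_def permutes_compose)
    fix F assume F: "mlin n F"
    have "icop n h (\<lambda>xs. F (permute_list (\<sigma> \<circ> \<tau>) xs)) =
        icop n h (\<lambda>xs. F (permute_list \<tau> (permute_list \<sigma> xs)))"
      using that by (intro ev_cong) (simp add: Q_def permute_list_compose icomult_length)
    also have "\<dots> = icop n h (\<lambda>xs. F (permute_list \<tau> xs))"
      using that(1)[unfolded Q_def] multilinear_permute[OF F, of \<tau>] that(2)[unfolded Q_def] by blast
    also have "\<dots> = icop n h F" using that(2) F by (simp add: Q_def)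
    finally show "icop n h (\<lambda>xs. F (permute_list (\<sigma> \<circ> \<tau>) xs)) = icop n h F" .
  qed
  have adj: "Q (Transposition.transpose i (Suc i))" if "Suc i < n" for i
    unfolding Q_def using that icop_swap by (auto intro!: permutes_swap_id)
  have swap: "Q (Transposition.transpose i (i + Suc d))" if "i + Suc d < n" for i d
    using that
  proof (induction d)
    case 0
    then show ?case using adj by simp
  next
    case (Suc d)
    \<comment> \<open>Conjugation by an adjacent transposition increases the distance of the two
      swapped points by one.\<close>
    have "Transposition.transpose i (i + Suc (Suc d)) =
      Transposition.transpose (i + Suc d) (Suc (i + Suc d)) \<circ> Transposition.transpose i (i + Suc d) \<circ>
      Transposition.transpose (i + Suc d) (Suc (i + Suc d))"
      by (rule ext) (auto simp: Transposition.transpose_def)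
    moreover have "Q (Transposition.transpose i (i + Suc d))" using Suc by simp
    moreover have "Q (Transposition.transpose (i + Suc d) (Suc (i + Suc d)))"
      using Suc.prems by (intro adj) simp
    ultimately show ?case by (metis comp)
  qed
  have id: "Q id" by (simp add: Q_def permutes_id)
  have "Q \<sigma>"
  proof (rule permutes_induct[OF assms(1)])
    fix a b \<tau> assume *: "a \<in> {..<n}" "b \<in> {..<n}" "a \<noteq> b" "Q \<tau>"
    have "Q (Transposition.transpose a b)"
    proof (cases "a < b")
      case True
      then show ?thesis using swap[of a "b - a - 1"] * by simp
    next
      case False
      then show ?thesis using swap[of b "a - b - 1"] * by (simp add: transpose_commute)
    qed
    then show "Q (Transposition.transpose a b \<circ> \<tau>)" using * comp by simp
  qed (use id in \<open>simp_all add: id_def\<close>)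
  then show ?thesis using assms(2) by (simp add: Q_def)
qed

end

text \<open>Each coset axiom is paired with a multilinear form; \<open>qev_qmap\<close> then turns
  the operation on chosen representatives into nested evaluation.\<close>

lemma (in cocommutative_hopf_algebra) cocomm_bialgebra: "cocomm_bialgebra K"
proof (unfold_locales, fact mult_add_left, fact mult_add_right, fact mult_scale_left,
    fact mult_scale_right, fact mult_assoc, fact mult_one_left)
  fix xs a assume "xs \<in> Poly_Mapping.keys (rep (comult K a))"
  then show "length xs = 2" using rep_tensor_power[OF comult_closed[of a]] by auto
next
  fix F :: "'b list \<Rightarrow> 'a" assume F: "multilinear (hscale K) 2 F"
  then have ann: "annihilates (hrels K 2) F" by (simp add: annihilates_tensor_rels)
  show "linear_form (hscale K) (\<lambda>a. ev (rep (comult K a)) F)"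
    unfolding qev_def[symmetric]
    by (rule linear_formI) (simp_all add: comult_add comult_scale qev_qadd[OF ann] qev_qscale[OF ann])
  fix a b
  show "ev (rep (comult K (hmult K a b))) F =
      ev (rep (comult K a)) (\<lambda>xs. ev (rep (comult K b)) (\<lambda>ys. F (map2 (hmult K) xs ys)))"
    using qev_qmap[OF ann, of _ "comult K a"] unfolding comult_mult qev_def by (simp add: ev_fbind)
  show "ev (rep (comult K a)) (\<lambda>xs. F (rev xs)) = ev (rep (comult K a)) F"
    using qev_qmap[OF ann, of "\<lambda>xs. gen (rev xs)" "comult K a"]
    by (simp add: cocommutative) (simp add: qev_def)
next
  fix F :: "'b list \<Rightarrow> 'a" and a assume F: "multilinear (hscale K) 3 F"
  then have ann: "annihilates (hrels K 3) F" by (simp add: annihilates_tensor_rels)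
  show "ev (rep (comult K a)) (\<lambda>xs. ev (rep (comult K (xs ! 0))) (\<lambda>ys. F (ys @ [xs ! 1]))) =
      ev (rep (comult K a)) (\<lambda>xs. ev (rep (comult K (xs ! 1))) (\<lambda>ys. F (xs ! 0 # ys)))"
    using arg_cong[OF coassoc[of a], of "\<lambda>A. qev A F"]
    by (simp add: qev_qmap[OF ann] ev_fbind) (simp add: qev_def)
qed


section \<open>Balanced forms\<close>

definition balanced_form ::
    "('k::field, 'a::ab_group_add) hopf \<Rightarrow> ('k, 'a, 'l::ab_group_add) gmod \<Rightarrow> nat
      \<Rightarrow> ('a list \<times> 'l \<Rightarrow> 'k) \<Rightarrow> bool" where
  "balanced_form K M n F \<longleftrightarrow>
     (\<forall>e. multilinear (hscale K) n (\<lambda>hs. F (hs, e)))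
   \<and> (\<forall>hs. length hs = n \<longrightarrow> linear_form (mscale M) (\<lambda>e. F (hs, e)))
   \<and> (\<forall>hs h e. length hs = n \<longrightarrow>
        ev (icomult K n h) (\<lambda>fs. F (map2 (hmult K) hs fs, e)) = F (hs, mact M h e))"

lemma annihilates_ptensor_rels: "annihilates (ptensor_rels K M n) F \<longleftrightarrow> balanced_form K M n F"
proof -
  have "annihilates (ptensor_rels K M n) F \<longleftrightarrow>
     (\<forall>hs i a b e. length hs = n \<and> i < n \<longrightarrow>
        ev (gen (hs[i := a + b], e) - gen (hs[i := a], e) - gen (hs[i := b], e)) F = 0) \<and>
     (\<forall>hs i c a e. length hs = n \<and> i < n \<longrightarrow>
        ev (gen (hs[i := hscale K c a], e) - fscale c (gen (hs[i := a], e))) F = 0) \<and>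
     (\<forall>hs x y. length hs = n \<longrightarrow> ev (gen (hs, x + y) - gen (hs, x) - gen (hs, y)) F = 0) \<and>
     (\<forall>hs c x. length hs = n \<longrightarrow> ev (gen (hs, mscale M c x) - fscale c (gen (hs, x))) F = 0) \<and>
     (\<forall>hs h e. length hs = n \<longrightarrow>
        ev (fbind (icomult K n h) (\<lambda>fs. gen (map2 (hmult K) hs fs, e)) - gen (hs, mact M h e)) F = 0)"
    unfolding annihilates_def ptensor_rels_def ball_Un conj_assoc
    by (intro arg_cong2[where f = "(\<and>)"]; blast)
  also have "\<dots> \<longleftrightarrow>
     (\<forall>hs i a b e. length hs = n \<and> i < n \<longrightarrow>
        F (hs[i := a + b], e) = F (hs[i := a], e) + F (hs[i := b], e)) \<and>
     (\<forall>hs i c a e. length hs = n \<and> i < n \<longrightarrow> F (hs[i := hscale K c a], e) = c * F (hs[i := a], e)) \<and>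
     (\<forall>hs x y. length hs = n \<longrightarrow> F (hs, x + y) = F (hs, x) + F (hs, y)) \<and>
     (\<forall>hs c x. length hs = n \<longrightarrow> F (hs, mscale M c x) = c * F (hs, x)) \<and>
     (\<forall>hs h e. length hs = n \<longrightarrow>
        ev (icomult K n h) (\<lambda>fs. F (map2 (hmult K) hs fs, e)) = F (hs, mact M h e))"
    unfolding ev_diff ev_fscale ev_fbind ev_single by (simp add: diff_diff_eq)
  also have "\<dots> \<longleftrightarrow> balanced_form K M n F"
    unfolding multilinear_iff_update linear_form_def balanced_form_def by blast
  finally show ?thesis .
qed

lemmas qev_ptensor =
  qev_qclass[of "ptensor_rels K M n" for K M n, unfolded annihilates_ptensor_rels]
  qev_qadd[of "ptensor_rels K M n" for K M n, unfolded annihilates_ptensor_rels]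
  qev_qscale[of "ptensor_rels K M n" for K M n, unfolded annihilates_ptensor_rels]
  qev_qsum[of "ptensor_rels K M n" for K M n, unfolded annihilates_ptensor_rels]
  qev_qmap[of "ptensor_rels K M n" for K M n, unfolded annihilates_ptensor_rels]

lemmas ptensor_eqI = qclass_eqI[of _ "ptensor_rels K M n" for K M n, unfolded annihilates_ptensor_rels]

lemma balanced_multilinear: "balanced_form K M n F \<Longrightarrow> multilinear (hscale K) n (\<lambda>hs. F (hs, e))"
  and balanced_linear: "balanced_form K M n F \<Longrightarrow> length hs = n \<Longrightarrow> linear_form (mscale M) (\<lambda>e. F (hs, e))"
  and balanced_act: "balanced_form K M n F \<Longrightarrow> length hs = n \<Longrightarrow>
    ev (icomult K n h) (\<lambda>fs. F (map2 (hmult K) hs fs, e)) = F (hs, mact M h e)"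
  by (auto simp: balanced_form_def)

lemma ptensor_range: "A \<in> ptensor K M n \<Longrightarrow> A \<in> range (qclass (ptensor_rels K M n))"
  by (auto simp: ptensor_def)

lemma qev_perm:
  "balanced_form K M n F \<Longrightarrow>
    qev (ptensor_perm K M n \<sigma> A) F = qev A (\<lambda>(fs, e). F (permute_list (inv \<sigma>) fs, e))"
  by (simp add: ptensor_perm_def qev_ptensor case_prod_unfold)

lemma qev_lmult:
  "balanced_form K M n F \<Longrightarrow>
    qev (ptensor_lmult K M n gs A) F = qev A (\<lambda>(fs, e). F (map2 (hmult K) gs fs, e))"
  by (simp add: ptensor_lmult_def qev_ptensor case_prod_unfold)

text \<open>Unfolding is possible here for arbitrary \<phi> and \<psi>, since \<open>qev\<close>
  refers to the same chosen representatives as \<open>pcomp\<close>; independence of the choice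
  comes from \<open>bal_pcomp_inner\<close> and \<open>bal_pcomp_outer\<close>.\<close>

lemma qev_pcomp:
  "balanced_form K M (length ys + length xs) F \<Longrightarrow>
    qev (pcomp K M \<phi> \<psi> ys xs) F =
    qev (\<psi> ys) (\<lambda>(hs, e). qev (\<phi> (e # xs)) (\<lambda>(fs, e').
      ev (icomult K (length ys) (hd fs)) (\<lambda>gs. F (map2 (hmult K) hs gs @ tl fs, e'))))"
  by (simp add: pcomp_def qev_ptensor case_prod_unfold ev_fbind) (simp add: qev_def)

lemma pHom_ptensor: "\<phi> \<in> pHom K M p n \<Longrightarrow> length xs = n \<Longrightarrow> \<phi> xs \<in> ptensor K M n"
  by (auto simp: pHom_def)

lemma pHom_add: "\<phi> \<in> pHom K M p n \<Longrightarrow> length xs = n \<Longrightarrow> i < n \<Longrightarrow>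
    \<phi> (xs[i := x + y]) = qadd (ptensor_rels K M n) (\<phi> (xs[i := x])) (\<phi> (xs[i := y]))"
  and pHom_scale: "\<phi> \<in> pHom K M p n \<Longrightarrow> length xs = n \<Longrightarrow> i < n \<Longrightarrow>
    \<phi> (xs[i := mscale M c x]) = qscale (ptensor_rels K M n) c (\<phi> (xs[i := x]))"
  by (simp_all add: pHom_def)

lemma pHom_linear_update:
  "\<phi> \<in> pHom K M p n \<Longrightarrow> balanced_form K M n F \<Longrightarrow> length xs = n \<Longrightarrow> i < n \<Longrightarrow>
    linear_form (mscale M) (\<lambda>x. qev (\<phi> (xs[i := x])) F)"
  by (rule linear_formI) (simp_all add: pHom_add pHom_scale qev_ptensor)

lemma pHom_multilinear:
  "\<phi> \<in> pHom K M p n \<Longrightarrow> balanced_form K M n F \<Longrightarrow> multilinear (mscale M) n (\<lambda>xs. qev (\<phi> xs) F)"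
  by (simp add: multilinear_iff_update pHom_linear_update)

lemma pHom_act:
  assumes "\<phi> \<in> pHom K M p n" "balanced_form K M n F" "length hs = n" "length xs = n"
  shows "qev (\<phi> (map2 (mact M) hs xs)) F = qev (\<phi> xs) (\<lambda>(fs, e). F (map2 (hmult K) hs fs, e))"
  using assms by (simp add: pHom_def qev_lmult)

locale bialgebra_module = cocomm_bialgebra K + graded_left_module K M
  for K :: "('k::field, 'a::ab_group_add) hopf" and M :: "('k, 'a, 'l::ab_group_add) gmod"
begin

abbreviation bal :: "nat \<Rightarrow> ('a list \<times> 'l \<Rightarrow> 'k) \<Rightarrow> bool" where
  "bal \<equiv> balanced_form K M"

lemma keys_ptensor_rels: "r \<in> ptensor_rels K M n \<Longrightarrow> Poly_Mapping.keys r \<subseteq> {t. length (fst t) = n}"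
  unfolding ptensor_rels_def
  by (elim UnE CollectE exE conjE; hypsubst;
      intro keys_subset_intros order_trans[OF keys_fbind] UN_least) (simp_all add: icomult_length)

lemma ptensor_keys: "A \<in> ptensor K M n \<Longrightarrow> t \<in> Poly_Mapping.keys (rep A) \<Longrightarrow> length (fst t) = n"
proof -
  assume "A \<in> ptensor K M n"
  then have "Poly_Mapping.keys (rep A) \<subseteq> {t. length (fst t) = n}"
    unfolding ptensor_def by (elim imageE, hypsubst, intro keys_rep_qclass[OF keys_ptensor_rels]) auto
  then show "t \<in> Poly_Mapping.keys (rep A) \<Longrightarrow> length (fst t) = n" by blast
qed

lemma qev_ptensor_cong:
  assumes "A \<in> ptensor K M n" "\<And>hs e. length hs = n \<Longrightarrow> F (hs, e) = G (hs, e)"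
  shows "qev A F = qev A G"
  unfolding qev_def
proof (rule ev_cong)
  fix t assume "t \<in> Poly_Mapping.keys (rep A)"
  then show "F t = G t" using ptensor_keys[OF assms(1)] assms(2) by (cases t) auto
qed

section \<open>Operations under which balanced forms are stable\<close>

lemma bal_lmul:
  assumes F: "bal n F" and gs: "length gs = n"
  shows "bal n (\<lambda>(fs, e). F (lmul gs fs, e))"
  unfolding balanced_form_def
proof (intro conjI allI impI)
  fix e
  show "mlin n (\<lambda>hs. case (hs, e) of (fs, e) \<Rightarrow> F (lmul gs fs, e))"
    using mlin_lmul_right[OF balanced_multilinear[OF F] gs] by simp
next
  fix hs :: "'a list" assume "length hs = n"
  then show "linear_form (mscale M) (\<lambda>e. case (hs, e) of (fs, e) \<Rightarrow> F (lmul gs fs, e))"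
    using balanced_linear[OF F, of "lmul gs hs"] gs by simp
next
  fix hs :: "'a list" and h e assume "length hs = n"
  then show "icop n h (\<lambda>fs. case (lmul hs fs, e) of (fs, e) \<Rightarrow> F (lmul gs fs, e)) =
      (case (hs, mact M h e) of (fs, e) \<Rightarrow> F (lmul gs fs, e))"
    using balanced_act[OF F, of "lmul gs hs" h e] gs by (simp add: lmul_assoc)
qed

lemma permute_lmul:
  "\<sigma> permutes {..<n} \<Longrightarrow> length xs = n \<Longrightarrow> length ys = n \<Longrightarrow>
    permute_list \<sigma> (lmul xs ys) = lmul (permute_list \<sigma> xs) (permute_list \<sigma> ys)"
  by (simp add: permute_list_map permute_list_zip)

text \<open>Permuting the factors respects the diagonal right action because the iterated coproduct
  is symmetric; this is where cocommutativity acts on balanced tensor products.\<close>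

lemma bal_permute:
  assumes F: "bal n F" and \<sigma>: "\<sigma> permutes {..<n}"
  shows "bal n (\<lambda>(fs, e). F (permute_list \<sigma> fs, e))"
  unfolding balanced_form_def
proof (intro conjI allI impI)
  fix e
  show "mlin n (\<lambda>hs. case (hs, e) of (fs, e) \<Rightarrow> F (permute_list \<sigma> fs, e))"
    using multilinear_permute[OF balanced_multilinear[OF F] \<sigma>] by simp
next
  fix hs :: "'a list" assume "length hs = n"
  then show "linear_form (mscale M) (\<lambda>e. case (hs, e) of (fs, e) \<Rightarrow> F (permute_list \<sigma> fs, e))"
    using balanced_linear[OF F, of "permute_list \<sigma> hs"] by simp
next
  fix hs :: "'a list" and h e assume hs: "length hs = n"
  have "icop n h (\<lambda>fs. F (permute_list \<sigma> (lmul hs fs), e)) =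
      icop n h (\<lambda>fs. F (lmul (permute_list \<sigma> hs) (permute_list \<sigma> fs), e))"
    using hs \<sigma> by (intro ev_cong) (simp add: permute_lmul icomult_length)
  also have "\<dots> = icop n h (\<lambda>fs. F (lmul (permute_list \<sigma> hs) fs, e))"
    using hs by (intro icop_permute[OF \<sigma>] mlin_lmul_right[OF balanced_multilinear[OF F]]) simp
  also have "\<dots> = F (permute_list \<sigma> hs, mact M h e)"
    using hs by (intro balanced_act[OF F]) simp
  finally show "icop n h (\<lambda>fs. case (lmul hs fs, e) of (fs, e) \<Rightarrow> F (permute_list \<sigma> fs, e)) =
      (case (hs, mact M h e) of (fs, e) \<Rightarrow> F (permute_list \<sigma> fs, e))" by simp
qed

text \<open>First half of the well-definedness of composition: independence of how the value of
  \<phi> is represented. If h multiplies that value on the right, its first factor f becomes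
  \<open>f h_(1)\<close>, whose l-fold coproduct is multiplicative; together with the legs on the
  other m factors this makes up the (l + m)-fold coproduct of h, which F absorbs.\<close>

lemma bal_pcomp_inner:
  assumes F: "bal (l + m) F" and l: "1 \<le> l" and hs: "length hs = l"
  shows "bal (Suc m) (\<lambda>(fs, e). icop l (hd fs) (\<lambda>gs. F (lmul hs gs @ tl fs, e)))"
  unfolding balanced_form_def split_conv
proof (intro conjI allI impI)
  fix e
  show "mlin (Suc m) (\<lambda>fs. icop l (hd fs) (\<lambda>gs. F (lmul hs gs @ tl fs, e)))"
  proof (rule multilinearI)
    fix as bs :: "'a list" assume len: "length as + Suc (length bs) = Suc m"
    show "linear_form (hscale K) (\<lambda>x. icop l (hd (as @ x # bs)) (\<lambda>gs. F (lmul hs gs @ tl (as @ x # bs), e)))"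
    proof (cases as)
      case Nil
      have "mlin l (\<lambda>gs. F (gs @ bs, e))"
        using balanced_multilinear[OF F] len Nil by (intro multilinear_append1) simp
      from icop_linear[OF l mlin_lmul_right[OF this hs]] show ?thesis using Nil by simp
    next
      case (Cons a as')
      have "linear_form (hscale K) (\<lambda>x. icop l a (\<lambda>gs. F (lmul hs gs @ as' @ x # bs, e)))"
      proof (rule linear_form_ev)
        fix gs assume "gs \<in> Poly_Mapping.keys (icomult K l a)"
        then show "linear_form (hscale K) (\<lambda>x. F (lmul hs gs @ as' @ x # bs, e))"
          using multilinearD[OF balanced_multilinear[OF F], of "lmul hs gs @ as'" bs] hs len Cons
          by (simp add: icomult_length)
      qed
      then show ?thesis using Cons by simp
    qed
  qed
next
  fix fs :: "'a list" assume "length fs = Suc m"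
  then show "linear_form (mscale M) (\<lambda>e. icop l (hd fs) (\<lambda>gs. F (lmul hs gs @ tl fs, e)))"
    using hs by (intro linear_form_ev balanced_linear[OF F]) (simp add: icomult_length)
next
  fix fs :: "'a list" and h e assume len: "length fs = Suc m"
  then obtain f fs' where fs: "fs = f # fs'" "length fs' = m" by (cases fs) auto
  show "icop (Suc m) h (\<lambda>ws. icop l (hd (lmul fs ws)) (\<lambda>gs. F (lmul hs gs @ tl (lmul fs ws), e))) =
      icop l (hd fs) (\<lambda>gs. F (lmul hs gs @ tl fs, mact M h e))"
  \<comment> \<open>For m = 0 the value of \<phi> has a single factor, and h cannot be split by
    \<open>icop_Suc\<close> and \<open>icop_add\<close>, which need m to be positive;
    multiplicativity of the coproduct is then the whole argument.\<close>
  proof (cases "m = 0")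
    case True
    have F': "bal l F" using F True by simp
    have "icop l (hmult K f h) (\<lambda>gs. F (lmul hs gs, e)) =
        icop l f (\<lambda>us. icop l h (\<lambda>vs. F (lmul hs (lmul us vs), e)))"
      by (rule icop_mult[OF l mlin_lmul_right[OF balanced_multilinear[OF F'] hs]])
    also have "\<dots> = icop l f (\<lambda>us. F (lmul hs us, mact M h e))"
      unfolding lmul_assoc[symmetric] using hs
      by (intro ev_cong balanced_act[OF F']) (simp add: icomult_length)
    finally show ?thesis using True fs by simp
  next
    case False
    then have m: "1 \<le> m" by simp
    have split: "F (lmul hs (lmul us vs) @ lmul fs' zs, e) = F (lmul (lmul hs us @ fs') (vs @ zs), e)"
      if "length us = l" "length vs = l" "length zs = m" for us vs zs
      using that fs hs by (simp add: lmul_assoc)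
    have "icop (Suc m) h (\<lambda>ws. icop l (hd (lmul fs ws)) (\<lambda>gs. F (lmul hs gs @ tl (lmul fs ws), e))) =
        cop h (\<lambda>xs. icop m (xs ! 1) (\<lambda>zs. icop l (hmult K f (xs ! 0)) (\<lambda>gs. F (lmul hs gs @ lmul fs' zs, e))))"
      unfolding icop_Suc[OF m] by (simp add: fs)
    also have "\<dots> = cop h (\<lambda>xs. icop m (xs ! 1) (\<lambda>zs. icop l f (\<lambda>us. icop l (xs ! 0)
        (\<lambda>vs. F (lmul hs (lmul us vs) @ lmul fs' zs, e)))))"
    proof (intro ev_cong[of "rep (comult K h)"] ev_cong[of "icomult K m x" for x] icop_mult[OF l])
      fix xs zs assume "zs \<in> Poly_Mapping.keys (icomult K m (xs ! 1))"
      then have "mlin l (\<lambda>gs. F (gs @ lmul fs' zs, e))"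
        using balanced_multilinear[OF F] fs by (intro multilinear_append1) (simp add: icomult_length)
      then show "mlin l (\<lambda>gs. F (lmul hs gs @ lmul fs' zs, e))" by (rule mlin_lmul_right[OF _ hs])
    qed
    also have "\<dots> = cop h (\<lambda>xs. icop m (xs ! 1) (\<lambda>zs. icop l f (\<lambda>us. icop l (xs ! 0)
        (\<lambda>vs. F (lmul (lmul hs us @ fs') (vs @ zs), e)))))"
      by (intro ev_cong split) (simp_all add: icomult_length)
    also have "\<dots> = cop h (\<lambda>xs. icop l f (\<lambda>us. icop m (xs ! 1) (\<lambda>zs. icop l (xs ! 0)
        (\<lambda>vs. F (lmul (lmul hs us @ fs') (vs @ zs), e)))))"
      by (subst ev_swap) (rule refl)
    also have "\<dots> = icop l f (\<lambda>us. cop h (\<lambda>xs. icop l (xs ! 0) (\<lambda>vs. icop m (xs ! 1)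
        (\<lambda>zs. F (lmul (lmul hs us @ fs') (vs @ zs), e)))))"
      by (subst ev_swap, subst (2) ev_swap) (rule refl)
    also have "\<dots> = icop l f (\<lambda>us. icop (l + m) h (\<lambda>ws. F (lmul (lmul hs us @ fs') ws, e)))"
      using fs hs
      by (intro ev_cong icop_add[OF l m, symmetric] mlin_lmul_right[OF balanced_multilinear[OF F]])
        (simp add: icomult_length)
    also have "\<dots> = icop l f (\<lambda>us. F (lmul hs us @ fs', mact M h e))"
      using fs hs by (intro ev_cong balanced_act[OF F]) (simp add: icomult_length)
    finally show ?thesis using fs by simp
  qed
qed

text \<open>Second half: independence of how the value of \<psi> is represented. Linearity of \<phi>
  turns h acting on e into left multiplication of the first factor f by h, and the coproduct of the
  product splits into that of h, which multiplies \<open>hs\<close> on the right, followed by that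
  of f.\<close>

lemma bal_pcomp_outer:
  assumes \<phi>: "\<phi> \<in> pHom K M p (Suc m)" and F: "bal (l + m) F" and l: "1 \<le> l" and xs: "length xs = m"
  shows "bal l (\<lambda>(hs, e). qev (\<phi> (e # xs)) (\<lambda>(fs, e'). icop l (hd fs) (\<lambda>gs. F (lmul hs gs @ tl fs, e'))))"
  unfolding balanced_form_def split_conv
proof (intro conjI allI impI)
  fix e
  have \<phi>e: "\<phi> (e # xs) \<in> ptensor K M (Suc m)" using pHom_ptensor[OF \<phi>] xs by simp
  show "mlin l (\<lambda>hs. qev (\<phi> (e # xs)) (\<lambda>(fs, e'). icop l (hd fs) (\<lambda>gs. F (lmul hs gs @ tl fs, e'))))"
    unfolding qev_def
  proof (rule multilinear_ev, clarify, rule multilinear_ev)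
    fix fs e' gs assume "(fs, e') \<in> Poly_Mapping.keys (rep (\<phi> (e # xs)))"
      and gs: "gs \<in> Poly_Mapping.keys (icomult K l (hd fs))"
    then have "length fs = Suc m" using ptensor_keys[OF \<phi>e] by fastforce
    then have "mlin l (\<lambda>hs. F (hs @ tl fs, e'))"
      using balanced_multilinear[OF F] by (intro multilinear_append1) simp
    then show "mlin l (\<lambda>hs. F (lmul hs gs @ tl fs, e'))"
      using mlin_lmul_left[of l "\<lambda>hs. F (hs @ tl fs, e')" gs] gs by (simp add: icomult_length)
  qed
next
  fix hs :: "'a list" assume hs: "length hs = l"
  show "linear_form (mscale M) (\<lambda>e. qev (\<phi> (e # xs)) (\<lambda>(fs, e'). icop l (hd fs) (\<lambda>gs. F (lmul hs gs @ tl fs, e'))))"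
    using multilinear_hd[OF pHom_multilinear[OF \<phi> bal_pcomp_inner[OF F l hs]] xs] by simp
next
  fix hs :: "'a list" and h e assume hs: "length hs = l"
  let ?I = "\<lambda>hs (fs, e'). icop l (hd fs) (\<lambda>gs. F (lmul hs gs @ tl fs, e'))"
  have \<phi>e: "\<phi> (e # xs) \<in> ptensor K M (Suc m)" using pHom_ptensor[OF \<phi>] xs by simp
  have "map2 (mact M) (replicate m (hone K)) xs = xs"
    using xs by (induction xs arbitrary: m) (auto simp: act_one)
  then have act_Cons: "map2 (mact M) (h # replicate m (hone K)) (e # xs) = mact M h e # xs" by simp
  have "qev (\<phi> (mact M h e # xs)) (?I hs) =
      qev (\<phi> (e # xs)) (\<lambda>(fs, e'). ?I hs (lmul (h # replicate m (hone K)) fs, e'))"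
    using pHom_act[OF \<phi> bal_pcomp_inner[OF F l hs], of "h # replicate m (hone K)" "e # xs"] xs
    unfolding act_Cons by simp
  also have "\<dots> = qev (\<phi> (e # xs)) (\<lambda>(fs, e'). icop l h (\<lambda>ws. icop l (hd fs)
      (\<lambda>gs. F (lmul (lmul hs ws) gs @ tl fs, e'))))"
  proof (rule qev_ptensor_cong[OF \<phi>e], unfold split_conv)
    fix fs :: "'a list" and e' assume "length fs = Suc m"
    then obtain f fs' where fs: "fs = f # fs'" "length fs' = m" by (cases fs) auto
    have "mlin l (\<lambda>gs. F (gs @ fs', e'))"
      using balanced_multilinear[OF F] fs by (intro multilinear_append1) simp
    from icop_mult[OF l mlin_lmul_right[OF this hs], of h f]
    show "icop l (hd (lmul (h # replicate m (hone K)) fs))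
        (\<lambda>gs. F (lmul hs gs @ tl (lmul (h # replicate m (hone K)) fs), e')) =
      icop l h (\<lambda>ws. icop l (hd fs) (\<lambda>gs. F (lmul (lmul hs ws) gs @ tl fs, e')))"
      by (simp add: fs lmul_ones lmul_assoc)
  qed
  also have "\<dots> = icop l h (\<lambda>ws. qev (\<phi> (e # xs)) (?I (lmul hs ws)))"
    unfolding qev_def by (subst (2) ev_swap) (simp add: case_prod_unfold)
  finally show "icop l h (\<lambda>ws. qev (\<phi> (e # xs)) (?I (lmul hs ws))) = qev (\<phi> (mact M h e # xs)) (?I hs)"
    by simp
qed

end


section \<open>The smash product as a bialgebra\<close>

lemma sum_UNIV_shift_left: "(\<Sum>d\<in>UNIV. f (b + d)) = (\<Sum>c\<in>UNIV. f (c :: 'g::{group_add,finite}))"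
  by (rule sum.reindex_bij_witness[of _ "\<lambda>c. - b + c" "\<lambda>d. b + d"]) (auto simp: add.assoc[symmetric])

lemma sum_UNIV_shift_right: "(\<Sum>d\<in>UNIV. f (d + b)) = (\<Sum>c\<in>UNIV. f (c :: 'g::{group_add,finite}))"
  by (rule sum.reindex_bij_witness[of _ "\<lambda>c. c - b" "\<lambda>d. d + b"]) auto

lemma sum_lookup_single:
  "(\<Sum>g\<in>UNIV. Poly_Mapping.single g (Poly_Mapping.lookup u g)) = (u :: 'g::finite \<Rightarrow>\<^sub>0 'h::ab_group_add)"
  by (rule poly_mapping_eqI) (simp add: lookup_sum lookup_single when_def)

locale smash_action = hopf_action H act
  for H :: "('k::field, 'h::ab_group_add) hopf" and act :: "'g::{group_add,finite} \<Rightarrow> 'h \<Rightarrow> 'h" +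
  assumes cocommutative: "cocommutative_hopf_algebra H"
begin

sublocale H: cocomm_bialgebra H
  using cocommutative by (rule cocommutative_hopf_algebra.cocomm_bialgebra)

abbreviation S :: "('k, 'g \<Rightarrow>\<^sub>0 'h) hopf" where
  "S \<equiv> smash H act"

abbreviation smul :: "('g \<Rightarrow>\<^sub>0 'h) list \<Rightarrow> ('g \<Rightarrow>\<^sub>0 'h) list \<Rightarrow> ('g \<Rightarrow>\<^sub>0 'h) list" where
  "smul \<equiv> map2 (hmult S)"

lemma hscale_module: "module (hscale H)"
  using vector_space by (simp add: module_iff_vector_space)

lemma hscale_zero [simp]: "hscale H c 0 = 0"
  by (rule module.scale_zero_right[OF hscale_module])

lemma hmult_zero [simp]: "hmult H 0 a = 0" "hmult H a 0 = 0"
  using mult_add_left[of 0 0 a] mult_add_right[of a 0 0] by simp_all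

lemma act_add: "act g (a + b) = act g a + act g b"
  and act_scale: "act g (hscale H c a) = hscale H c (act g a)"
  using act_linear[of g] by (simp_all add: Vector_Spaces.linear_iff)

lemma act_0 [simp]: "act g 0 = 0"
  using act_add[of g 0 0] by simp

lemma act_sum: "act g (\<Sum>i\<in>I. x i) = (\<Sum>i\<in>I. act g (x i))"
  by (induction I rule: infinite_finite_induct) (auto simp: act_add)

lemma hmult_sum_left: "hmult H (\<Sum>i\<in>I. x i) y = (\<Sum>i\<in>I. hmult H (x i) y)"
  and hmult_sum_right: "hmult H y (\<Sum>i\<in>I. x i) = (\<Sum>i\<in>I. hmult H y (x i))"
  by (induction I rule: infinite_finite_induct) (auto simp: mult_add_left mult_add_right)

lemma hscale_sum: "hscale H c (\<Sum>i\<in>I. x i) = (\<Sum>i\<in>I. hscale H c (x i))"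
  by (rule module.scale_sum_right[OF hscale_module])

lemma lookup_smash_scale [simp]: "Poly_Mapping.lookup (hscale S c u) g = hscale H c (Poly_Mapping.lookup u g)"
  by (simp add: smash_def Poly_Mapping.map.rep_eq when_def)

lemma lookup_smash_mult:
  "Poly_Mapping.lookup (hmult S u v) a =
    (\<Sum>b\<in>UNIV. hmult H (Poly_Mapping.lookup u b) (act b (Poly_Mapping.lookup v (- b + a))))"
proof -
  have "b + c = a \<longleftrightarrow> c = - b + a" for b c :: 'g
    by (auto simp: add.assoc[symmetric])
  then show ?thesis
    by (simp add: smash_def lookup_sum lookup_single when_def)
qed

lemma lookup_smash_mult_single:
  "Poly_Mapping.lookup (hmult S u (Poly_Mapping.single g x)) a =
    hmult H (Poly_Mapping.lookup u (a - g)) (act (a - g) x)"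
proof -
  have "g = - b + a \<longleftrightarrow> b = a - g" for b
    by (metis add.assoc add.left_inverse add.right_inverse add_0 diff_add_cancel diff_conv_add_uminus minus_add_cancel)
  then show ?thesis
    by (simp add: lookup_smash_mult lookup_single when_def if_distrib[of "act _"] if_distrib[of "hmult H _"]
        cong: if_cong)
qed

lemma lookup_smash_single_mult:
  "Poly_Mapping.lookup (hmult S (Poly_Mapping.single g x) v) a =
    hmult H x (act g (Poly_Mapping.lookup v (- g + a)))"
  by (simp add: lookup_smash_mult lookup_single when_def if_distrib[of "\<lambda>x. hmult H x _"] cong: if_cong)

lemma smash_single_mult_single:
  "hmult S (Poly_Mapping.single a x) (Poly_Mapping.single b y) =
    Poly_Mapping.single (a + b) (hmult H x (act a y))"
proof (rule poly_mapping_eqI)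
  fix c
  have "b = - a + c \<longleftrightarrow> a + b = c" by (auto simp: add.assoc[symmetric])
  then show "Poly_Mapping.lookup (hmult S (Poly_Mapping.single a x) (Poly_Mapping.single b y)) c =
    Poly_Mapping.lookup (Poly_Mapping.single (a + b) (hmult H x (act a y))) c"
    by (simp add: lookup_smash_single_mult lookup_single when_def)
qed

lemma smash_single_scale: "Poly_Mapping.single g (hscale H c x) = hscale S c (Poly_Mapping.single g x)"
  by (rule poly_mapping_eqI) (simp add: lookup_single when_def)

lemma smash_mult_add_left: "hmult S (u + v) w = hmult S u w + hmult S v w"
  by (rule poly_mapping_eqI) (simp add: lookup_smash_mult lookup_add mult_add_left sum.distrib)

lemma smash_mult_add_right: "hmult S w (u + v) = hmult S w u + hmult S w v"
  by (rule poly_mapping_eqI) (simp add: lookup_smash_mult lookup_add mult_add_right act_add sum.distrib)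

lemma smash_mult_scale_left: "hmult S (hscale S c u) v = hscale S c (hmult S u v)"
  by (rule poly_mapping_eqI) (simp add: lookup_smash_mult mult_scale_left hscale_sum)

lemma smash_mult_scale_right: "hmult S u (hscale S c v) = hscale S c (hmult S u v)"
  by (rule poly_mapping_eqI) (simp add: lookup_smash_mult act_scale mult_scale_right hscale_sum)

lemma smash_mult_assoc: "hmult S (hmult S u v) w = hmult S u (hmult S v w)"
proof (rule poly_mapping_eqI)
  fix a
  let ?t = "\<lambda>b d c. hmult H (Poly_Mapping.lookup u b)
    (hmult H (act b (Poly_Mapping.lookup v d)) (act c (Poly_Mapping.lookup w (- c + a))))"
  have "Poly_Mapping.lookup (hmult S (hmult S u v) w) a = (\<Sum>c\<in>UNIV. \<Sum>b\<in>UNIV. ?t b (- b + c) c)"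
    by (simp add: lookup_smash_mult hmult_sum_left mult_assoc)
  also have "\<dots> = (\<Sum>b\<in>UNIV. \<Sum>c\<in>UNIV. ?t b (- b + c) c)" by (rule sum.swap)
  \<comment> \<open>The substitution c = b + d, with d the group component of v, makes both
    bracketings the same double sum.\<close>
  also have "\<dots> = (\<Sum>b\<in>UNIV. \<Sum>d\<in>UNIV. ?t b (- b + (b + d)) (b + d))"
    by (rule sum.cong[OF refl], rule sum_UNIV_shift_left[symmetric])
  also have "\<dots> = (\<Sum>b\<in>UNIV. \<Sum>d\<in>UNIV. ?t b d (b + d))"
    by (simp add: add.assoc[symmetric])
  also have "\<dots> = Poly_Mapping.lookup (hmult S u (hmult S v w)) a"
    by (simp add: lookup_smash_mult act_sum hmult_sum_right act_hmult act_plus minus_add add.assoc diff_conv_add_uminus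
        del: add_uminus_conv_diff)
  finally show "Poly_Mapping.lookup (hmult S (hmult S u v) w) a = Poly_Mapping.lookup (hmult S u (hmult S v w)) a" .
qed

lemma hone_smash: "hone S = Poly_Mapping.single 0 (hone H)"
  by (simp add: smash_def)

lemma smash_mult_one_left: "hmult S (hone S) u = u"
  by (rule poly_mapping_eqI) (simp add: hone_smash lookup_smash_single_mult act_zero mult_one_left)

section \<open>Coproduct laws of the smash product\<close>

lemma multilinear_smash_single:
  "multilinear (hscale S) n F \<Longrightarrow> H.mlin n (\<lambda>xs. F (map (Poly_Mapping.single g) xs))"
  by (rule multilinear_map) (simp_all add: single_add smash_single_scale)

lemma multilinear_act: "H.mlin n F \<Longrightarrow> H.mlin n (\<lambda>xs. F (map (act g) xs))"
  by (rule multilinear_map) (simp_all add: act_add act_scale)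

lemma linear_form_lookup:
  "linear_form (hscale H) f \<Longrightarrow> linear_form (hscale S) (\<lambda>u. f (Poly_Mapping.lookup u g))"
  by (simp add: linear_form_def lookup_add)

lemma multilinear_lookup:
  "H.mlin n F \<Longrightarrow> multilinear (hscale S) n (\<lambda>us. F (map (\<lambda>u. Poly_Mapping.lookup u g) us))"
  by (rule multilinear_map) (simp_all add: lookup_add)

lemma linear_form_expand:
  "linear_form (hscale S) f \<Longrightarrow> f u = (\<Sum>g\<in>UNIV. f (Poly_Mapping.single g (Poly_Mapping.lookup u g)))"
  using linear_form_sum[of "hscale S" f "\<lambda>g. Poly_Mapping.single g (Poly_Mapping.lookup u g)" UNIV]
  by (simp add: sum_lookup_single)

text \<open>Group elements are group-like, so the coproduct works separately on each component u(g),
  with g attached to both legs. This formula reduces the coalgebra laws of the smash product to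
  those of \<open>H\<close>.\<close>

lemma smash_cop:
  assumes "multilinear (hscale S) 2 F"
  shows "ev (rep (comult S u)) F =
    (\<Sum>g\<in>UNIV. H.cop (Poly_Mapping.lookup u g) (\<lambda>xs. F (map (Poly_Mapping.single g) xs)))"
proof -
  have "annihilates (hrels S 2) F" using assms by (simp add: annihilates_tensor_rels)
  then show ?thesis
    using qev_qclass[of "hrels S 2" F] by (simp add: smash_def qev_def ev_sum ev_fbind)
qed

lemma smash_cop_single:
  assumes "multilinear (hscale S) 2 F"
  shows "ev (rep (comult S (Poly_Mapping.single g x))) F = H.cop x (\<lambda>xs. F (map (Poly_Mapping.single g) xs))"
proof -
  have "H.cop (Poly_Mapping.lookup (Poly_Mapping.single g x) a) (\<lambda>xs. F (map (Poly_Mapping.single a) xs)) =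
      (if a = g then H.cop x (\<lambda>xs. F (map (Poly_Mapping.single g) xs)) else 0)" for a
    using linear_form_zero[OF H.comult_linear[OF multilinear_smash_single[OF assms]]]
    by (simp add: lookup_single when_def)
  then show ?thesis by (simp add: smash_cop[OF assms])
qed

lemma cop_act: "H.mlin 2 F \<Longrightarrow> H.cop (act g x) F = H.cop x (\<lambda>xs. F (map (act g) xs))"
  using qev_qmap[of "hrels H 2" F "\<lambda>xs. gen (map (act g) xs)" "comult H x"]
  by (simp add: act_comult annihilates_tensor_rels) (simp add: qev_def)

lemma smash_comult_length:
  assumes "xs \<in> Poly_Mapping.keys (rep (comult S u))"
  shows "length xs = 2"
proof -
  have "Poly_Mapping.keys (rep (comult S u)) \<subseteq> {xs. length xs = 2}"
    unfolding smash_def hopf.simps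
    by (intro keys_rep_qclass[OF keys_tensor_rels] order_trans[OF Poly_Mapping.keys_sum] UN_least
        order_trans[OF keys_fbind] keys_subset_gen) (auto dest: H.comult_length)
  then show ?thesis using assms by blast
qed

lemma smash_comult_linear:
  "multilinear (hscale S) 2 F \<Longrightarrow> linear_form (hscale S) (\<lambda>u. ev (rep (comult S u)) F)"
  unfolding smash_cop
  by (intro linear_form_sum_fun linear_form_lookup H.comult_linear multilinear_smash_single)

lemma smash_comult_coassoc:
  assumes F: "multilinear (hscale S) 3 F"
  shows "ev (rep (comult S u)) (\<lambda>xs. ev (rep (comult S (xs ! 0))) (\<lambda>ys. F (ys @ [xs ! 1]))) =
    ev (rep (comult S u)) (\<lambda>xs. ev (rep (comult S (xs ! 1))) (\<lambda>ys. F (xs ! 0 # ys)))"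
    (is "ev _ ?L = ev _ ?R")
proof -
  have Fl: "multilinear (hscale S) 2 (\<lambda>ys. F (ys @ [z]))" for z
    using F multilinear_append1[of "hscale S" 2 "[z]" F] by simp
  have Fr: "multilinear (hscale S) 2 (\<lambda>ys. F (z # ys))" for z
    using F multilinear_Cons[of "hscale S" 2 F z] by simp
  have L: "multilinear (hscale S) 2 ?L"
  proof (rule multilinear_two_I)
    show "linear_form (hscale S) (\<lambda>a. ?L [a, b])" for b
      using smash_comult_linear[OF Fl] by simp
    show "linear_form (hscale S) (\<lambda>b. ?L [a, b])" for a
      using F by (simp, intro linear_form_ev multilinearD[where bs = "[]"]) (auto dest: smash_comult_length)
  qed
  have R: "multilinear (hscale S) 2 ?R"
  proof (rule multilinear_two_I)
    show "linear_form (hscale S) (\<lambda>b. ?R [a, b])" for a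
      using smash_comult_linear[OF Fr] by simp
    show "linear_form (hscale S) (\<lambda>a. ?R [a, b])" for b
      using F by (simp, intro linear_form_ev multilinear_hd[where n = 2]) (auto dest: smash_comult_length)
  qed
  show ?thesis
    unfolding smash_cop[OF L] smash_cop[OF R]
  proof (rule sum.cong[OF refl])
    fix g
    let ?x = "Poly_Mapping.lookup u g" and ?s = "Poly_Mapping.single g"
    have "H.cop ?x (\<lambda>xs. ?L (map ?s xs)) =
        H.cop ?x (\<lambda>xs. H.cop (xs ! 0) (\<lambda>ys. F (map ?s (ys @ [xs ! 1]))))"
      by (intro ev_cong, elim H.comult_keysE) (simp add: smash_cop_single[OF Fl])
    also have "\<dots> = H.cop ?x (\<lambda>xs. H.cop (xs ! 1) (\<lambda>ys. F (map ?s (xs ! 0 # ys))))"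
      by (rule H.comult_coassoc[OF multilinear_smash_single[OF F]])
    also have "\<dots> = H.cop ?x (\<lambda>xs. ?R (map ?s xs))"
      by (intro ev_cong, elim H.comult_keysE) (simp add: smash_cop_single[OF Fr])
    finally show "H.cop ?x (\<lambda>xs. ?L (map ?s xs)) = H.cop ?x (\<lambda>xs. ?R (map ?s xs))" .
  qed
qed

lemma multilinear_smul_right:
  "multilinear (hscale S) n F \<Longrightarrow> length us = n \<Longrightarrow> multilinear (hscale S) n (\<lambda>vs. F (smul us vs))"
  by (rule multilinear_map2) (simp_all add: smash_mult_add_right smash_mult_scale_right)

lemma multilinear_smul_left:
  "multilinear (hscale S) n F \<Longrightarrow> length vs = n \<Longrightarrow> multilinear (hscale S) n (\<lambda>us. F (smul us vs))"
  by (rule multilinear_map2_left) (simp_all add: smash_mult_add_left smash_mult_scale_left)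

lemma smul_map_single:
  "smul (map (Poly_Mapping.single a) xs) (map (Poly_Mapping.single b) ys) =
    map (Poly_Mapping.single (a + b)) (H.lmul xs (map (act a) ys))"
  by (induction xs ys rule: list_induct2') (auto simp: smash_single_mult_single)

text \<open>The product twists the second factor by the group, so besides
  \<open>H.comult_mult\<close> the argument uses that the action commutes with the coproduct, in the
  form \<open>cop_act\<close>.\<close>

lemma smash_comult_mult:
  assumes F: "multilinear (hscale S) 2 F"
  shows "ev (rep (comult S (hmult S u v))) F =
    ev (rep (comult S u)) (\<lambda>xs. ev (rep (comult S v)) (\<lambda>ys. F (smul xs ys)))"
proof -
  let ?l = Poly_Mapping.lookup and ?s = Poly_Mapping.single
  have "hmult S u v = (\<Sum>a\<in>UNIV. \<Sum>b\<in>UNIV. ?s (a + b) (hmult H (?l u a) (act a (?l v b))))"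
    by (simp add: smash_def)
  then have "ev (rep (comult S (hmult S u v))) F =
      (\<Sum>a\<in>UNIV. \<Sum>b\<in>UNIV. H.cop (hmult H (?l u a) (act a (?l v b))) (\<lambda>xs. F (map (?s (a + b)) xs)))"
    by (simp add: linear_form_sum[OF smash_comult_linear[OF F]] smash_cop_single[OF F])
  also have "\<dots> = (\<Sum>a\<in>UNIV. \<Sum>b\<in>UNIV. H.cop (?l u a) (\<lambda>xs. H.cop (?l v b)
      (\<lambda>ys. F (map (?s (a + b)) (H.lmul xs (map (act a) ys))))))"
  proof (intro sum.cong refl)
    fix a b
    note F' = multilinear_smash_single[OF F, of "a + b"]
    have "H.cop (act a (?l v b)) (\<lambda>ys. F (map (?s (a + b)) (H.lmul xs ys))) =
      H.cop (?l v b) (\<lambda>ys. F (map (?s (a + b)) (H.lmul xs (map (act a) ys))))"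
      if "xs \<in> Poly_Mapping.keys (rep (comult H (?l u a)))" for xs
      using H.comult_length[OF that] by (intro cop_act H.mlin_lmul_right[OF F'])
    then show "H.cop (hmult H (?l u a) (act a (?l v b))) (\<lambda>xs. F (map (?s (a + b)) xs)) =
      H.cop (?l u a) (\<lambda>xs. H.cop (?l v b) (\<lambda>ys. F (map (?s (a + b)) (H.lmul xs (map (act a) ys)))))"
      unfolding H.comult_mult[OF F'] by (intro ev_cong)
  qed
  also have "\<dots> = (\<Sum>a\<in>UNIV. H.cop (?l u a) (\<lambda>xs. \<Sum>b\<in>UNIV. H.cop (?l v b)
      (\<lambda>ys. F (smul (map (?s a) xs) (map (?s b) ys)))))"
    unfolding smul_map_single ev_sum_fun ..
  also have "\<dots> = (\<Sum>a\<in>UNIV. H.cop (?l u a) (\<lambda>xs. ev (rep (comult S v)) (\<lambda>ys. F (smul (map (?s a) xs) ys))))"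
    by (intro sum.cong refl ev_cong smash_cop[symmetric] multilinear_smul_right[OF F])
      (simp add: H.comult_length)
  also have "\<dots> = ev (rep (comult S u)) (\<lambda>xs. ev (rep (comult S v)) (\<lambda>ys. F (smul xs ys)))"
    by (intro smash_cop[symmetric] multilinear_ev multilinear_smul_left[OF F] smash_comult_length)
  finally show ?thesis .
qed

lemma smash_comult_cocomm:
  assumes F: "multilinear (hscale S) 2 F"
  shows "ev (rep (comult S u)) (\<lambda>xs. F (rev xs)) = ev (rep (comult S u)) F"
proof -
  have R: "multilinear (hscale S) 2 (\<lambda>xs. F (rev xs))"
  proof (rule multilinear_two_I)
    show "linear_form (hscale S) (\<lambda>a. F (rev [a, b]))" for b
      using multilinearD[OF F, of "[b]" "[]"] by simp
    show "linear_form (hscale S) (\<lambda>b. F (rev [a, b]))" for a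
      using multilinearD[OF F, of "[]" "[a]"] by simp
  qed
  show ?thesis
    unfolding smash_cop[OF R] smash_cop[OF F] rev_map[symmetric]
    by (simp add: rev_map H.comult_cocomm[OF multilinear_smash_single[OF F]])
qed

sublocale S: cocomm_bialgebra S
  by (rule cocomm_bialgebra.intro;
      fact smash_mult_add_left smash_mult_add_right smash_mult_scale_left smash_mult_scale_right
        smash_mult_assoc smash_mult_one_left smash_comult_length smash_comult_linear
        smash_comult_coassoc smash_comult_mult smash_comult_cocomm)

text \<open>Iterating \<open>smash_cop\<close> keeps g attached to every leg. The local fact
  \<open>single\<close> feeds the induction, because the second leg is again concentrated in one
  component.\<close>

lemma smash_icop:
  "1 \<le> n \<Longrightarrow> S.mlin n F \<Longrightarrow>
    S.icop n u F = (\<Sum>g\<in>UNIV. H.icop n (Poly_Mapping.lookup u g) (\<lambda>xs. F (map (Poly_Mapping.single g) xs)))"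
proof (induction n arbitrary: u F rule: nat_induct_at_least)
  case base
  show ?case
    unfolding S.icop_one H.icop_one list.map by (rule linear_form_expand[OF multilinear_one[OF base]])
next
  case (Suc n)
  let ?s = Poly_Mapping.single
  have single: "S.icop n (?s g x) G = H.icop n x (\<lambda>xs. G (map (?s g) xs))" if G: "S.mlin n G" for g x G
  proof -
    have "H.icop n (Poly_Mapping.lookup (?s g x) a) (\<lambda>xs. G (map (?s a) xs)) =
        (if a = g then H.icop n x (\<lambda>xs. G (map (?s g) xs)) else 0)" for a
      using linear_form_zero[OF H.icop_linear[OF Suc.hyps multilinear_smash_single[OF G]]]
      by (simp add: lookup_single when_def)
    then show ?thesis by (simp add: Suc.IH[OF G])
  qed
  have "S.icop (Suc n) u F = (\<Sum>g\<in>UNIV. H.cop (Poly_Mapping.lookup u g)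
      (\<lambda>xs. S.icop n (map (?s g) xs ! 1) (\<lambda>ys. F (map (?s g) xs ! 0 # ys))))"
    unfolding S.icop_Suc[OF Suc.hyps] by (rule smash_cop[OF S.mlin_icop_Cons[OF Suc.hyps Suc.prems]])
  also have "\<dots> = (\<Sum>g\<in>UNIV. H.cop (Poly_Mapping.lookup u g)
      (\<lambda>xs. H.icop n (xs ! 1) (\<lambda>ys. F (map (?s g) (xs ! 0 # ys)))))"
    by (intro sum.cong refl ev_cong, elim H.comult_keysE)
      (simp add: single[OF multilinear_Cons[OF Suc.prems]])
  finally show ?case unfolding H.icop_Suc[OF Suc.hyps] .
qed

lemma icop_act:
  "1 \<le> n \<Longrightarrow> H.mlin n F \<Longrightarrow> H.icop n (act g x) F = H.icop n x (\<lambda>xs. F (map (act g) xs))"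
proof (induction n arbitrary: x F rule: nat_induct_at_least)
  case base
  show ?case by simp
next
  case (Suc n)
  have "H.icop (Suc n) (act g x) F = H.cop x (\<lambda>xs. H.icop n (map (act g) xs ! 1)
      (\<lambda>ys. F (map (act g) xs ! 0 # ys)))"
    unfolding H.icop_Suc[OF Suc.hyps] by (rule cop_act[OF H.mlin_icop_Cons[OF Suc.hyps Suc.prems]])
  also have "\<dots> = H.cop x (\<lambda>xs. H.icop n (xs ! 1) (\<lambda>ys. F (map (act g) (xs ! 0 # ys))))"
    by (intro ev_cong, elim H.comult_keysE) (simp add: Suc.IH[OF multilinear_Cons[OF Suc.prems]])
  finally show ?case unfolding H.icop_Suc[OF Suc.hyps] .
qed

end


section \<open>Composition, permutation and the Jacobi expression\<close>

text \<open>Replaces the coset equations in \<open>pHom\<close> by conditions on balanced forms. The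
  degree condition speaks of representatives, which forms do not see, and stays as it is.\<close>

lemma pHomI:
  fixes M :: "('k::field, 'a::ab_group_add, 'l::ab_group_add) gmod"
  assumes "\<phi> \<in> extensional {xs. length xs = n}"
    and ptensor: "\<And>xs. length xs = n \<Longrightarrow> \<phi> xs \<in> ptensor K M n"
    and lin: "\<And>F. balanced_form K M n F \<Longrightarrow> multilinear (mscale M) n (\<lambda>xs. qev (\<phi> xs) F)"
    and act: "\<And>F hs xs. balanced_form K M n F \<Longrightarrow> length hs = n \<Longrightarrow> length xs = n \<Longrightarrow>
      qev (\<phi> (map2 (mact M) hs xs)) F = qev (\<phi> xs) (\<lambda>(fs, e). F (map2 (hmult K) hs fs, e))"
    and comp: "\<And>d xs. length xs = n \<Longrightarrow> (\<And>i. i < n \<Longrightarrow> xs ! i \<in> mcomp M (d i)) \<Longrightarrow>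
      \<phi> xs \<in> ptensor_comp K M n (p + (\<Sum>i<n. d i))"
  shows "\<phi> \<in> pHom K M p n"
  unfolding pHom_def
proof (intro CollectI conjI allI impI)
  show "\<phi> \<in> {xs. length xs = n} \<rightarrow>\<^sub>E ptensor K M n"
    using assms(1,2) by (auto simp: PiE_def)
  show "\<phi> (xs[i := x + y]) = qadd (ptensor_rels K M n) (\<phi> (xs[i := x])) (\<phi> (xs[i := y]))"
    if "length xs = n \<and> i < n" for xs i x y
  proof (rule ptensor_eqI)
    show "\<phi> (xs[i := x + y]) \<in> range (qclass (ptensor_rels K M n))"
      using that by (intro ptensor_range ptensor) simp
    fix F assume F: "balanced_form K M n F"
    show "qev (\<phi> (xs[i := x + y])) F = qev (qadd (ptensor_rels K M n) (\<phi> (xs[i := x])) (\<phi> (xs[i := y]))) F"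
      using linear_form_add[OF multilinear_update[OF lin[OF F]]] that by (simp add: qev_ptensor[OF F])
  qed simp
  show "\<phi> (xs[i := mscale M c x]) = qscale (ptensor_rels K M n) c (\<phi> (xs[i := x]))"
    if "length xs = n \<and> i < n" for xs i c x
  proof (rule ptensor_eqI)
    show "\<phi> (xs[i := mscale M c x]) \<in> range (qclass (ptensor_rels K M n))"
      using that by (intro ptensor_range ptensor) simp
    fix F assume F: "balanced_form K M n F"
    show "qev (\<phi> (xs[i := mscale M c x])) F = qev (qscale (ptensor_rels K M n) c (\<phi> (xs[i := x]))) F"
      using linear_form_scale[OF multilinear_update[OF lin[OF F]]] that by (simp add: qev_ptensor[OF F])
  qed simp
  show "\<phi> (map2 (mact M) hs xs) = ptensor_lmult K M n hs (\<phi> xs)"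
    if "length hs = n \<and> length xs = n" for hs xs
  proof (rule ptensor_eqI)
    show "\<phi> (map2 (mact M) hs xs) \<in> range (qclass (ptensor_rels K M n))"
      using that by (intro ptensor_range ptensor) simp
    show "ptensor_lmult K M n hs (\<phi> xs) \<in> range (qclass (ptensor_rels K M n))"
      by (simp add: ptensor_lmult_def)
    show "qev (\<phi> (map2 (mact M) hs xs)) F = qev (ptensor_lmult K M n hs (\<phi> xs)) F"
      if "balanced_form K M n F" for F
      using that \<open>length hs = n \<and> length xs = n\<close> by (simp add: act qev_lmult)
  qed
qed (use comp in blast)

text \<open>The left-hand side of the generalised Jacobi identity, named so that its linearity and
  its behaviour under \<delta> can be stated.\<close>

definition jacobiator ::
    "('k::field, 'a::ab_group_add) hopf \<Rightarrow> ('k, 'a, 'l::ab_group_add) gmod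
      \<Rightarrow> (nat \<Rightarrow> 'l list \<Rightarrow> ('a list \<times> 'l \<Rightarrow>\<^sub>0 'k) set) \<Rightarrow> nat \<Rightarrow> (nat \<Rightarrow> int) \<Rightarrow> 'l list
      \<Rightarrow> ('a list \<times> 'l \<Rightarrow>\<^sub>0 'k) set" where
  "jacobiator K M \<beta> N d xs = qsum (ptensor_rels K M N)
     (\<lambda>((k, l), \<sigma>). qscale (ptensor_rels K M N)
        (of_int (sign \<sigma>) * koszul_sign N d \<sigma> * (-1) ^ (l * (k - 1)))
        (ptensor_perm K M N \<sigma>
          (pcomp K M (\<beta> k) (\<beta> l) (take l (permute_list \<sigma> xs)) (drop l (permute_list \<sigma> xs)))))
     (SIGMA (k, l) : {(k, l). 1 \<le> k \<and> 1 \<le> l \<and> k + l = N + 1}. Sh l (k - 1))"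

lemma qev_jacobiator:
  assumes F: "balanced_form K M N F"
  shows "qev (jacobiator K M \<beta> N d xs) F =
    (\<Sum>((k, l), \<sigma>)\<in>(SIGMA (k, l) : {(k, l). 1 \<le> k \<and> 1 \<le> l \<and> k + l = N + 1}. Sh l (k - 1)).
      of_int (sign \<sigma>) * koszul_sign N d \<sigma> * (-1) ^ (l * (k - 1)) *
      qev (pcomp K M (\<beta> k) (\<beta> l) (take l (permute_list \<sigma> xs)) (drop l (permute_list \<sigma> xs)))
        (\<lambda>(fs, e). F (permute_list (inv \<sigma>) fs, e)))"
  unfolding jacobiator_def qev_ptensor(4)[OF F]
  by (rule sum.cong) (auto simp: qev_ptensor(3)[OF F] qev_perm[OF F])

lemma L_infinity_structures_iff:
  "\<beta> \<in> L_infinity_structures K M \<longleftrightarrow>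
     \<beta> \<in> (\<Pi>\<^sub>E k\<in>{1..}. pHom K M (int k - 2) k)
   \<and> (\<forall>k\<ge>1. \<forall>\<sigma> d xs. \<sigma> permutes {..<k} \<and> length xs = k \<and> (\<forall>i<k. xs ! i \<in> mcomp M (d i)) \<longrightarrow>
        \<beta> k xs = qscale (ptensor_rels K M k) (of_int (sign \<sigma>) * koszul_sign k d \<sigma>)
                   (ptensor_perm K M k \<sigma> (\<beta> k (permute_list \<sigma> xs))))
   \<and> (\<forall>N\<ge>1. \<forall>d xs. length xs = N \<and> (\<forall>i<N. xs ! i \<in> mcomp M (d i)) \<longrightarrow>
        jacobiator K M \<beta> N d xs = qclass (ptensor_rels K M N) 0)"
  unfolding L_infinity_structures_def jacobiator_def mem_Collect_eq ..

context bialgebra_module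
begin

lemma ptensorI: "Poly_Mapping.keys t \<subseteq> {x. length (fst x) = n} \<Longrightarrow> qclass (ptensor_rels K M n) t \<in> ptensor K M n"
  unfolding ptensor_def by (rule imageI) auto

lemma ptensor_rep_keys: "A \<in> ptensor K M n \<Longrightarrow> Poly_Mapping.keys (rep A) \<subseteq> {x. length (fst x) = n}"
  using ptensor_keys by blast

lemma qscale_ptensor: "A \<in> ptensor K M n \<Longrightarrow> qscale (ptensor_rels K M n) c A \<in> ptensor K M n"
  unfolding qscale_def by (intro ptensorI order_trans[OF keys_fscale] ptensor_rep_keys)

lemma qsum_ptensor:
  "(\<And>i. i \<in> I \<Longrightarrow> f i \<in> ptensor K M n) \<Longrightarrow> qsum (ptensor_rels K M n) f I \<in> ptensor K M n"
  unfolding qsum_def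
  by (intro ptensorI order_trans[OF Poly_Mapping.keys_sum] UN_least ptensor_rep_keys)

lemma perm_ptensor: "A \<in> ptensor K M n \<Longrightarrow> ptensor_perm K M n \<sigma> A \<in> ptensor K M n"
  unfolding ptensor_perm_def qmap_def
  by (intro ptensorI order_trans[OF keys_fbind] UN_least) (auto dest: ptensor_keys)

lemma lmult_ptensor:
  "A \<in> ptensor K M n \<Longrightarrow> length hs = n \<Longrightarrow> ptensor_lmult K M n hs A \<in> ptensor K M n"
  unfolding ptensor_lmult_def qmap_def
  by (intro ptensorI order_trans[OF keys_fbind] UN_least) (auto dest: ptensor_keys)

lemma pcomp_ptensor:
  assumes \<phi>: "\<phi> \<in> pHom K M p (Suc (length xs))" and \<psi>: "\<psi> \<in> pHom K M q (length ys)"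
  shows "pcomp K M \<phi> \<psi> ys xs \<in> ptensor K M (length ys + length xs)"
proof -
  have "length fs = Suc (length xs)"
    if "(fs, e') \<in> Poly_Mapping.keys (rep (\<phi> (e # xs)))" for fs e e'
    using ptensor_keys[OF pHom_ptensor[OF \<phi>] that] by simp
  moreover have "length hs = length ys" if "(hs, e) \<in> Poly_Mapping.keys (rep (\<psi> ys))" for hs e
    using ptensor_keys[OF pHom_ptensor[OF \<psi>] that] by simp
  ultimately show ?thesis
    unfolding pcomp_def qmap_def
    by (intro ptensorI order_trans[OF keys_fbind] UN_least, clarify)
      (force dest!: keys_fbind[THEN subsetD] icomult_length)
qed

text \<open>The multipliers \<open>hs\<close> pass through \<psi>, and \<open>hs'\<close> passes
  through \<phi>, whose first argument is multiplied by 1. Each passage applies linearity to a form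
  that one of the two balancedness lemmas for compositions provides.\<close>

lemma pcomp_act:
  assumes \<phi>: "\<phi> \<in> pHom K M p (Suc m)" and \<psi>: "\<psi> \<in> pHom K M q l" and l: "1 \<le> l"
    and F: "bal (l + m) F" and len: "length ys = l" "length xs = m" "length hs = l" "length hs' = m"
  shows "qev (pcomp K M \<phi> \<psi> (map2 (mact M) hs ys) (map2 (mact M) hs' xs)) F =
    qev (pcomp K M \<phi> \<psi> ys xs) (\<lambda>(us, e). F (lmul (hs @ hs') us, e))"
proof -
  let ?hx = "map2 (mact M) hs' xs"
  let ?I = "\<lambda>us (fs, e'). icop l (hd fs) (\<lambda>gs. F (lmul us gs @ tl fs, e'))"
  have "qev (pcomp K M \<phi> \<psi> (map2 (mact M) hs ys) ?hx) F =
      qev (\<psi> (map2 (mact M) hs ys)) (\<lambda>(us, e). qev (\<phi> (e # ?hx)) (?I us))"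
    using qev_pcomp[of K M "map2 (mact M) hs ys" ?hx F \<phi> \<psi>] F len by simp
  also have "\<dots> = qev (\<psi> ys) (\<lambda>(us, e). qev (\<phi> (e # ?hx)) (?I (lmul hs us)))"
    using pHom_act[OF \<psi> bal_pcomp_outer[OF \<phi> F l], of ?hx hs ys] len by simp
  also have "\<dots> = qev (\<psi> ys) (\<lambda>(us, e). qev (\<phi> (e # xs))
      (\<lambda>(fs, e'). icop l (hd fs) (\<lambda>gs. F (lmul (hs @ hs') (lmul us gs @ tl fs), e'))))"
  proof (rule qev_ptensor_cong[OF pHom_ptensor[OF \<psi> len(1)]], unfold split_conv)
    fix us :: "'a list" and e assume us: "length us = l"
    have "map2 (mact M) (hone K # hs') (e # xs) = e # ?hx" by (simp add: act_one)
    then have "qev (\<phi> (e # ?hx)) (?I (lmul hs us)) =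
        qev (\<phi> (e # xs)) (\<lambda>(fs, e'). ?I (lmul hs us) (lmul (hone K # hs') fs, e'))"
      using pHom_act[OF \<phi> bal_pcomp_inner[OF F l], of "lmul hs us" "hone K # hs'" "e # xs"] us len
      by (simp del: list.map)
    also have "\<dots> = qev (\<phi> (e # xs))
      (\<lambda>(fs, e'). icop l (hd fs) (\<lambda>gs. F (lmul (hs @ hs') (lmul us gs @ tl fs), e')))"
    proof (rule qev_ptensor_cong, rule pHom_ptensor[OF \<phi>])
      fix fs :: "'a list" and e' assume "length fs = Suc m"
      then obtain f fs' where fs: "fs = f # fs'" "length fs' = m" by (cases fs) auto
      have "icop l f (\<lambda>gs. F (lmul (lmul hs us) gs @ lmul hs' fs', e')) =
          icop l f (\<lambda>gs. F (lmul (hs @ hs') (lmul us gs @ fs'), e'))"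
        using fs us len by (intro ev_cong) (simp add: lmul_assoc icomult_length)
      then show "(case (fs, e') of (fs, e') \<Rightarrow> ?I (lmul hs us) (lmul (hone K # hs') fs, e')) =
          (case (fs, e') of (fs, e') \<Rightarrow> icop l (hd fs) (\<lambda>gs. F (lmul (hs @ hs') (lmul us gs @ tl fs), e')))"
        by (simp add: fs mult_one_left)
    qed (simp add: len)
    finally show "qev (\<phi> (e # ?hx)) (?I (lmul hs us)) = qev (\<phi> (e # xs))
      (\<lambda>(fs, e'). icop l (hd fs) (\<lambda>gs. F (lmul (hs @ hs') (lmul us gs @ tl fs), e')))" .
  qed
  also have "\<dots> = qev (pcomp K M \<phi> \<psi> ys xs) (\<lambda>(us, e). F (lmul (hs @ hs') us, e))"
    using qev_pcomp[of K M ys xs "\<lambda>(us, e). F (lmul (hs @ hs') us, e)" \<phi> \<psi>]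
      bal_lmul[OF F, of "hs @ hs'"] len by simp
  finally show ?thesis .
qed

lemma jacobiator_indices:
  assumes "((k, l), \<sigma>) \<in> (SIGMA (k, l) : {(k, l). 1 \<le> k \<and> 1 \<le> l \<and> k + l = N + 1}. Sh l (k - 1))"
  shows "1 \<le> l" "l + (k - 1) = N" "k = Suc (k - 1)" "\<sigma> permutes {..<N}"
proof -
  show "1 \<le> l" and N: "l + (k - 1) = N" and "k = Suc (k - 1)" using assms by auto
  show "\<sigma> permutes {..<N}" using assms unfolding Sh_def N[symmetric] by auto
qed

lemma jacobiator_ptensor:
  assumes \<beta>: "\<And>k. 1 \<le> k \<Longrightarrow> \<beta> k \<in> pHom K M (p k) k" and xs: "length xs = N"
  shows "jacobiator K M \<beta> N d xs \<in> ptensor K M N"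
  unfolding jacobiator_def
proof (rule qsum_ptensor, clarify, intro qscale_ptensor perm_ptensor)
  fix k l \<sigma> assume *: "1 \<le> k" "1 \<le> l" "k + l = N + 1"
  have "\<beta> k \<in> pHom K M (p k) (Suc (length (drop l (permute_list \<sigma> xs))))"
    "\<beta> l \<in> pHom K M (p l) (length (take l (permute_list \<sigma> xs)))"
  proof -
    have "Suc (length (drop l (permute_list \<sigma> xs))) = k" "length (take l (permute_list \<sigma> xs)) = l"
      using * xs by auto
    then show "\<beta> k \<in> pHom K M (p k) (Suc (length (drop l (permute_list \<sigma> xs))))"
      "\<beta> l \<in> pHom K M (p l) (length (take l (permute_list \<sigma> xs)))"
      using * \<beta> by simp_all
  qed
  from pcomp_ptensor[OF this]
  show "pcomp K M (\<beta> k) (\<beta> l) (take l (permute_list \<sigma> xs)) (drop l (permute_list \<sigma> xs)) \<in> ptensor K M N"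
    using * xs by simp
qed

text \<open>In each summand the multipliers are permuted together with the arguments, and the later
  \<open>inv \<sigma>\<close> puts them back in order. The signs depend only on d, which is the same
  on both sides. With group-like multipliers this reduces the Jacobi identity over the smash product
  to translated arguments.\<close>

lemma jacobiator_act:
  assumes \<beta>: "\<And>k. 1 \<le> k \<Longrightarrow> \<beta> k \<in> pHom K M (p k) k"
    and F: "bal N F" and len: "length xs = N" "length hs = N"
  shows "qev (jacobiator K M \<beta> N d (map2 (mact M) hs xs)) F =
    qev (jacobiator K M \<beta> N d xs) (\<lambda>(fs, e). F (lmul hs fs, e))"
  unfolding qev_jacobiator[OF F] qev_jacobiator[OF bal_lmul[OF F len(2)]]
proof (rule sum.cong[OF refl], goal_cases)
  case (1 x)
  obtain k l \<sigma> where x: "x = ((k, l), \<sigma>)" by (metis surj_pair)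
  note idx = jacobiator_indices[OF 1[unfolded x]]
  let ?hs = "permute_list \<sigma> hs" and ?xs = "permute_list \<sigma> xs"
  have \<sigma>': "inv \<sigma> permutes {..<N}" by (rule permutes_inv[OF idx(4)])
  have perm: "permute_list \<sigma> (map2 (mact M) hs xs) = map2 (mact M) ?hs ?xs"
    using idx(4) len by (simp add: permute_list_map permute_list_zip)
  have unperm: "permute_list (inv \<sigma>) ?hs = hs"
    using permute_list_compose[of "inv \<sigma>" hs \<sigma>] \<sigma>' len permutes_inv_o[OF idx(4)] by simp
  have len': "length (take l ?xs) = l" "length (drop l ?xs) = k - 1"
    "length (take l ?hs) = l" "length (drop l ?hs) = k - 1"
    using idx(2) len by (auto simp: min_def)
  have \<phi>: "\<beta> k \<in> pHom K M (p k) (Suc (k - 1))" and \<psi>: "\<beta> l \<in> pHom K M (p l) l"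
    using \<beta>[of k] \<beta>[of l] idx by auto
  have PF: "bal (l + (k - 1)) (\<lambda>(fs, e). F (permute_list (inv \<sigma>) fs, e))"
    using bal_permute[OF F \<sigma>'] idx(2) by simp
  have "qev (pcomp K M (\<beta> k) (\<beta> l) (take l (permute_list \<sigma> (map2 (mact M) hs xs)))
        (drop l (permute_list \<sigma> (map2 (mact M) hs xs)))) (\<lambda>(fs, e). F (permute_list (inv \<sigma>) fs, e)) =
      qev (pcomp K M (\<beta> k) (\<beta> l) (take l ?xs) (drop l ?xs))
        (\<lambda>(us, e). F (permute_list (inv \<sigma>) (lmul ?hs us), e))"
    using pcomp_act[OF \<phi> \<psi> idx(1) PF len'] unfolding perm by (simp add: take_map drop_map take_zip drop_zip)
  also have "\<dots> = qev (pcomp K M (\<beta> k) (\<beta> l) (take l ?xs) (drop l ?xs))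
        (\<lambda>(us, e). F (lmul hs (permute_list (inv \<sigma>) us), e))"
  proof (rule qev_ptensor_cong)
    show "pcomp K M (\<beta> k) (\<beta> l) (take l ?xs) (drop l ?xs) \<in> ptensor K M N"
      using pcomp_ptensor[of "\<beta> k" "p k" "drop l ?xs" "\<beta> l" "p l" "take l ?xs"] \<phi> \<psi> idx(2)
      unfolding len' by simp
    fix us :: "'a list" and e assume "length us = N"
    then show "(case (us, e) of (us, e) \<Rightarrow> F (permute_list (inv \<sigma>) (lmul ?hs us), e)) =
        (case (us, e) of (us, e) \<Rightarrow> F (lmul hs (permute_list (inv \<sigma>) us), e))"
      using permute_lmul[OF \<sigma>', of ?hs us] unperm len by simp
  qed
  finally show ?case by (simp add: x)
qed

end


section \<open>Transfer of forms between the two balanced tensor products\<close>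

context smash_action
begin

abbreviation grouplike :: "'g \<Rightarrow> 'g \<Rightarrow>\<^sub>0 'h" where
  "grouplike g \<equiv> Poly_Mapping.single g (hone H)"

lemma act_one_hmult: "hmult H (hone H) (act g x) = act g x" "hmult H x (act g (hone H)) = x"
  by (simp_all add: mult_one_left mult_one_right act_hone)

lemma icop_hone: "1 \<le> n \<Longrightarrow> H.mlin n F \<Longrightarrow> H.icop n (hone H) F = F (replicate n (hone H))"
proof (induction n arbitrary: F rule: nat_induct_at_least)
  case base
  show ?case by simp
next
  case (Suc n)
  have cop: "H.cop (hone H) G = G [hone H, hone H]" if "H.mlin 2 G" for G
    using qev_qclass[of "hrels H 2" G] that
    by (simp add: comult_one annihilates_tensor_rels qev_def[symmetric])
  show ?case
    unfolding H.icop_Suc[OF Suc.hyps] cop[OF H.mlin_icop_Cons[OF Suc.hyps Suc.prems]]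
    by (simp add: Suc.IH[OF multilinear_Cons[OF Suc.prems]])
qed

lemma smash_icop_single:
  assumes "1 \<le> n" "S.mlin n F"
  shows "S.icop n (Poly_Mapping.single g x) F = H.icop n x (\<lambda>xs. F (map (Poly_Mapping.single g) xs))"
proof -
  have "H.icop n (Poly_Mapping.lookup (Poly_Mapping.single g x) a) (\<lambda>xs. F (map (Poly_Mapping.single a) xs)) =
      (if a = g then H.icop n x (\<lambda>xs. F (map (Poly_Mapping.single g) xs)) else 0)" for a
    using linear_form_zero[OF H.icop_linear[OF assms(1) multilinear_smash_single[OF assms(2)]]]
    by (simp add: lookup_single when_def)
  then show ?thesis by (simp add: smash_icop[OF assms])
qed

lemma smash_icop_grouplike:
  "1 \<le> n \<Longrightarrow> S.mlin n F \<Longrightarrow> S.icop n (grouplike g) F = F (replicate n (grouplike g))"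
  by (simp add: smash_icop_single icop_hone[OF _ multilinear_smash_single])

lemma finite_lists_length [simp]: "finite {gs :: 'g list. length gs = n}"
  using finite_lists_length_eq[of "UNIV :: 'g set" n] by simp

text \<open>Each entry is the sum of its group components, so a multilinear function is determined
  by its values on tuples whose entries are concentrated in one component each.\<close>

lemma multilinear_expand:
  "S.mlin n F \<Longrightarrow> length us = n \<Longrightarrow>
    F us = (\<Sum>gs\<in>{gs. length gs = n}. F (map2 (\<lambda>g u. Poly_Mapping.single g (Poly_Mapping.lookup u g)) gs us))"
proof (induction n arbitrary: F us)
  case 0
  then show ?case by simp
next
  case (Suc n)
  let ?p = "\<lambda>g u. Poly_Mapping.single g (Poly_Mapping.lookup u g)"
  obtain u us' where us: "us = u # us'" "length us' = n" using Suc.prems by (cases us) auto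
  have "F us = (\<Sum>g\<in>UNIV. F (?p g u # us'))"
    unfolding us by (rule linear_form_expand[OF multilinear_hd[OF Suc.prems(1) us(2)]])
  also have "\<dots> = (\<Sum>g\<in>UNIV. \<Sum>gs\<in>{gs. length gs = n}. F (?p g u # map2 ?p gs us'))"
    by (intro sum.cong refl Suc.IH us multilinear_Cons Suc.prems)
  also have "\<dots> = (\<Sum>(g, gs)\<in>UNIV \<times> {gs. length gs = n}. F (?p g u # map2 ?p gs us'))"
    by (rule sum.cartesian_product)
  also have "\<dots> = (\<Sum>gs\<in>{gs. length gs = Suc n}. F (map2 ?p gs us))"
    by (rule sum.reindex_bij_witness[of _ "\<lambda>gs. (hd gs, tl gs)" "\<lambda>(g, gs). g # gs"])
      (auto simp: us length_Suc_conv)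
  finally show ?case .
qed

end

locale smash_module = smash_action H act + M: graded_left_module "smash H act" M
  for H :: "('k::field, 'h::ab_group_add) hopf" and act :: "'g::{group_add,finite} \<Rightarrow> 'h \<Rightarrow> 'h"
    and M :: "('k, 'g \<Rightarrow>\<^sub>0 'h, 'l::ab_group_add) gmod"
begin

sublocale SM: bialgebra_module S M
  by unfold_locales

abbreviation U :: "('k, 'h, 'l) gmod" where
  "U \<equiv> underlying_module M"

abbreviation gact :: "'g \<Rightarrow> 'l \<Rightarrow> 'l" where
  "gact \<equiv> group_act H M"

lemma underlying_simps [simp]:
  "mscale U = mscale M" "mact U f x = mact M (Poly_Mapping.single 0 f) x" "mcomp U = mcomp M"
  by (simp_all add: underlying_module_def)

lemma underlying_graded: "graded_left_module H U"
proof (rule graded_left_module.intro, goal_cases)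
  case 1 show ?case using M.vector_space by simp
next
  case 2 show ?case by (simp add: single_add M.act_add_left)
next
  case 3 show ?case by (simp add: M.act_add_right)
next
  case 4 show ?case by (simp add: smash_single_scale M.act_scale_left)
next
  case 5 show ?case by (simp add: M.act_scale_right)
next
  case 6 show ?case using M.act_one by (simp add: hone_smash)
next
  case 7
  show ?case by (simp add: M.act_mult[symmetric] smash_single_mult_single act_zero)
next
  case 8 show ?case using M.comp_subspace by simp
next
  case 9 then show ?case using M.act_comp by simp
next
  case 10 show ?case using M.direct_sum by simp
qed

sublocale HM: bialgebra_module H U
  by (rule bialgebra_module.intro[OF H.cocomm_bialgebra_axioms underlying_graded])

lemma mact_single: "mact M (Poly_Mapping.single g f) x = mact U f (gact g x)"
  by (simp add: group_act_def M.act_mult[symmetric] smash_single_mult_single act_one_hmult)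

lemma gact_mact: "gact g (mact U f x) = mact U (act g f) (gact g x)"
  by (simp add: group_act_def M.act_mult[symmetric] smash_single_mult_single act_one_hmult act_zero
      mult_one_right)

lemma gact_plus: "gact (a + b) x = gact a (gact b x)"
  by (simp add: group_act_def M.act_mult[symmetric] smash_single_mult_single act_one_hmult)

lemma gact_zero: "gact 0 x = x"
  using M.act_one by (simp add: group_act_def hone_smash)

lemma gact_add: "gact g (x + y) = gact g x + gact g y"
  by (simp add: group_act_def M.act_add_right)

lemma gact_scale: "gact g (mscale M c x) = mscale M c (gact g x)"
  by (simp add: group_act_def M.act_scale_right)

lemma gact_0 [simp]: "gact g 0 = 0"
  using gact_add[of g 0 0] by simp

lemma gact_sum: "gact g (\<Sum>i\<in>I. x i) = (\<Sum>i\<in>I. gact g (x i))"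
  by (induction I rule: infinite_finite_induct) (auto simp: gact_add)

lemma gact_comp: "x \<in> mcomp M p \<Longrightarrow> gact g x \<in> mcomp M p"
  by (simp add: group_act_def M.act_comp)

lemma mact_0_left [simp]: "mact M 0 x = 0"
  using M.act_add_left[of 0 0 x] by simp

lemma mact_sum_left: "mact M (\<Sum>i\<in>I. u i) x = (\<Sum>i\<in>I. mact M (u i) x)"
  by (induction I rule: infinite_finite_induct) (auto simp: M.act_add_left)

lemma mact_expand: "mact M u x = (\<Sum>g\<in>UNIV. mact U (Poly_Mapping.lookup u g) (gact g x))"
proof -
  have "mact M u x = mact M (\<Sum>g\<in>UNIV. Poly_Mapping.single g (Poly_Mapping.lookup u g)) x"
    by (simp add: sum_lookup_single)
  then show ?thesis unfolding mact_sum_left mact_single .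
qed

lemma linear_form_gact: "linear_form (mscale M) f \<Longrightarrow> linear_form (mscale M) (\<lambda>x. f (gact g x))"
  by (simp add: linear_form_def gact_add gact_scale)

definition delta_form :: "('h list \<times> 'l \<Rightarrow> 'k) \<Rightarrow> ('g \<Rightarrow>\<^sub>0 'h) list \<times> 'l \<Rightarrow> 'k" where
  "delta_form F = (\<lambda>(us, e). \<Sum>g\<in>UNIV. F (map (\<lambda>u. Poly_Mapping.lookup u g) us, gact g e))"

lemma lookup_smul_single:
  "map (\<lambda>u. Poly_Mapping.lookup u a) (smul us (map (Poly_Mapping.single b) xs)) =
    H.lmul (map (\<lambda>u. Poly_Mapping.lookup u (a - b)) us) (map (act (a - b)) xs)"
  by (induction us xs rule: list_induct2') (auto simp: lookup_smash_mult_single)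

text \<open>This is the well-definedness of \<delta>. Right multiplication by an element x b moves
  component c to c + b and twists x by c; F absorbs the twisted factor, and \<open>gact_mact\<close>
  reassembles the action of v on e.\<close>

lemma bal_delta_form:
  assumes F: "HM.bal n F" and n: "1 \<le> n"
  shows "SM.bal n (delta_form F)"
  unfolding balanced_form_def
proof (intro conjI allI impI)
  have mlin: "S.mlin n (\<lambda>us. delta_form F (us, e))" for e
    unfolding delta_form_def split_conv
    by (intro multilinear_sum_fun multilinear_lookup balanced_multilinear[OF F])
  then show "S.mlin n (\<lambda>us. delta_form F (us, e))" for e .
  show "linear_form (mscale M) (\<lambda>e. delta_form F (us, e))" if "length us = n" for us
    unfolding delta_form_def split_conv
    using balanced_linear[OF F] that by (intro linear_form_sum_fun linear_form_gact) simp
  fix us :: "('g \<Rightarrow>\<^sub>0 'h) list" and v e assume us: "length us = n"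
  let ?l = Poly_Mapping.lookup
  let ?t = "\<lambda>c b xs. F (H.lmul (map (\<lambda>u. ?l u c) us) xs, gact (c + b) e)"
  \<comment> \<open>The summation index is c = a - b, the component of \<open>us\<close> from which
    component a of the product arises.\<close>
  have eq: "delta_form F (smul us (map (Poly_Mapping.single b) xs), e) =
      (\<Sum>c\<in>UNIV. ?t c b (map (act c) xs))" for b xs
    unfolding delta_form_def split_conv lookup_smul_single
    by (subst sum_UNIV_shift_right[of _ b, symmetric]) simp
  have "S.icop n v (\<lambda>ws. delta_form F (smul us ws, e)) =
      (\<Sum>b\<in>UNIV. H.icop n (?l v b) (\<lambda>xs. delta_form F (smul us (map (Poly_Mapping.single b) xs), e)))"
    by (rule smash_icop[OF n multilinear_smul_right[OF mlin us]])
  also have "\<dots> = (\<Sum>b\<in>UNIV. \<Sum>c\<in>UNIV. H.icop n (?l v b) (\<lambda>xs. ?t c b (map (act c) xs)))"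
    unfolding eq ev_sum_fun ..
  also have "\<dots> = (\<Sum>b\<in>UNIV. \<Sum>c\<in>UNIV. H.icop n (act c (?l v b)) (?t c b))"
    using us by (intro sum.cong refl icop_act[OF n, symmetric] H.mlin_lmul_right balanced_multilinear[OF F]) simp
  also have "\<dots> = (\<Sum>b\<in>UNIV. \<Sum>c\<in>UNIV.
      F (map (\<lambda>u. ?l u c) us, mact U (act c (?l v b)) (gact (c + b) e)))"
    using us by (intro sum.cong refl balanced_act[OF F]) simp
  also have "\<dots> = (\<Sum>c\<in>UNIV. \<Sum>b\<in>UNIV. F (map (\<lambda>u. ?l u c) us, gact c (mact U (?l v b) (gact b e))))"
    unfolding gact_mact gact_plus by (rule sum.swap)
  also have "\<dots> = delta_form F (us, mact M v e)"
    unfolding delta_form_def split_conv mact_expand[of v] gact_sum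
    using balanced_linear[OF F] us by (intro sum.cong refl linear_form_sum[where s = "mscale M", symmetric]) simp
  finally show "S.icop n v (\<lambda>ws. delta_form F (smul us ws, e)) = delta_form F (us, mact M v e)" .
qed

text \<open>For fixed e, the value of F at fs and u e is balanced over \<open>H\<close> as a
  function of fs and u, by associativity of the action on \<open>M\<close>. Hence the representative
  of \<open>delta_pure\<close> does not matter, and the tensor factor over the smash product is
  contracted as in the isomorphism in the definition of \<delta>.\<close>

lemma ev_delta_pure:
  assumes F: "HM.bal (length us) F" and us: "us \<noteq> []"
  shows "ev (rep (delta_pure H act us)) (\<lambda>(fs, u). F (fs, mact M u e)) = delta_form F (us, e)"
proof -
  have "balanced_form H (underlying_module (regular_module S)) (length us) (\<lambda>(fs, u). F (fs, mact M u e))"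
    unfolding balanced_form_def
  proof (intro conjI allI impI)
    show "H.mlin (length us) (\<lambda>hs. case (hs, u) of (fs, u) \<Rightarrow> F (fs, mact M u e))" for u
      using balanced_multilinear[OF F] by simp
    fix hs :: "'h list" assume hs: "length hs = length us"
    show "linear_form (mscale (underlying_module (regular_module S)))
        (\<lambda>u. case (hs, u) of (fs, u) \<Rightarrow> F (fs, mact M u e))"
      using balanced_linear[OF F hs]
      by (simp add: underlying_module_def regular_module_def linear_form_def M.act_add_left M.act_scale_left)
    show "H.icop (length us) h (\<lambda>fs. case (H.lmul hs fs, u) of (fs, u) \<Rightarrow> F (fs, mact M u e)) =
        (case (hs, mact (underlying_module (regular_module S)) h u) of (fs, u) \<Rightarrow> F (fs, mact M u e))" for h u
      using balanced_act[OF F hs, of h "mact M u e"]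
      by (simp add: underlying_module_def regular_module_def M.act_mult)
  qed
  from qev_ptensor(1)[OF this] show ?thesis
    by (simp add: delta_pure_def qev_def ev_sum delta_form_def group_act_def)
qed

text \<open>All evaluations of \<delta> go through this rule. Membership of the value of \<phi> in
  \<open>ptensor S M n\<close> supplies the lengths that \<open>ev_delta_pure\<close> asks
  for.\<close>

lemma qev_delta:
  assumes \<phi>: "\<phi> xs \<in> ptensor S M n" and xs: "length xs = n" and n: "1 \<le> n" and F: "HM.bal n F"
  shows "qev (delta H act M n \<phi> xs) F = qev (\<phi> xs) (delta_form F)"
proof -
  have "qev (delta H act M n \<phi> xs) F =
      qev (\<phi> xs) (\<lambda>(us, e). ev (rep (delta_pure H act us)) (\<lambda>(fs, u). F (fs, mact M u e)))"
    using xs by (simp add: delta_def qev_ptensor[OF F] ev_fbind case_prod_unfold)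
  also have "\<dots> = qev (\<phi> xs) (delta_form F)"
    using F n by (intro SM.qev_ptensor_cong[OF \<phi>], unfold split_conv, intro ev_delta_pure) auto
  finally show ?thesis .
qed

section \<open>The inclusion of H and the reconstruction of an element from its images under
  \<delta>\<close>

definition incl_form :: "(('g \<Rightarrow>\<^sub>0 'h) list \<times> 'l \<Rightarrow> 'k) \<Rightarrow> 'h list \<times> 'l \<Rightarrow> 'k" where
  "incl_form F = (\<lambda>(fs, e). F (map (Poly_Mapping.single 0) fs, e))"

lemma bal_incl_form:
  assumes F: "SM.bal n F" and n: "1 \<le> n"
  shows "HM.bal n (incl_form F)"
  unfolding balanced_form_def incl_form_def split_conv
proof (intro conjI allI impI)
  show "H.mlin n (\<lambda>hs. F (map (Poly_Mapping.single 0) hs, e))" for e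
    by (rule multilinear_smash_single[OF balanced_multilinear[OF F]])
  fix hs :: "'h list" assume hs: "length hs = n"
  then show "linear_form (mscale U) (\<lambda>e. F (map (Poly_Mapping.single 0) hs, e))"
    using balanced_linear[OF F] by simp
  fix h e
  have act_id: "map (act 0) xs = xs" for xs by (induction xs) (simp_all add: act_zero)
  have "H.icop n h (\<lambda>fs. F (map (Poly_Mapping.single 0) (H.lmul hs fs), e)) =
      H.icop n h (\<lambda>fs. F (smul (map (Poly_Mapping.single 0) hs) (map (Poly_Mapping.single 0) fs), e))"
    by (simp add: smul_map_single act_id)
  also have "\<dots> = S.icop n (Poly_Mapping.single 0 h) (\<lambda>ws. F (smul (map (Poly_Mapping.single 0) hs) ws, e))"
    using hs by (intro smash_icop_single[OF n, symmetric] multilinear_smul_right balanced_multilinear[OF F]) simp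
  also have "\<dots> = F (map (Poly_Mapping.single 0) hs, mact U h e)"
    using hs balanced_act[OF F] by simp
  finally show "H.icop n h (\<lambda>fs. F (map (Poly_Mapping.single 0) (H.lmul hs fs), e)) =
      F (map (Poly_Mapping.single 0) hs, mact U h e)" .
qed

definition lmul_form :: "('g \<Rightarrow>\<^sub>0 'h) list \<Rightarrow> (('g \<Rightarrow>\<^sub>0 'h) list \<times> 'l \<Rightarrow> 'k) \<Rightarrow> ('g \<Rightarrow>\<^sub>0 'h) list \<times> 'l \<Rightarrow> 'k" where
  "lmul_form us F = (\<lambda>(vs, e). F (smul us vs, e))"

lemma bal_lmul_form: "SM.bal n F \<Longrightarrow> length us = n \<Longrightarrow> SM.bal n (lmul_form us F)"
  unfolding lmul_form_def by (rule SM.bal_lmul)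

text \<open>Modulo the diagonal right translations every tuple of group elements has a unique
  representative with first entry \<^term>\<open>0\<close>.\<close>

definition cosets :: "nat \<Rightarrow> 'g list set" where
  "cosets n = {gs. length gs = n \<and> hd gs = 0}"

lemma finite_cosets [simp]: "finite (cosets n)"
  by (rule finite_subset[OF _ finite_lists_length[of n]]) (auto simp: cosets_def)

text \<open>Sending (gs, a) to the right translate of gs by a is a bijection onto all tuples; its
  inverse subtracts the head, which exists because n is positive.\<close>

lemma sum_cosets:
  assumes "1 \<le> n"
  shows "(\<Sum>gs\<in>cosets n. \<Sum>a\<in>UNIV. f (map (\<lambda>g. g + a) gs)) = (\<Sum>gs\<in>{gs. length gs = n}. f gs)"
proof -
  have "(\<Sum>gs\<in>cosets n. \<Sum>a\<in>UNIV. f (map (\<lambda>g. g + a) gs)) =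
      (\<Sum>(gs, a)\<in>cosets n \<times> UNIV. f (map (\<lambda>g. g + a) gs))"
    by (rule sum.cartesian_product)
  also have "\<dots> = (\<Sum>gs\<in>{gs. length gs = n}. f gs)"
    using assms
    by (intro sum.reindex_bij_witness[of _ "\<lambda>hs. (map (\<lambda>h. h - hd hs) hs, hd hs)" "\<lambda>(gs, a). map (\<lambda>g. g + a) gs"])
      (auto simp: cosets_def hd_map o_def length_greater_0_conv[symmetric] simp del: length_greater_0_conv)
  finally show ?thesis .
qed

text \<open>For fixed gs, multiplication by the inverses brings component g + a to a, \<delta>
  collects the components with equal a, and multiplication by gs after the inclusion moves them to
  g. Balancedness of F trades the remaining action of a on e for right translation by a. The sum
  over a thus runs through one orbit of tuples, and the orbits together give
  \<open>multilinear_expand\<close>.\<close>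

lemma smash_form_expand:
  assumes F: "SM.bal n F" and n: "1 \<le> n" and us: "length us = n"
  shows "F (us, e) = (\<Sum>gs\<in>cosets n.
    lmul_form (map (\<lambda>g. grouplike (- g)) gs) (delta_form (incl_form (lmul_form (map grouplike gs) F))) (us, e))"
proof -
  let ?l = Poly_Mapping.lookup and ?s = Poly_Mapping.single
  have "lmul_form (map (\<lambda>g. grouplike (- g)) gs) (delta_form (incl_form (lmul_form (map grouplike gs) F))) (us, e)
      = (\<Sum>a\<in>UNIV. F (map2 (\<lambda>g u. ?s g (?l u g)) (map (\<lambda>g. g + a) gs) us, e))"
    if gs: "length gs = n" for gs
    unfolding lmul_form_def delta_form_def incl_form_def split_conv
  proof (rule sum.cong[OF refl])
    fix a
    have 1: "smul (map grouplike gs) (map (?s 0) (map (\<lambda>u. ?l u a) (smul (map (\<lambda>g. grouplike (- g)) gs) us))) =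
        map2 (\<lambda>g u. ?s g (?l u (g + a))) gs us"
      by (induction gs us rule: list_induct2')
        (auto simp: smash_single_mult_single lookup_smash_single_mult act_one_hmult act_plus[symmetric]
          act_zero mult_one_left act_hmult act_hone)
    have 2: "smul (map2 (\<lambda>g u. ?s g (?l u (g + a))) gs us) (replicate n (grouplike a)) =
        map2 (\<lambda>g u. ?s g (?l u g)) (map (\<lambda>g. g + a) gs) us"
      using gs us
      by (induction gs us arbitrary: n rule: list_induct2')
        (auto simp: smash_single_mult_single act_one_hmult)
    \<comment> \<open>As a is group-like, its iterated coproduct multiplies every factor by
      a.\<close>
    have "F (map2 (\<lambda>g u. ?s g (?l u (g + a))) gs us, gact a e) =
        S.icop n (grouplike a) (\<lambda>ws. F (smul (map2 (\<lambda>g u. ?s g (?l u (g + a))) gs us) ws, e))"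
      using balanced_act[OF F] gs us by (simp add: group_act_def)
    also have "\<dots> = F (map2 (\<lambda>g u. ?s g (?l u g)) (map (\<lambda>g. g + a) gs) us, e)"
      unfolding 2[symmetric] using gs us
      by (intro smash_icop_grouplike[OF n] multilinear_smul_right balanced_multilinear[OF F]) simp
    finally show "F (smul (map grouplike gs) (map (?s 0) (map (\<lambda>u. ?l u a)
        (smul (map (\<lambda>g. grouplike (- g)) gs) us))), gact a e) =
      F (map2 (\<lambda>g u. ?s g (?l u g)) (map (\<lambda>g. g + a) gs) us, e)"
      unfolding 1 .
  qed
  then have "(\<Sum>gs\<in>cosets n. lmul_form (map (\<lambda>g. grouplike (- g)) gs)
      (delta_form (incl_form (lmul_form (map grouplike gs) F))) (us, e)) =
    (\<Sum>gs\<in>cosets n. \<Sum>a\<in>UNIV. F (map2 (\<lambda>g u. ?s g (?l u g)) (map (\<lambda>g. g + a) gs) us, e))"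
    by (intro sum.cong refl) (simp add: cosets_def)
  also have "\<dots> = (\<Sum>gs\<in>{gs. length gs = n}. F (map2 (\<lambda>g u. ?s g (?l u g)) gs us, e))"
    by (rule sum_cosets[OF n, where f = "\<lambda>gs. F (map2 (\<lambda>g u. ?s g (?l u g)) gs us, e)"])
  also have "\<dots> = F (us, e)"
    by (rule multilinear_expand[OF balanced_multilinear[OF F] us, symmetric])
  finally show ?thesis by simp
qed

text \<open>Each summand of \<open>smash_form_expand\<close> is one of the test forms in the
  hypothesis, for the tuple of inverses, so these forms suffice to separate points.\<close>

lemma smash_separation:
  assumes A: "A \<in> ptensor S M n" and B: "B \<in> ptensor S M n" and n: "1 \<le> n"
    and eq: "\<And>F gs. HM.bal n F \<Longrightarrow> length gs = n \<Longrightarrow>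
      qev A (lmul_form (map grouplike gs) (delta_form F)) = qev B (lmul_form (map grouplike gs) (delta_form F))"
  shows "A = B"
proof (rule ptensor_eqI[OF ptensor_range[OF A] ptensor_range[OF B]])
  fix F assume F: "SM.bal n F"
  define T where "T = (\<lambda>gs. lmul_form (map (\<lambda>g. grouplike (- g)) gs)
    (delta_form (incl_form (lmul_form (map grouplike gs) F))))"
  have expand: "qev C F = (\<Sum>gs\<in>cosets n. qev C (T gs))" if C: "C \<in> ptensor S M n" for C
  proof -
    have "qev C F = qev C (\<lambda>x. \<Sum>gs\<in>cosets n. T gs x)"
      by (rule SM.qev_ptensor_cong[OF C]) (simp add: smash_form_expand[OF F n] T_def)
    then show ?thesis by (simp add: qev_def ev_sum_fun)
  qed
  have "qev A (T gs) = qev B (T gs)" if "gs \<in> cosets n" for gs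
    using that eq[of "incl_form (lmul_form (map grouplike gs) F)" "map uminus gs"]
      bal_incl_form[OF bal_lmul_form[OF F] n, of "map grouplike gs"]
    by (simp add: T_def cosets_def o_def)
  then show "qev A F = qev B F" by (simp add: expand A B)
qed

text \<open>A left factor from \<open>H\<close> multiplies every group component without moving it;
  this is the linearity of \<delta> over the tensor power of \<open>H\<close>.\<close>

lemma delta_form_lmul_single:
  "delta_form F (smul (map (Poly_Mapping.single 0) fs) us, e) =
    delta_form (\<lambda>(hs, e). F (H.lmul fs hs, e)) (us, e)"
proof -
  have "map (\<lambda>u. Poly_Mapping.lookup u g) (smul (map (Poly_Mapping.single 0) fs) us) =
      H.lmul fs (map (\<lambda>u. Poly_Mapping.lookup u g) us)" for g
    by (induction fs us rule: list_induct2') (auto simp: lookup_smash_single_mult act_zero)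
  then show ?thesis by (simp add: delta_form_def)
qed

lemma delta_form_permute:
  assumes "\<sigma> permutes {..<n}" "length us = n"
  shows "delta_form F (permute_list \<sigma> us, e) = delta_form (\<lambda>(fs, e). F (permute_list \<sigma> fs, e)) (us, e)"
  using assms by (simp add: delta_form_def permute_list_map)

end


section \<open>Properties of \<open>\<delta>\<close>\<close>

context smash_module
begin

lemma map2_mact_grouplike: "map2 (mact M) (map grouplike gs) xs = map2 gact gs xs"
  by (induction gs xs rule: list_induct2') (auto simp: group_act_def)

lemma qev_delta_pHom:
  "\<phi> \<in> pHom S M p n \<Longrightarrow> length xs = n \<Longrightarrow> 1 \<le> n \<Longrightarrow> HM.bal n F \<Longrightarrow>
    qev (delta H act M n \<phi> xs) F = qev (\<phi> xs) (delta_form F)"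
  by (rule qev_delta[of \<phi> xs]) (rule pHom_ptensor)

text \<open>Forms determine a coset but do not show the degrees of its representatives. This
  explicit representative serves for membership in \<open>ptensor\<close> and for the degree
  condition.\<close>

lemma delta_class:
  assumes t: "Poly_Mapping.keys t \<subseteq> {x. length (fst x) = n}" and \<phi>: "\<phi> xs = qclass (ptensor_rels S M n) t"
    and xs: "length xs = n" and n: "1 \<le> n"
  shows "delta H act M n \<phi> xs = qclass (ptensor_rels H U n)
    (fbind t (\<lambda>(us, e). \<Sum>g\<in>UNIV. gen (map (\<lambda>u. Poly_Mapping.lookup u g) us, gact g e)))"
proof (rule ptensor_eqI)
  fix F assume F: "HM.bal n F"
  have "\<phi> xs \<in> ptensor S M n" unfolding \<phi> by (rule SM.ptensorI[OF t])
  from qev_delta[of \<phi> xs, OF this xs n F]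
  show "qev (delta H act M n \<phi> xs) F = qev (qclass (ptensor_rels H U n)
    (fbind t (\<lambda>(us, e). \<Sum>g\<in>UNIV. gen (map (\<lambda>u. Poly_Mapping.lookup u g) us, gact g e)))) F"
    unfolding \<phi> qev_ptensor(1)[OF bal_delta_form[OF F n]] qev_ptensor(1)[OF F]
    by (simp add: ev_fbind case_prod_unfold ev_sum delta_form_def)
qed (use xs in \<open>simp_all add: delta_def\<close>)

lemma keys_delta_class:
  assumes "Poly_Mapping.keys t \<subseteq> {x. length (fst x) = n \<and> snd x \<in> C}" "\<And>g x. x \<in> C \<Longrightarrow> gact g x \<in> C"
  shows "Poly_Mapping.keys (fbind t (\<lambda>(us, e). \<Sum>g\<in>UNIV. gen (map (\<lambda>u. Poly_Mapping.lookup u g) us, gact g e)))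
    \<subseteq> {x. length (fst x) = n \<and> snd x \<in> C}"
  using assms
  by (intro order_trans[OF keys_fbind] UN_least, clarify)
    (auto dest!: Poly_Mapping.keys_sum[THEN subsetD] split: if_splits)

lemma delta_pHom:
  assumes \<phi>: "\<phi> \<in> pHom S M p n" and n: "1 \<le> n"
  shows "delta H act M n \<phi> \<in> pHom H U p n"
proof (rule pHomI)
  show "delta H act M n \<phi> \<in> extensional {xs. length xs = n}"
    by (simp add: delta_def)
  show "delta H act M n \<phi> xs \<in> ptensor H U n" if xs: "length xs = n" for xs
  proof -
    obtain t where t: "Poly_Mapping.keys t \<subseteq> {x. length (fst x) = n}"
      "\<phi> xs = qclass (ptensor_rels S M n) t"
      using pHom_ptensor[OF \<phi> xs] by (force simp: ptensor_def)
    show ?thesis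
      unfolding delta_class[of t n \<phi> xs, OF t xs n]
      using keys_delta_class[of t n UNIV] t by (intro HM.ptensorI) auto
  qed
  note qev_delta = qev_delta_pHom[OF \<phi> _ n]
  show "multilinear (mscale U) n (\<lambda>xs. qev (delta H act M n \<phi> xs) F)" if F: "HM.bal n F" for F
  proof (rule multilinearI)
    fix as bs :: "'l list" assume "length as + Suc (length bs) = n"
    then show "linear_form (mscale U) (\<lambda>x. qev (delta H act M n \<phi> (as @ x # bs)) F)"
      using multilinearD[OF pHom_multilinear[OF \<phi> bal_delta_form[OF F n]]] by (simp add: qev_delta F)
  qed
  show "qev (delta H act M n \<phi> (map2 (mact U) hs xs)) F =
      qev (delta H act M n \<phi> xs) (\<lambda>(fs, e). F (H.lmul hs fs, e))"
    if F: "HM.bal n F" and len: "length hs = n" "length xs = n" for F hs xs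
  proof -
    have eq: "map2 (mact U) hs xs = map2 (mact M) (map (Poly_Mapping.single 0) hs) xs"
      by (induction hs xs rule: list_induct2') auto
    have "qev (delta H act M n \<phi> (map2 (mact U) hs xs)) F = qev (\<phi> (map2 (mact U) hs xs)) (delta_form F)"
      using len by (intro qev_delta F) simp_all
    also have "\<dots> = qev (\<phi> xs) (\<lambda>(us, e). delta_form F (smul (map (Poly_Mapping.single 0) hs) us, e))"
      unfolding eq using len by (intro pHom_act[OF \<phi> bal_delta_form[OF F n]]) simp_all
    also have "\<dots> = qev (\<phi> xs) (delta_form (\<lambda>(fs, e). F (H.lmul hs fs, e)))"
      unfolding delta_form_lmul_single by simp
    also have "\<dots> = qev (delta H act M n \<phi> xs) (\<lambda>(fs, e). F (H.lmul hs fs, e))"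
      using len by (intro qev_delta[symmetric] HM.bal_lmul F) simp_all
    finally show ?thesis .
  qed
  show "delta H act M n \<phi> xs \<in> ptensor_comp H U n (p + (\<Sum>i<n. d i))"
    if xs: "length xs = n" and d: "\<And>i. i < n \<Longrightarrow> xs ! i \<in> mcomp U (d i)" for d xs
  proof -
    let ?C = "mcomp M (p + (\<Sum>i<n. d i))"
    have "\<phi> xs \<in> ptensor_comp S M n (p + (\<Sum>i<n. d i))"
      using \<phi> xs d by (simp add: pHom_def)
    then obtain t where t: "Poly_Mapping.keys t \<subseteq> {x. length (fst x) = n \<and> snd x \<in> ?C}"
      "\<phi> xs = qclass (ptensor_rels S M n) t"
      by (force simp: ptensor_comp_def)
    then have t': "Poly_Mapping.keys t \<subseteq> {x. length (fst x) = n}" by blast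
    show ?thesis
      unfolding delta_class[of t n \<phi> xs, OF t' t(2) xs n] ptensor_comp_def underlying_simps
      using keys_delta_class[OF t(1) gact_comp] by (intro imageI) auto
  qed
qed

text \<open>Linearity of \<phi> moves the group elements from the form to the arguments; hence the
  test forms of \<open>smash_separation\<close> see only values of \<delta>.\<close>

lemma qev_lmul_delta_form:
  assumes \<phi>: "\<phi> \<in> pHom S M p n" and n: "1 \<le> n" and F: "HM.bal n F" and len: "length gs = n" "length xs = n"
  shows "qev (\<phi> xs) (lmul_form (map grouplike gs) (delta_form F)) =
    qev (delta H act M n \<phi> (map2 gact gs xs)) F"
proof -
  have "qev (delta H act M n \<phi> (map2 gact gs xs)) F = qev (\<phi> (map2 gact gs xs)) (delta_form F)"
    using len by (intro qev_delta_pHom[OF \<phi>] n F) simp_all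
  also have "\<dots> = qev (\<phi> xs) (lmul_form (map grouplike gs) (delta_form F))"
    unfolding map2_mact_grouplike[symmetric] lmul_form_def
    using len by (intro pHom_act[OF \<phi> bal_delta_form[OF F n]]) simp_all
  finally show ?thesis by simp
qed

lemma bal_group_form:
  assumes F: "HM.bal n F" and n: "1 \<le> n"
  shows "HM.bal n (\<lambda>(fs, e). F (map (act g) fs, gact g e))"
  unfolding balanced_form_def split_conv
proof (intro conjI allI impI)
  show "H.mlin n (\<lambda>hs. F (map (act g) hs, gact g e))" for e
    by (rule multilinear_act[OF balanced_multilinear[OF F]])
  fix hs :: "'h list" assume hs: "length hs = n"
  then show "linear_form (mscale U) (\<lambda>e. F (map (act g) hs, gact g e))"
    using linear_form_gact balanced_linear[OF F, of "map (act g) hs"] by simp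
  fix h e
  have lmul: "map (act g) (H.lmul hs fs) = H.lmul (map (act g) hs) (map (act g) fs)" for fs
    by (induction hs fs rule: list_induct2') (auto simp: act_hmult)
  have "H.icop n h (\<lambda>fs. F (map (act g) (H.lmul hs fs), gact g e)) =
      H.icop n (act g h) (\<lambda>fs. F (H.lmul (map (act g) hs) fs, gact g e))"
    unfolding lmul
    using hs by (intro icop_act[OF n, symmetric] H.mlin_lmul_right balanced_multilinear[OF F]) simp
  also have "\<dots> = F (map (act g) hs, gact g (mact U h e))"
    unfolding gact_mact using hs by (intro balanced_act[OF F]) simp
  finally show "H.icop n h (\<lambda>fs. F (map (act g) (H.lmul hs fs), gact g e)) =
      F (map (act g) hs, gact g (mact U h e))" .
qed

lemma qev_ptensor_group_act:
  "HM.bal n F \<Longrightarrow> qev (ptensor_group_act H act M n g A) F = qev A (\<lambda>(fs, e). F (map (act g) fs, gact g e))"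
  by (simp add: ptensor_group_act_def qev_ptensor case_prod_unfold)

text \<open>Left multiplication of all factors by g sends component b to component g + b, twisted by
  g. Reindexing the sum over components turns this into the group action on the image of
  \<delta>.\<close>

lemma delta_equivariant:
  assumes \<phi>: "\<phi> \<in> pHom S M p n" and n: "1 \<le> n" and xs: "length xs = n"
  shows "delta H act M n \<phi> (map (gact g) xs) = ptensor_group_act H act M n g (delta H act M n \<phi> xs)"
proof (rule ptensor_eqI)
  show "delta H act M n \<phi> (map (gact g) xs) \<in> range (qclass (ptensor_rels H U n))"
    using xs by (simp add: delta_def)
  show "ptensor_group_act H act M n g (delta H act M n \<phi> xs) \<in> range (qclass (ptensor_rels H U n))"
    by (simp add: ptensor_group_act_def)
  fix F assume F: "HM.bal n F"
  have map2: "map (gact g) xs = map2 gact (replicate n g) xs"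
    using xs by (induction xs arbitrary: n) auto
  have form: "delta_form F (smul (map grouplike (replicate n g)) us, e) =
      delta_form (\<lambda>(fs, e). F (map (act g) fs, gact g e)) (us, e)" if "length us = n" for us e
  proof -
    have "map (\<lambda>u. Poly_Mapping.lookup u (g + b)) (smul (map grouplike (replicate n g)) us) =
        map (act g) (map (\<lambda>u. Poly_Mapping.lookup u b) us)" for b
      using that
      by (induction us arbitrary: n) (auto simp: lookup_smash_single_mult mult_one_left add.assoc[symmetric])
    then show ?thesis
      unfolding delta_form_def split_conv
      by (subst sum_UNIV_shift_left[of _ g, symmetric]) (simp add: gact_plus)
  qed
  have "qev (delta H act M n \<phi> (map (gact g) xs)) F =
      qev (\<phi> xs) (lmul_form (map grouplike (replicate n g)) (delta_form F))"
    unfolding map2 using xs by (intro qev_lmul_delta_form[OF \<phi> n F, symmetric]) simp_all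
  also have "\<dots> = qev (\<phi> xs) (delta_form (\<lambda>(fs, e). F (map (act g) fs, gact g e)))"
    unfolding lmul_form_def
    by (rule SM.qev_ptensor_cong[OF pHom_ptensor[OF \<phi> xs]]) (simp add: form[simplified])
  also have "\<dots> = qev (delta H act M n \<phi> xs) (\<lambda>(fs, e). F (map (act g) fs, gact g e))"
    by (rule qev_delta_pHom[OF \<phi> xs n bal_group_form[OF F n], symmetric])
  also have "\<dots> = qev (ptensor_group_act H act M n g (delta H act M n \<phi> xs)) F"
    by (rule qev_ptensor_group_act[OF F, symmetric])
  finally show "qev (delta H act M n \<phi> (map (gact g) xs)) F =
    qev (ptensor_group_act H act M n g (delta H act M n \<phi> xs)) F" .
qed

section \<open>Compatibility of \<delta> with composition and with the Jacobi expression\<close>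

lemma sum_UNIV_reflect:
  "(\<Sum>b\<in>UNIV. f (a - b) b) = (\<Sum>c\<in>UNIV. f c (- c + (a :: 'g)))"
  by (rule sum.reindex_bij_witness[of _ "\<lambda>c. - c + a" "\<lambda>b. a - b"])
    (simp_all add: minus_add diff_conv_add_uminus add.assoc del: add_uminus_conv_diff)

text \<open>On the left, component b of f multiplies component c of hs and lands in component a = c
  + b, where fs is read off. On the right, f is first multiplied by c, so component a of the product
  is component -c + a of f, twisted by c. \<open>sum_UNIV_reflect\<close> matches the indices and
  \<open>icop_act\<close> the twists.\<close>

lemma delta_pcomp_pure:
  assumes F: "HM.bal (l + m) F" and l: "1 \<le> l" and len: "length hs = l" "length fs = m"
  shows "S.icop l f (\<lambda>gs. delta_form F (smul hs gs @ fs, e)) =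
    (\<Sum>c\<in>UNIV. delta_form
      (\<lambda>(fs, e). H.icop l (hd fs) (\<lambda>gs. F (H.lmul (map (\<lambda>u. Poly_Mapping.lookup u c) hs) gs @ tl fs, e)))
      (hmult S (grouplike c) f # fs, e))"
proof -
  let ?l = Poly_Mapping.lookup
  let ?at = "\<lambda>us c. map (\<lambda>u. ?l u c) us"
  let ?T = "\<lambda>a c b. H.icop l (?l f b)
    (\<lambda>gs. F (H.lmul (?at hs c) (map (act c) gs) @ ?at fs a, gact a e))"
  have bal: "SM.bal (l + m) (delta_form F)"
    using l by (intro bal_delta_form[OF F]) simp
  have "S.mlin l (\<lambda>gs. delta_form F (gs @ fs, e))"
    using balanced_multilinear[OF bal] len by (intro multilinear_append1) simp
  then have "S.icop l f (\<lambda>gs. delta_form F (smul hs gs @ fs, e)) = (\<Sum>b\<in>UNIV. H.icop l (?l f b)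
      (\<lambda>xs. delta_form F (smul hs (map (Poly_Mapping.single b) xs) @ fs, e)))"
    using len by (intro smash_icop[OF l] multilinear_smul_right)
  also have "\<dots> = (\<Sum>b\<in>UNIV. \<Sum>a\<in>UNIV. ?T a (a - b) b)"
    unfolding delta_form_def split_conv map_append lookup_smul_single ev_sum_fun ..
  also have "\<dots> = (\<Sum>a\<in>UNIV. \<Sum>b\<in>UNIV. ?T a (a - b) b)"
    by (rule sum.swap)
  also have "\<dots> = (\<Sum>a\<in>UNIV. \<Sum>c\<in>UNIV. ?T a c (- c + a))"
    by (rule sum.cong[OF refl], rule sum_UNIV_reflect[where f = "?T _"])
  also have "\<dots> = (\<Sum>c\<in>UNIV. \<Sum>a\<in>UNIV. ?T a c (- c + a))"
    by (rule sum.swap)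
  also have "\<dots> = (\<Sum>c\<in>UNIV. \<Sum>a\<in>UNIV. H.icop l (?l (hmult S (grouplike c) f) a)
      (\<lambda>gs. F (H.lmul (?at hs c) gs @ ?at fs a, gact a e)))"
  proof (intro sum.cong refl)
    fix c a
    have "H.mlin l (\<lambda>gs. F (gs @ ?at fs a, gact a e))"
      using balanced_multilinear[OF F] len by (intro multilinear_append1) simp
    then have "H.mlin l (\<lambda>gs. F (H.lmul (?at hs c) gs @ ?at fs a, gact a e))"
      using len by (intro H.mlin_lmul_right) simp_all
    from icop_act[OF l this]
    show "?T a c (- c + a) = H.icop l (?l (hmult S (grouplike c) f) a)
      (\<lambda>gs. F (H.lmul (?at hs c) gs @ ?at fs a, gact a e))"
      by (simp add: lookup_smash_single_mult mult_one_left)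
  qed
  finally show ?thesis by (simp add: delta_form_def)
qed

text \<open>Applying \<delta> to \<psi> splits its value into components c, with e replaced by c e.
  Then \<phi> has c e as its first argument, and linearity turns this into a factor c on the first
  factor of its value, which is the situation of \<open>delta_pcomp_pure\<close>.\<close>

lemma delta_pcomp:
  assumes \<phi>: "\<phi> \<in> pHom S M p (Suc m)" and \<psi>: "\<psi> \<in> pHom S M q l" and l: "1 \<le> l"
    and F: "HM.bal (l + m) F" and len: "length ys = l" "length xs = m"
  shows "qev (pcomp S M \<phi> \<psi> ys xs) (delta_form F) =
    qev (pcomp H U (delta H act M (Suc m) \<phi>) (delta H act M l \<psi>) ys xs) F"
proof -
  let ?I = "\<lambda>hs (fs, e'). H.icop l (hd fs) (\<lambda>gs. F (H.lmul hs gs @ tl fs, e'))"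
  let ?at = "\<lambda>us c. map (\<lambda>u. Poly_Mapping.lookup u c) us"
  have bal: "SM.bal (l + m) (delta_form F)"
    using l by (intro bal_delta_form[OF F]) simp
  have \<delta>\<phi>: "delta H act M (Suc m) \<phi> \<in> pHom H U p (Suc m)"
    by (rule delta_pHom[OF \<phi>]) simp
  have \<psi>ys: "\<psi> ys \<in> ptensor S M l" by (rule pHom_ptensor[OF \<psi> len(1)])
  have "qev (pcomp H U (delta H act M (Suc m) \<phi>) (delta H act M l \<psi>) ys xs) F =
      qev (delta H act M l \<psi> ys) (\<lambda>(hs, e). qev (delta H act M (Suc m) \<phi> (e # xs)) (?I hs))"
    using qev_pcomp[of H U ys xs F] F len by simp
  also have "\<dots> = qev (\<psi> ys) (delta_form (\<lambda>(hs, e). qev (delta H act M (Suc m) \<phi> (e # xs)) (?I hs)))"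
    by (rule qev_delta_pHom[OF \<psi> len(1) l HM.bal_pcomp_outer[OF \<delta>\<phi> F l len(2)]])
  also have "\<dots> = qev (\<psi> ys) (\<lambda>(hs, e). qev (\<phi> (e # xs))
      (\<lambda>(fs, e'). S.icop l (hd fs) (\<lambda>gs. delta_form F (smul hs gs @ tl fs, e'))))"
  proof (rule SM.qev_ptensor_cong[OF \<psi>ys], unfold split_conv)
    fix hs :: "('g \<Rightarrow>\<^sub>0 'h) list" and e assume hs: "length hs = l"
    have \<phi>e: "\<phi> (e # xs) \<in> ptensor S M (Suc m)" using pHom_ptensor[OF \<phi>] len by simp
    have summand: "qev (delta H act M (Suc m) \<phi> (gact c e # xs)) (?I (?at hs c)) = qev (\<phi> (e # xs))
        (\<lambda>(fs, e'). delta_form (?I (?at hs c)) (hmult S (grouplike c) (hd fs) # tl fs, e'))" for c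
    proof -
      have bal: "HM.bal (Suc m) (?I (?at hs c))"
        using hs by (intro HM.bal_pcomp_inner[OF F l]) simp
      have ones: "map2 gact (replicate (length zs) 0) zs = zs" for zs
        by (induction zs) (auto simp: gact_zero)
      \<comment> \<open>Only the first argument is translated, so the tuple is c followed by neutral
        elements.\<close>
      have "gact c e # xs = map2 gact (c # replicate m 0) (e # xs)"
        using ones[of xs] len by simp
      then have "qev (delta H act M (Suc m) \<phi> (gact c e # xs)) (?I (?at hs c)) =
          qev (\<phi> (e # xs)) (lmul_form (map grouplike (c # replicate m 0)) (delta_form (?I (?at hs c))))"
        using qev_lmul_delta_form[OF \<phi> _ bal, of "c # replicate m 0" "e # xs"] len by (simp only:) simp
      also have "\<dots> = qev (\<phi> (e # xs))
          (\<lambda>(fs, e'). delta_form (?I (?at hs c)) (hmult S (grouplike c) (hd fs) # tl fs, e'))"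
      proof (rule SM.qev_ptensor_cong[OF \<phi>e])
        fix fs :: "('g \<Rightarrow>\<^sub>0 'h) list" and e' assume "length fs = Suc m"
        then obtain f fs' where fs: "fs = f # fs'" "length fs' = m" by (cases fs) auto
        then show "lmul_form (map grouplike (c # replicate m 0)) (delta_form (?I (?at hs c))) (fs, e') =
          (case (fs, e') of (fs, e') \<Rightarrow> delta_form (?I (?at hs c)) (hmult S (grouplike c) (hd fs) # tl fs, e'))"
          using S.lmul_ones[OF fs(2)] by (simp add: lmul_form_def hone_smash)
      qed
      finally show ?thesis .
    qed
    have "delta_form (\<lambda>(hs, e). qev (delta H act M (Suc m) \<phi> (e # xs)) (?I hs)) (hs, e) =
        qev (\<phi> (e # xs)) (\<lambda>x. \<Sum>c\<in>UNIV.
          (\<lambda>(fs, e'). delta_form (?I (?at hs c)) (hmult S (grouplike c) (hd fs) # tl fs, e')) x)"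
      unfolding qev_def ev_sum_fun unfolding qev_def[symmetric] summand[symmetric]
      by (simp add: delta_form_def)
    also have "\<dots> = qev (\<phi> (e # xs))
        (\<lambda>(fs, e'). S.icop l (hd fs) (\<lambda>gs. delta_form F (smul hs gs @ tl fs, e')))"
    proof (rule SM.qev_ptensor_cong[OF \<phi>e], unfold split_conv)
      fix fs :: "('g \<Rightarrow>\<^sub>0 'h) list" and e' assume "length fs = Suc m"
      then show "(\<Sum>c\<in>UNIV. delta_form (?I (?at hs c)) (hmult S (grouplike c) (hd fs) # tl fs, e')) =
          S.icop l (hd fs) (\<lambda>gs. delta_form F (smul hs gs @ tl fs, e'))"
        by (intro delta_pcomp_pure[OF F l hs, symmetric]) simp
    qed
    finally show "delta_form (\<lambda>(hs, e). qev (delta H act M (Suc m) \<phi> (e # xs)) (?I hs)) (hs, e) =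
      qev (\<phi> (e # xs)) (\<lambda>(fs, e'). S.icop l (hd fs) (\<lambda>gs. delta_form F (smul hs gs @ tl fs, e')))" .
  qed
  also have "\<dots> = qev (pcomp S M \<phi> \<psi> ys xs) (delta_form F)"
    using qev_pcomp[of S M ys xs "delta_form F" \<phi> \<psi>] bal len by simp
  finally show ?thesis by simp
qed

text \<open>Holds summand by summand, since \<delta> is compatible with composition and with
  permutations, while the signs depend only on \<sigma>, the degrees and the arities.\<close>

lemma delta_jacobiator:
  assumes \<beta>: "\<And>k. 1 \<le> k \<Longrightarrow> \<beta> k \<in> pHom S M (p k) k" and \<beta>': "\<And>k. 1 \<le> k \<Longrightarrow> \<beta>' k = delta H act M k (\<beta> k)"
    and N: "1 \<le> N" and F: "HM.bal N F" and xs: "length xs = N"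
  shows "qev (jacobiator S M \<beta> N d xs) (delta_form F) = qev (jacobiator H U \<beta>' N d xs) F"
  unfolding qev_jacobiator[OF F] qev_jacobiator[OF bal_delta_form[OF F N]]
proof (rule sum.cong[OF refl], goal_cases)
  case (1 x)
  obtain k l \<sigma> where x: "x = ((k, l), \<sigma>)" by (metis surj_pair)
  note idx = HM.jacobiator_indices[OF 1[unfolded x]]
  have k: "1 \<le> k" using idx(3) by simp
  let ?xs = "permute_list \<sigma> xs"
  have \<sigma>': "inv \<sigma> permutes {..<N}" by (rule permutes_inv[OF idx(4)])
  have len: "length (take l ?xs) = l" "length (drop l ?xs) = k - 1"
    using idx(2) xs by (auto simp: min_def)
  have \<phi>: "\<beta> k \<in> pHom S M (p k) (Suc (k - 1))" and \<psi>: "\<beta> l \<in> pHom S M (p l) l"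
    using \<beta>[of k] \<beta>[of l] idx by auto
  have PF: "HM.bal (l + (k - 1)) (\<lambda>(fs, e). F (permute_list (inv \<sigma>) fs, e))"
    using HM.bal_permute[OF F \<sigma>'] idx(2) by simp
  have mem: "pcomp S M (\<beta> k) (\<beta> l) (take l ?xs) (drop l ?xs) \<in> ptensor S M N"
    using SM.pcomp_ptensor[of "\<beta> k" "p k" "drop l ?xs" "\<beta> l" "p l" "take l ?xs"] \<phi> \<psi> idx(2)
    unfolding len by simp
  have "qev (pcomp S M (\<beta> k) (\<beta> l) (take l ?xs) (drop l ?xs))
        (\<lambda>(us, e). delta_form F (permute_list (inv \<sigma>) us, e)) =
      qev (pcomp S M (\<beta> k) (\<beta> l) (take l ?xs) (drop l ?xs))
        (delta_form (\<lambda>(fs, e). F (permute_list (inv \<sigma>) fs, e)))"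
    by (rule SM.qev_ptensor_cong[OF mem]) (simp add: delta_form_permute[OF \<sigma>'])
  also have "\<dots> = qev (pcomp H U (\<beta>' k) (\<beta>' l) (take l ?xs) (drop l ?xs))
        (\<lambda>(fs, e). F (permute_list (inv \<sigma>) fs, e))"
    using delta_pcomp[OF \<phi> \<psi> idx(1) PF len] idx(3) \<beta>'[OF k] \<beta>'[OF idx(1)] by simp
  finally show ?case by (simp add: x)
qed

text \<open>Needed because skew-symmetry permutes arguments that have been translated individually:
  the tuple of translations has to be permuted along with them.\<close>

lemma lmul_delta_form_permute:
  assumes \<sigma>: "\<sigma> permutes {..<n}" and len: "length gs = n" "length us = n"
  shows "lmul_form (map grouplike gs) (delta_form F) (permute_list (inv \<sigma>) us, e) =
    lmul_form (map grouplike (permute_list \<sigma> gs))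
      (delta_form (\<lambda>(fs, e). F (permute_list (inv \<sigma>) fs, e))) (us, e)"
proof -
  have \<sigma>': "inv \<sigma> permutes {..<n}" by (rule permutes_inv[OF \<sigma>])
  have "permute_list (inv \<sigma>) (permute_list \<sigma> gs) = gs"
    using permute_list_compose[of "inv \<sigma>" gs \<sigma>] \<sigma>' len permutes_inv_o[OF \<sigma>] by simp
  then have "permute_list (inv \<sigma>) (map grouplike (permute_list \<sigma> gs)) = map grouplike gs"
    using \<sigma>' len by (simp add: permute_list_map)
  then have "smul (map grouplike gs) (permute_list (inv \<sigma>) us) =
      permute_list (inv \<sigma>) (smul (map grouplike (permute_list \<sigma> gs)) us)"
    using SM.permute_lmul[OF \<sigma>', of "map grouplike (permute_list \<sigma> gs)" us] len by simp
  then show ?thesis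
    using delta_form_permute[OF \<sigma>', of "smul (map grouplike (permute_list \<sigma> gs)) us" F e] len
    by (simp add: lmul_form_def)
qed

end


section \<open>The inverse of \<open>\<delta>\<close>\<close>

text \<open>Serves for tuples of components: as soon as one entry has no component at the given
  group element, the whole term vanishes.\<close>

lemma (in cocomm_bialgebra) mlin_zero_entry:
  assumes "mlin n F" "length xs = n" "0 \<in> set xs"
  shows "F xs = 0"
proof -
  obtain as bs where xs: "xs = as @ 0 # bs" using split_list[OF assms(3)] by blast
  have "linear_form (hscale K) (\<lambda>x. F (as @ x # bs))"
    using assms xs by (intro multilinearD) auto
  from linear_form_zero[OF this] show ?thesis by (simp add: xs)
qed

context smash_module
begin

text \<open>The restriction to lists of length n is what \<open>pHom\<close> requires. The formula
  makes sense for every \<phi>; linearity over the smash product is shown for equivariant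
  \<phi>.\<close>

definition induce :: "nat \<Rightarrow> ('l list \<Rightarrow> ('h list \<times> 'l \<Rightarrow>\<^sub>0 'k) set)
    \<Rightarrow> ('l list \<Rightarrow> (('g \<Rightarrow>\<^sub>0 'h) list \<times> 'l \<Rightarrow>\<^sub>0 'k) set)" where
  "induce n \<phi> = (\<lambda>xs\<in>{xs. length xs = n}. qclass (ptensor_rels S M n)
     (\<Sum>gs\<in>cosets n. fbind (rep (\<phi> (map2 (\<lambda>g. gact (- g)) gs xs)))
       (\<lambda>(fs, e). gen (smul (map grouplike gs) (map (Poly_Mapping.single 0) fs), e))))"

lemma qev_induce:
  assumes F: "SM.bal n F" and xs: "length xs = n"
  shows "qev (induce n \<phi> xs) F = (\<Sum>gs\<in>cosets n. qev (\<phi> (map2 (\<lambda>g. gact (- g)) gs xs))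
    (incl_form (lmul_form (map grouplike gs) F)))"
  using xs
  by (simp add: induce_def qev_ptensor(1)[OF F] ev_sum ev_fbind case_prod_unfold
      incl_form_def lmul_form_def) (simp add: qev_def)

lemma induce_ptensor:
  assumes \<phi>: "\<phi> \<in> pHom H U p n" and xs: "length xs = n"
  shows "induce n \<phi> xs \<in> ptensor S M n"
proof -
  have "length fs = n" if "gs \<in> cosets n" "(fs, e) \<in> Poly_Mapping.keys (rep (\<phi> (map2 (\<lambda>g. gact (- g)) gs xs)))"
    for gs fs e
    using HM.ptensor_keys[OF pHom_ptensor[OF \<phi>] that(2)] that(1) xs by (simp add: cosets_def)
  then show ?thesis
    using xs unfolding induce_def
    by (simp, intro SM.ptensorI order_trans[OF Poly_Mapping.keys_sum] UN_least order_trans[OF keys_fbind])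
      (auto simp: cosets_def)
qed

text \<open>Moving the group elements to the right past f twists f, and the tuples bs and gs add up
  entrywise; \<delta> then keeps only the constant sums.\<close>

lemma smul_grouplike_incl:
  "smul (map grouplike bs) (smul (map grouplike gs) (map (Poly_Mapping.single 0) fs)) =
    map2 (\<lambda>c f. Poly_Mapping.single c (act c f)) (map2 (+) bs gs) fs"
proof (induction bs arbitrary: gs fs)
  case (Cons b bs)
  then show ?case
    by (cases gs; cases fs)
      (simp_all add: smash_single_mult_single act_one_hmult mult_one_left act_plus act_hmult act_hone)
qed simp

text \<open>Only the coset of \<^term>\<open>map uminus bs\<close> survives.\<close>

lemma qev_induce_delta_form:
  assumes \<phi>: "\<phi> \<in> pHom H U p n" and n: "1 \<le> n" and F: "HM.bal n F"
    and eqv: "\<And>xs g. length xs = n \<Longrightarrow> \<phi> (map (gact g) xs) = ptensor_group_act H act M n g (\<phi> xs)"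
    and len: "length bs = n" "length xs = n"
  shows "qev (induce n \<phi> xs) (lmul_form (map grouplike bs) (delta_form F)) = qev (\<phi> (map2 gact bs xs)) F"
proof -
  \<comment> \<open>\<delta> retains only tuples for which all b + g equal one element a. As the
    head of gs is 0, a must be the head of bs, and then g = - b + a, so exactly one term
    survives.\<close>
  define a0 where "a0 = hd bs"
  define gs0 where "gs0 = map (\<lambda>b. - b + a0) bs"
  have gs0: "gs0 \<in> cosets n" using len n by (cases bs) (auto simp: cosets_def gs0_def a0_def)
  have eq: "map2 (+) bs gs = replicate n a \<longleftrightarrow> gs = gs0 \<and> a = a0" if gs: "gs \<in> cosets n" for gs a
  proof
    have gs': "length gs = n" "hd gs = 0" using gs by (auto simp: cosets_def)
    assume *: "map2 (+) bs gs = replicate n a"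
    obtain b bs' g gs' where cons: "bs = b # bs'" "gs = g # gs'"
      using len gs' n by (cases bs; cases gs) auto
    have a: "a = a0" using arg_cong[OF *, of hd] gs' n unfolding cons a0_def by (cases n) simp_all
    have "gs = map (\<lambda>b. - b + a) bs"
    proof (rule nth_equalityI)
      fix i assume i: "i < length gs"
      then have "bs ! i + gs ! i = a" using arg_cong[OF *, of "\<lambda>xs. xs ! i"] len gs' by simp
      then show "gs ! i = map (\<lambda>b. - b + a) bs ! i"
        using i len gs' by (simp add: add.assoc[symmetric]) (metis add.assoc add.left_inverse add_0)
    qed (use len gs' in simp)
    then show "gs = gs0 \<and> a = a0" using a by (simp add: gs0_def)
  next
    assume "gs = gs0 \<and> a = a0"
    then show "map2 (+) bs gs = replicate n a"
      using len by (auto simp: gs0_def add.assoc[symmetric] intro!: nth_equalityI)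
  qed
  have val: "incl_form (lmul_form (map grouplike gs) (lmul_form (map grouplike bs) (delta_form F))) (fs, e) =
      (if gs = gs0 then F (map (act a0) fs, gact a0 e) else 0)"
    if gs: "gs \<in> cosets n" and fs: "length fs = n" for gs fs e
  proof -
    let ?cs = "map2 (+) bs gs"
    have lcs: "length ?cs = n" using gs len by (simp add: cosets_def)
    have "F (map (\<lambda>u. Poly_Mapping.lookup u a) (map2 (\<lambda>c f. Poly_Mapping.single c (act c f)) ?cs fs), gact a e) =
        (if ?cs = replicate n a then F (map (act a) fs, gact a e) else 0)" for a
    proof (cases "?cs = replicate n a")
      case True
      have "map (\<lambda>u. Poly_Mapping.lookup u a) (map2 (\<lambda>c f. Poly_Mapping.single c (act c f)) (replicate n a) fs) =
          map (act a) fs"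
        using fs by (intro nth_equalityI) simp_all
      then show ?thesis using True by simp
    next
      case False
      have "\<exists>i<n. cs ! i \<noteq> a" if "length cs = n" "cs \<noteq> replicate n a" for cs :: "'g list"
        using that by (auto simp: list_eq_iff_nth_eq)
      from this[OF lcs False] obtain i where i: "i < n" "?cs ! i \<noteq> a" by blast
      let ?v = "map (\<lambda>u. Poly_Mapping.lookup u a) (map2 (\<lambda>c f. Poly_Mapping.single c (act c f)) ?cs fs)"
      have v: "?v ! i = 0" using i lcs fs by (simp add: lookup_single when_def)
      have "?v ! i \<in> set ?v" using i lcs fs by (intro nth_mem) simp
      then have "0 \<in> set ?v" unfolding v .
      then have "F (?v, gact a e) = 0"
        using lcs fs by (intro H.mlin_zero_entry[OF balanced_multilinear[OF F]]) simp_all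
      then show ?thesis using False by simp
    qed
    then have "incl_form (lmul_form (map grouplike gs) (lmul_form (map grouplike bs) (delta_form F))) (fs, e) =
        (\<Sum>a\<in>UNIV. if gs = gs0 \<and> a = a0 then F (map (act a) fs, gact a e) else 0)"
      unfolding incl_form_def lmul_form_def delta_form_def split_conv smul_grouplike_incl eq[OF gs]
      by simp
    also have "\<dots> = (if gs = gs0 then F (map (act a0) fs, gact a0 e) else 0)"
      by (cases "gs = gs0") simp_all
    finally show ?thesis .
  qed
  let ?x = "\<lambda>gs. map2 (\<lambda>g. gact (- g)) gs xs"
  have "qev (induce n \<phi> xs) (lmul_form (map grouplike bs) (delta_form F)) =
      (\<Sum>gs\<in>cosets n. qev (\<phi> (?x gs))
        (incl_form (lmul_form (map grouplike gs) (lmul_form (map grouplike bs) (delta_form F)))))"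
    using len by (intro qev_induce bal_lmul_form bal_delta_form[OF F n]) simp_all
  also have "\<dots> = (\<Sum>gs\<in>cosets n. if gs = gs0 then qev (\<phi> (?x gs0)) (\<lambda>(fs, e). F (map (act a0) fs, gact a0 e)) else 0)"
  proof (rule sum.cong[OF refl])
    fix gs assume gs: "gs \<in> cosets n"
    then have mem: "\<phi> (?x gs) \<in> ptensor H U n"
      using len by (intro pHom_ptensor[OF \<phi>]) (simp add: cosets_def)
    have "qev (\<phi> (?x gs))
        (incl_form (lmul_form (map grouplike gs) (lmul_form (map grouplike bs) (delta_form F)))) =
      qev (\<phi> (?x gs)) (\<lambda>(fs, e). if gs = gs0 then F (map (act a0) fs, gact a0 e) else 0)"
      by (rule HM.qev_ptensor_cong[OF mem]) (simp add: val[OF gs])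
    then show "qev (\<phi> (?x gs))
        (incl_form (lmul_form (map grouplike gs) (lmul_form (map grouplike bs) (delta_form F)))) =
      (if gs = gs0 then qev (\<phi> (?x gs0)) (\<lambda>(fs, e). F (map (act a0) fs, gact a0 e)) else 0)"
      by (cases "gs = gs0") (simp_all add: qev_def ev_def lin_ext_def)
  qed
  also have "\<dots> = qev (\<phi> (?x gs0)) (\<lambda>(fs, e). F (map (act a0) fs, gact a0 e))"
    using gs0 by simp
  \<comment> \<open>Equivariance moves the translation by a0 from the form to the arguments, where
    it cancels the a0 contained in gs0 and leaves the translation by bs.\<close>
  also have "\<dots> = qev (\<phi> (map (gact a0) (?x gs0))) F"
    using eqv[of "?x gs0" a0] qev_ptensor_group_act[OF F] gs0 len by (simp add: cosets_def)
  also have "map (gact a0) (?x gs0) = map2 gact bs xs"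
    unfolding gs0_def
    by (intro nth_equalityI) (auto simp: gact_plus[symmetric] minus_add add.assoc[symmetric])
  finally show ?thesis .
qed

lemma gact_mact_single:
  "gact b (mact M (Poly_Mapping.single g f) x) = mact U (act b f) (gact (b + g) x)"
  unfolding mact_single gact_mact gact_plus ..

text \<open>Against the forms of \<open>smash_separation\<close> both sides are multilinear in us
  (\<Phi> and \<Psi>), so us may be taken with entries \<open>f g\<close> concentrated in single
  components. There \<open>qev_induce_delta_form\<close> applies with b + g in place of b, and f,
  twisted by b, is absorbed by the \<open>H\<close>-linearity of \<phi>.\<close>

lemma induce_act:
  assumes \<phi>: "\<phi> \<in> pHom H U p n" and n: "1 \<le> n"
    and eqv: "\<And>xs g. length xs = n \<Longrightarrow> \<phi> (map (gact g) xs) = ptensor_group_act H act M n g (\<phi> xs)"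
    and len: "length us = n" "length xs = n"
  shows "induce n \<phi> (map2 (mact M) us xs) = ptensor_lmult S M n us (induce n \<phi> xs)"
proof (rule smash_separation[OF _ _ n])
  show "induce n \<phi> (map2 (mact M) us xs) \<in> ptensor S M n"
    using len by (intro induce_ptensor[OF \<phi>]) simp
  show "ptensor_lmult S M n us (induce n \<phi> xs) \<in> ptensor S M n"
    using len by (intro SM.lmult_ptensor induce_ptensor[OF \<phi>])
  fix F and bs :: "'g list" assume F: "HM.bal n F" and bs: "length bs = n"
  let ?s = Poly_Mapping.single
  let ?D = "lmul_form (map grouplike bs) (delta_form F)"
  note star = qev_induce_delta_form[OF \<phi> n _ eqv]
  have D: "SM.bal n ?D" using bs by (intro bal_lmul_form bal_delta_form[OF F n]) simp
  define \<Phi> where "\<Phi> us = qev (\<phi> (map2 gact bs (map2 (mact M) us xs))) F" for us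
  define \<Psi> where "\<Psi> us = qev (induce n \<phi> xs) (\<lambda>(vs, e). ?D (smul us vs, e))" for us
  have "multilinear (mscale M) n (\<lambda>ys. qev (\<phi> (map2 gact bs ys)) F)"
    using multilinear_map2[OF pHom_multilinear[OF \<phi> F] bs, of gact "mscale M"]
    by (simp add: gact_add gact_scale)
  then have \<Phi>: "S.mlin n \<Phi>"
    unfolding \<Phi>_def by (rule multilinear_map2_left[OF _ len(2)]) (simp_all add: M.act_add_left M.act_scale_left)
  have \<Psi>: "S.mlin n \<Psi>"
    unfolding \<Psi>_def qev_def
  proof (rule multilinear_ev, clarify)
    fix vs e assume "(vs, e) \<in> Poly_Mapping.keys (rep (induce n \<phi> xs))"
    then have "length vs = n" using SM.ptensor_keys[OF induce_ptensor[OF \<phi> len(2)]] by fastforce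
    then show "S.mlin n (\<lambda>us. ?D (smul us vs, e))"
      by (intro multilinear_smul_left balanced_multilinear[OF D])
  qed
  have pure: "\<Phi> (map2 ?s gs fs) = \<Psi> (map2 ?s gs fs)" if gs: "length gs = n" "length fs = n" for gs fs
  proof -
    let ?f = "map2 act bs fs" and ?g = "map2 (+) bs gs"
    have "map2 gact bs (map2 (mact M) (map2 ?s gs fs) xs) = map2 (mact U) ?f (map2 gact ?g xs)"
    proof (rule nth_equalityI)
      fix i assume "i < length (map2 gact bs (map2 (mact M) (map2 ?s gs fs) xs))"
      then show "map2 gact bs (map2 (mact M) (map2 ?s gs fs) xs) ! i = map2 (mact U) ?f (map2 gact ?g xs) ! i"
        using bs len gs by (simp add: gact_mact_single del: underlying_simps)
    qed (use bs len gs in simp)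
    then have "\<Phi> (map2 ?s gs fs) = qev (\<phi> (map2 gact ?g xs)) (\<lambda>(hs, e). F (H.lmul ?f hs, e))"
      unfolding \<Phi>_def using bs gs len by (simp only:) (intro pHom_act[OF \<phi> F], simp_all)
    also have "\<dots> = qev (induce n \<phi> xs) (lmul_form (map grouplike ?g) (delta_form (\<lambda>(hs, e). F (H.lmul ?f hs, e))))"
      using bs gs len by (intro star[symmetric] HM.bal_lmul F) simp_all
    also have "\<dots> = \<Psi> (map2 ?s gs fs)"
      unfolding \<Psi>_def
    proof (rule SM.qev_ptensor_cong[OF induce_ptensor[OF \<phi> len(2)]])
      fix vs :: "('g \<Rightarrow>\<^sub>0 'h) list" and e assume vs: "length vs = n"
      have "smul (map grouplike bs) (map2 ?s gs fs) = smul (map (?s 0) ?f) (map grouplike ?g)"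
        using bs gs by (intro nth_equalityI) (simp_all add: smash_single_mult_single act_one_hmult act_hone mult_one_left mult_one_right)
      then have "smul (map grouplike bs) (smul (map2 ?s gs fs) vs) = smul (map (?s 0) ?f) (smul (map grouplike ?g) vs)"
        unfolding S.lmul_assoc[symmetric] by simp
      then show "lmul_form (map grouplike ?g) (delta_form (\<lambda>(hs, e). F (H.lmul ?f hs, e))) (vs, e) =
        (case (vs, e) of (vs, e) \<Rightarrow> ?D (smul (map2 ?s gs fs) vs, e))"
        unfolding lmul_form_def split_conv by (simp only: delta_form_lmul_single)
    qed
    finally show ?thesis .
  qed
  have "\<Phi> us = \<Psi> us"
    unfolding multilinear_expand[OF \<Phi> len(1)] multilinear_expand[OF \<Psi> len(1)]
  proof (rule sum.cong[OF refl])
    fix gs :: "'g list" assume "gs \<in> {gs. length gs = n}"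
    moreover have "map2 (\<lambda>g u. ?s g (Poly_Mapping.lookup u g)) gs us =
        map2 ?s gs (map2 (\<lambda>g u. Poly_Mapping.lookup u g) gs us)"
      by (induction gs us rule: list_induct2') auto
    ultimately show "\<Phi> (map2 (\<lambda>g u. ?s g (Poly_Mapping.lookup u g)) gs us) =
        \<Psi> (map2 (\<lambda>g u. ?s g (Poly_Mapping.lookup u g)) gs us)"
      using len by (simp add: pure)
  qed
  moreover have "qev (induce n \<phi> (map2 (mact M) us xs)) ?D = \<Phi> us"
    unfolding \<Phi>_def using bs len by (intro star F) simp_all
  moreover have "qev (ptensor_lmult S M n us (induce n \<phi> xs)) ?D = \<Psi> us"
    unfolding \<Psi>_def by (rule qev_lmult[OF D])
  ultimately show "qev (induce n \<phi> (map2 (mact M) us xs)) ?D = qev (ptensor_lmult S M n us (induce n \<phi> xs)) ?D"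
    by simp
qed

lemma induce_pHom:
  assumes \<phi>: "\<phi> \<in> pHom H U p n" and n: "1 \<le> n"
    and eqv: "\<And>xs g. length xs = n \<Longrightarrow> \<phi> (map (gact g) xs) = ptensor_group_act H act M n g (\<phi> xs)"
  shows "induce n \<phi> \<in> pHom S M p n"
proof (rule pHomI)
  show "induce n \<phi> \<in> extensional {xs. length xs = n}" by (simp add: induce_def)
  show "induce n \<phi> xs \<in> ptensor S M n" if "length xs = n" for xs
    by (rule induce_ptensor[OF \<phi> that])
  show "multilinear (mscale M) n (\<lambda>xs. qev (induce n \<phi> xs) F)" if F: "SM.bal n F" for F
  proof -
    have "multilinear (mscale M) n (\<lambda>xs. \<Sum>gs\<in>cosets n. qev (\<phi> (map2 (\<lambda>g. gact (- g)) gs xs))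
        (incl_form (lmul_form (map grouplike gs) F)))"
    proof (rule multilinear_sum_fun)
      fix gs assume gs: "gs \<in> cosets n"
      then have "HM.bal n (incl_form (lmul_form (map grouplike gs) F))"
        by (intro bal_incl_form bal_lmul_form F n) (simp add: cosets_def)
      from pHom_multilinear[OF \<phi> this]
      have ml: "multilinear (mscale M) n (\<lambda>xs. qev (\<phi> xs) (incl_form (lmul_form (map grouplike gs) F)))"
        by simp
      show "multilinear (mscale M) n (\<lambda>xs. qev (\<phi> (map2 (\<lambda>g. gact (- g)) gs xs))
          (incl_form (lmul_form (map grouplike gs) F)))"
        using gs by (intro multilinear_map2[OF ml]) (simp_all add: cosets_def gact_add gact_scale)
    qed
    then show ?thesis
      by (auto simp: multilinear_def linear_form_def qev_induce[OF F])
  qed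
  show "qev (induce n \<phi> (map2 (mact M) hs xs)) F = qev (induce n \<phi> xs) (\<lambda>(fs, e). F (smul hs fs, e))"
    if "SM.bal n F" "length hs = n" "length xs = n" for F hs xs
    using that by (simp add: induce_act[OF \<phi> n eqv] qev_lmult)
  show "induce n \<phi> xs \<in> ptensor_comp S M n (p + (\<Sum>i<n. d i))"
    if xs: "length xs = n" and d: "\<And>i. i < n \<Longrightarrow> xs ! i \<in> mcomp M (d i)" for d xs
  proof -
    let ?C = "mcomp M (p + (\<Sum>i<n. d i))"
    let ?x = "\<lambda>gs. map2 (\<lambda>g. gact (- g)) gs xs"
    \<comment> \<open>A homogeneous coset has a homogeneous representative, but \<open>rep\<close>
      is not known to be one; representatives are chosen anew and the value of \<open>induce\<close>
      is recomputed from them.\<close>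
    have "\<exists>t. Poly_Mapping.keys t \<subseteq> {x. length (fst x) = n \<and> snd x \<in> ?C} \<and>
        \<phi> (?x gs) = qclass (ptensor_rels H U n) t" if gs: "gs \<in> cosets n" for gs
    proof -
      have "\<forall>i<n. ?x gs ! i \<in> mcomp U (d i)"
        using gs xs d by (auto simp: cosets_def gact_comp)
      then have "\<phi> (?x gs) \<in> ptensor_comp H U n (p + (\<Sum>i<n. d i))"
        using \<phi> gs xs by (simp add: pHom_def cosets_def)
      then show ?thesis by (force simp: ptensor_comp_def)
    qed
    then have "\<forall>gs\<in>cosets n. \<exists>t. Poly_Mapping.keys t \<subseteq> {x. length (fst x) = n \<and> snd x \<in> ?C} \<and>
        \<phi> (?x gs) = qclass (ptensor_rels H U n) t" by blast
    from bchoice[OF this] obtain t where "\<forall>gs\<in>cosets n.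
        Poly_Mapping.keys (t gs) \<subseteq> {x. length (fst x) = n \<and> snd x \<in> ?C} \<and>
        \<phi> (?x gs) = qclass (ptensor_rels H U n) (t gs)" ..
    then have t: "Poly_Mapping.keys (t gs) \<subseteq> {x. length (fst x) = n \<and> snd x \<in> ?C}"
      "\<phi> (?x gs) = qclass (ptensor_rels H U n) (t gs)" if "gs \<in> cosets n" for gs
      using that by blast+
    let ?t = "\<Sum>gs\<in>cosets n. fbind (t gs)
      (\<lambda>(fs, e). gen (smul (map grouplike gs) (map (Poly_Mapping.single 0) fs), e))"
    have "induce n \<phi> xs = qclass (ptensor_rels S M n) ?t"
    proof (rule ptensor_eqI)
      show "induce n \<phi> xs \<in> range (qclass (ptensor_rels S M n))"
        by (rule ptensor_range[OF induce_ptensor[OF \<phi> xs]])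
      fix F assume F: "SM.bal n F"
      have "qev (\<phi> (?x gs)) (incl_form (lmul_form (map grouplike gs) F)) =
          ev (t gs) (incl_form (lmul_form (map grouplike gs) F))" if gs: "gs \<in> cosets n" for gs
        using gs unfolding t(2)[OF gs]
        by (intro qev_ptensor bal_incl_form bal_lmul_form F n) (simp add: cosets_def)
      then show "qev (induce n \<phi> xs) F = qev (qclass (ptensor_rels S M n) ?t) F"
        by (simp add: qev_induce[OF F xs] qev_ptensor(1)[OF F] ev_sum ev_fbind case_prod_unfold
            incl_form_def lmul_form_def)
    qed simp
    moreover have "Poly_Mapping.keys ?t \<subseteq> {x. length (fst x) = n \<and> snd x \<in> ?C}"
      using t(1)
      by (intro order_trans[OF Poly_Mapping.keys_sum] UN_least order_trans[OF keys_fbind])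
        (force simp: cosets_def)
    ultimately show ?thesis unfolding ptensor_comp_def by (auto intro!: imageI)
  qed
qed

lemma delta_induce:
  assumes \<phi>: "\<phi> \<in> pHom H U p n" and n: "1 \<le> n"
    and eqv: "\<And>xs g. length xs = n \<Longrightarrow> \<phi> (map (gact g) xs) = ptensor_group_act H act M n g (\<phi> xs)"
  shows "delta H act M n (induce n \<phi>) = \<phi>"
proof
  fix xs
  note ind = induce_pHom[OF \<phi> n eqv]
  show "delta H act M n (induce n \<phi>) xs = \<phi> xs"
  proof (cases "length xs = n")
    case False
    then show ?thesis using \<phi> by (auto simp: delta_def pHom_def PiE_def extensional_def)
  next
    case xs: True
    show ?thesis
    proof (rule ptensor_eqI)
      show "delta H act M n (induce n \<phi>) xs \<in> range (qclass (ptensor_rels H U n))"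
        using xs by (simp add: delta_def)
      show "\<phi> xs \<in> range (qclass (ptensor_rels H U n))"
        by (rule ptensor_range[OF pHom_ptensor[OF \<phi> xs]])
      fix F assume F: "HM.bal n F"
      have zero: "map2 gact (replicate (length ys) 0) ys = ys" for ys
        by (induction ys) (simp_all add: gact_zero)
      \<comment> \<open>The neutral tuple turns both pairing formulas into statements about the
        arguments xs themselves.\<close>
      have "qev (delta H act M n (induce n \<phi>) (map2 gact (replicate n 0) xs)) F =
          qev (\<phi> (map2 gact (replicate n 0) xs)) F"
        using xs qev_lmul_delta_form[OF ind n F, of "replicate n 0" xs]
          qev_induce_delta_form[OF \<phi> n F eqv, of "replicate n 0" xs] by simp
      then show "qev (delta H act M n (induce n \<phi>) xs) F = qev (\<phi> xs) F"
        using zero[of xs] xs by simp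
    qed
  qed
qed

lemma delta_inj:
  assumes \<phi>: "\<phi> \<in> pHom S M p n" and \<psi>: "\<psi> \<in> pHom S M q n" and n: "1 \<le> n"
    and eq: "delta H act M n \<phi> = delta H act M n \<psi>"
  shows "\<phi> = \<psi>"
proof
  fix xs
  show "\<phi> xs = \<psi> xs"
  proof (cases "length xs = n")
    case False
    then show ?thesis using \<phi> \<psi> by (auto simp: pHom_def PiE_def extensional_def)
  next
    case True
    then show ?thesis
      using qev_lmul_delta_form[OF \<phi> n] qev_lmul_delta_form[OF \<psi> n] eq
      by (intro smash_separation[OF pHom_ptensor[OF \<phi>] pHom_ptensor[OF \<psi>] n]) simp_all
  qed
qed


section \<open>Transfer of structures\<close>

text \<open>It suffices here to evaluate the identities over the smash product at forms pulled back
  along \<delta>, with the arguments unchanged.\<close>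

lemma delta_L_infinity:
  assumes \<beta>: "\<beta> \<in> L_infinity_structures S M"
  shows "(\<lambda>k\<in>{1..}. delta H act M k (\<beta> k)) \<in> L_infinity_structures H U"
    and "equivariant H act M (\<lambda>k\<in>{1..}. delta H act M k (\<beta> k))"
proof -
  let ?\<beta> = "\<lambda>k\<in>{1..}. delta H act M k (\<beta> k)"
  note str = \<beta>[unfolded L_infinity_structures_iff]
  have hom: "\<beta> k \<in> pHom S M (int k - 2) k" if "1 \<le> k" for k using str that by (auto simp: PiE_def)
  show "equivariant H act M ?\<beta>"
    unfolding equivariant_def using delta_equivariant[OF hom] by simp
  show "?\<beta> \<in> L_infinity_structures H U"
    unfolding L_infinity_structures_iff
  proof (intro conjI allI impI)
    show "?\<beta> \<in> (\<Pi>\<^sub>E k\<in>{1..}. pHom H U (int k - 2) k)"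
      using delta_pHom[OF hom] by auto
    fix k \<sigma> d and xs :: "'l list"
    assume k: "1 \<le> k" and *: "\<sigma> permutes {..<k} \<and> length xs = k \<and> (\<forall>i<k. xs ! i \<in> mcomp U (d i))"
    then have xs: "length xs = k" and \<sigma>: "\<sigma> permutes {..<k}" and d: "\<forall>i<k. xs ! i \<in> mcomp M (d i)" by auto
    let ?c = "of_int (sign \<sigma>) * koszul_sign k d \<sigma>"
    have \<sigma>': "inv \<sigma> permutes {..<k}" by (rule permutes_inv[OF \<sigma>])
    have "delta H act M k (\<beta> k) xs = qscale (ptensor_rels H U k) ?c
        (ptensor_perm H U k \<sigma> (delta H act M k (\<beta> k) (permute_list \<sigma> xs)))"
    proof (rule ptensor_eqI)
      show "delta H act M k (\<beta> k) xs \<in> range (qclass (ptensor_rels H U k))"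
        using xs by (simp add: delta_def)
      fix F assume F: "HM.bal k F"
      let ?F = "\<lambda>(fs, e). F (permute_list (inv \<sigma>) fs, e)"
      have "qev (delta H act M k (\<beta> k) xs) F = qev (\<beta> k xs) (delta_form F)"
        by (rule qev_delta_pHom[OF hom[OF k] xs k F])
      also have "\<beta> k xs = qscale (ptensor_rels S M k) ?c (ptensor_perm S M k \<sigma> (\<beta> k (permute_list \<sigma> xs)))"
        using str k \<sigma> xs d by blast
      also have "qev \<dots> (delta_form F) =
          ?c * qev (\<beta> k (permute_list \<sigma> xs)) (\<lambda>(us, e). delta_form F (permute_list (inv \<sigma>) us, e))"
        by (simp add: qev_ptensor(3)[OF bal_delta_form[OF F k]] qev_perm[OF bal_delta_form[OF F k]])
      also have "qev (\<beta> k (permute_list \<sigma> xs)) (\<lambda>(us, e). delta_form F (permute_list (inv \<sigma>) us, e)) =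
          qev (\<beta> k (permute_list \<sigma> xs)) (delta_form ?F)"
        using xs by (intro SM.qev_ptensor_cong[OF pHom_ptensor[OF hom[OF k]]])
          (simp_all add: delta_form_permute[OF \<sigma>'])
      also have "\<dots> = qev (delta H act M k (\<beta> k) (permute_list \<sigma> xs)) ?F"
        using xs by (intro qev_delta_pHom[OF hom[OF k] _ k HM.bal_permute[OF F \<sigma>'], symmetric]) simp
      finally show "qev (delta H act M k (\<beta> k) xs) F = qev (qscale (ptensor_rels H U k) ?c
          (ptensor_perm H U k \<sigma> (delta H act M k (\<beta> k) (permute_list \<sigma> xs)))) F"
        by (simp add: qev_ptensor(3)[OF F] qev_perm[OF F])
    qed simp
    then show "?\<beta> k xs = qscale (ptensor_rels H U k) ?c (ptensor_perm H U k \<sigma> (?\<beta> k (permute_list \<sigma> xs)))"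
      using k by simp
  next
    fix N d and xs :: "'l list"
    assume N: "1 \<le> N" and *: "length xs = N \<and> (\<forall>i<N. xs ! i \<in> mcomp U (d i))"
    then have zero: "jacobiator S M \<beta> N d xs = qclass (ptensor_rels S M N) 0"
      using str by simp
    show "jacobiator H U ?\<beta> N d xs = qclass (ptensor_rels H U N) 0"
    proof (rule ptensor_eqI)
      fix F assume F: "HM.bal N F"
      have "qev (jacobiator H U ?\<beta> N d xs) F = qev (jacobiator S M \<beta> N d xs) (delta_form F)"
        using * by (intro delta_jacobiator[OF hom _ N F, symmetric]) simp_all
      then show "qev (jacobiator H U ?\<beta> N d xs) F = qev (qclass (ptensor_rels H U N) 0) F"
        unfolding zero by (simp add: qev_ptensor(1)[OF bal_delta_form[OF F N]] qev_ptensor(1)[OF F])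
    qed (simp_all add: jacobiator_def)
  qed
qed

text \<open>Pulled-back forms alone need not separate points over the smash product, so each
  identity is tested after multiplication by group elements. These move to the arguments, where the
  identity over \<open>H\<close> applies; translation preserves degrees, hence the signs
  agree.\<close>

lemma L_infinity_if_delta:
  assumes \<beta>: "\<beta> \<in> L_infinity_structures H U"
    and ext: "\<gamma> \<in> (\<Pi>\<^sub>E k\<in>{1..}. pHom S M (int k - 2) k)"
    and delta: "\<And>k. 1 \<le> k \<Longrightarrow> delta H act M k (\<gamma> k) = \<beta> k"
  shows "\<gamma> \<in> L_infinity_structures S M"
  unfolding L_infinity_structures_iff
proof (intro conjI allI impI)
  note str = \<beta>[unfolded L_infinity_structures_iff]
  have hom: "\<gamma> k \<in> pHom S M (int k - 2) k" if "1 \<le> k" for k using ext that by (auto simp: PiE_def)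
  show "\<gamma> \<in> (\<Pi>\<^sub>E k\<in>{1..}. pHom S M (int k - 2) k)" by (rule ext)
  fix k \<sigma> d and xs :: "'l list"
  assume k: "1 \<le> k" and *: "\<sigma> permutes {..<k} \<and> length xs = k \<and> (\<forall>i<k. xs ! i \<in> mcomp M (d i))"
  then have xs: "length xs = k" and \<sigma>: "\<sigma> permutes {..<k}" and d: "\<forall>i<k. xs ! i \<in> mcomp M (d i)" by auto
  have \<sigma>': "inv \<sigma> permutes {..<k}" by (rule permutes_inv[OF \<sigma>])
  let ?c = "of_int (sign \<sigma>) * koszul_sign k d \<sigma>" and ?xs = "permute_list \<sigma> xs"
  have mem: "\<gamma> k ?xs \<in> ptensor S M k" using xs by (intro pHom_ptensor[OF hom[OF k]]) simp
  show "\<gamma> k xs = qscale (ptensor_rels S M k) ?c (ptensor_perm S M k \<sigma> (\<gamma> k ?xs))"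
  proof (rule smash_separation[OF pHom_ptensor[OF hom[OF k] xs] _ k])
    show "qscale (ptensor_rels S M k) ?c (ptensor_perm S M k \<sigma> (\<gamma> k ?xs)) \<in> ptensor S M k"
      by (intro SM.qscale_ptensor SM.perm_ptensor mem)
    fix F and gs :: "'g list" assume F: "HM.bal k F" and gs: "length gs = k"
    let ?F = "\<lambda>(fs, e). F (permute_list (inv \<sigma>) fs, e)"
    let ?D = "lmul_form (map grouplike gs) (delta_form F)"
    have D: "SM.bal k ?D" using gs by (intro bal_lmul_form bal_delta_form[OF F k]) simp
    have perm: "permute_list \<sigma> (map2 gact gs xs) = map2 gact (permute_list \<sigma> gs) ?xs"
      using \<sigma> gs xs by (simp add: permute_list_map permute_list_zip)
    have "qev (\<gamma> k xs) ?D = qev (\<beta> k (map2 gact gs xs)) F"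
      using qev_lmul_delta_form[OF hom[OF k] k F gs xs] delta[OF k] by simp
    also have "\<beta> k (map2 gact gs xs) = qscale (ptensor_rels H U k) ?c
        (ptensor_perm H U k \<sigma> (\<beta> k (permute_list \<sigma> (map2 gact gs xs))))"
    proof -
      have "length (map2 gact gs xs) = k" "\<forall>i<k. map2 gact gs xs ! i \<in> mcomp U (d i)"
        using gs xs d by (simp_all add: gact_comp)
      then show ?thesis using str k \<sigma> by blast
    qed
    also have "qev \<dots> F = ?c * qev (\<beta> k (map2 gact (permute_list \<sigma> gs) ?xs)) ?F"
      by (simp add: qev_ptensor(3)[OF F] qev_perm[OF F] perm)
    also have "qev (\<beta> k (map2 gact (permute_list \<sigma> gs) ?xs)) ?F =
        qev (\<gamma> k ?xs) (lmul_form (map grouplike (permute_list \<sigma> gs)) (delta_form ?F))"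
      using qev_lmul_delta_form[OF hom[OF k] k HM.bal_permute[OF F \<sigma>'], of "permute_list \<sigma> gs" ?xs]
        delta[OF k] gs xs by simp
    also have "\<dots> = qev (\<gamma> k ?xs) (\<lambda>(us, e). ?D (permute_list (inv \<sigma>) us, e))"
      by (rule SM.qev_ptensor_cong[OF mem]) (simp add: lmul_delta_form_permute[OF \<sigma> gs])
    finally show "qev (\<gamma> k xs) ?D = qev (qscale (ptensor_rels S M k) ?c (ptensor_perm S M k \<sigma> (\<gamma> k ?xs))) ?D"
      by (simp add: qev_ptensor(3)[OF D] qev_perm[OF D])
  qed
next
  note str = \<beta>[unfolded L_infinity_structures_iff]
  have hom: "\<gamma> k \<in> pHom S M (int k - 2) k" if "1 \<le> k" for k using ext that by (auto simp: PiE_def)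
  fix N d and xs :: "'l list"
  assume N: "1 \<le> N" and *: "length xs = N \<and> (\<forall>i<N. xs ! i \<in> mcomp M (d i))"
  then have xs: "length xs = N" and d: "\<forall>i<N. xs ! i \<in> mcomp M (d i)" by auto
  show "jacobiator S M \<gamma> N d xs = qclass (ptensor_rels S M N) 0"
  proof (rule smash_separation[OF _ _ N])
    show "jacobiator S M \<gamma> N d xs \<in> ptensor S M N" by (rule SM.jacobiator_ptensor[OF hom xs])
    show "qclass (ptensor_rels S M N) 0 \<in> ptensor S M N" by (rule SM.ptensorI) simp
    fix F and gs :: "'g list" assume F: "HM.bal N F" and gs: "length gs = N"
    let ?D = "lmul_form (map grouplike gs) (delta_form F)"
    have D: "SM.bal N ?D" using gs by (intro bal_lmul_form bal_delta_form[OF F N]) simp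
    have "qev (jacobiator S M \<gamma> N d xs) ?D = qev (jacobiator S M \<gamma> N d (map2 gact gs xs)) (delta_form F)"
      unfolding lmul_form_def map2_mact_grouplike[symmetric]
      using gs by (intro SM.jacobiator_act[OF hom bal_delta_form[OF F N] xs, symmetric]) simp_all
    also have "\<dots> = qev (jacobiator H U \<beta> N d (map2 gact gs xs)) F"
      using gs xs delta by (intro delta_jacobiator[OF hom _ N F]) simp_all
    also have "jacobiator H U \<beta> N d (map2 gact gs xs) = qclass (ptensor_rels H U N) 0"
    proof -
      have "length (map2 gact gs xs) = N" "\<forall>i<N. map2 gact gs xs ! i \<in> mcomp U (d i)"
        using gs xs d by (simp_all add: gact_comp)
      then show ?thesis using str N by blast
    qed
    finally show "qev (jacobiator S M \<gamma> N d xs) ?D = qev (qclass (ptensor_rels S M N) 0) ?D"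
      by (simp add: qev_ptensor(1)[OF F] qev_ptensor(1)[OF D])
  qed
qed

lemma delta_bij_betw:
  "bij_betw (\<lambda>\<beta>. \<lambda>k\<in>{1..}. delta H act M k (\<beta> k)) (L_infinity_structures S M)
    {\<beta> \<in> L_infinity_structures H U. equivariant H act M \<beta>}"
proof (rule bij_betw_imageI)
  show "inj_on (\<lambda>\<beta>. \<lambda>k\<in>{1..}. delta H act M k (\<beta> k)) (L_infinity_structures S M)"
  proof (rule inj_onI)
    fix \<beta> \<gamma> assume \<beta>: "\<beta> \<in> L_infinity_structures S M" and \<gamma>: "\<gamma> \<in> L_infinity_structures S M"
      and eq: "(\<lambda>k\<in>{1..}. delta H act M k (\<beta> k)) = (\<lambda>k\<in>{1..}. delta H act M k (\<gamma> k))"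
    then have P: "\<beta> \<in> (\<Pi>\<^sub>E k\<in>{1..}. pHom S M (int k - 2) k)" "\<gamma> \<in> (\<Pi>\<^sub>E k\<in>{1..}. pHom S M (int k - 2) k)"
      by (simp_all add: L_infinity_structures_iff)
    show "\<beta> = \<gamma>"
    \<comment> \<open>Both families are \<open>undefined\<close> at k = 0, so only k \<ge> 1 has to
      be compared.\<close>
    proof (rule PiE_ext[OF P])
      fix k :: nat assume k: "k \<in> {1..}"
      then have "delta H act M k (\<beta> k) = delta H act M k (\<gamma> k)" using fun_cong[OF eq, of k] by simp
      then show "\<beta> k = \<gamma> k"
        using k P by (intro delta_inj[of "\<beta> k" "int k - 2" k "\<gamma> k" "int k - 2"]) (auto simp: PiE_def)
    qed
  qed
  show "(\<lambda>\<beta>. \<lambda>k\<in>{1..}. delta H act M k (\<beta> k)) ` L_infinity_structures S M =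
      {\<beta> \<in> L_infinity_structures H U. equivariant H act M \<beta>}"
  proof (intro equalityI subsetI)
    fix \<beta> assume "\<beta> \<in> (\<lambda>\<beta>. \<lambda>k\<in>{1..}. delta H act M k (\<beta> k)) ` L_infinity_structures S M"
    then show "\<beta> \<in> {\<beta> \<in> L_infinity_structures H U. equivariant H act M \<beta>}"
      using delta_L_infinity by blast
  next
    fix \<beta> assume "\<beta> \<in> {\<beta> \<in> L_infinity_structures H U. equivariant H act M \<beta>}"
    then have \<beta>: "\<beta> \<in> L_infinity_structures H U" and eqv: "equivariant H act M \<beta>" by auto
    have P: "\<beta> \<in> (\<Pi>\<^sub>E k\<in>{1..}. pHom H U (int k - 2) k)" using \<beta> by (simp add: L_infinity_structures_iff)
    then have hom: "\<beta> k \<in> pHom H U (int k - 2) k" if "1 \<le> k" for k using that by (auto simp: PiE_def)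
    have eqv: "\<beta> k (map (gact g) xs) = ptensor_group_act H act M k g (\<beta> k xs)"
      if "1 \<le> k" "length xs = k" for k g xs
      using eqv that by (simp add: equivariant_def)
    define \<gamma> where "\<gamma> = (\<lambda>k\<in>{1..}. induce k (\<beta> k))"
    have delta: "delta H act M k (\<gamma> k) = \<beta> k" if "1 \<le> k" for k
      using that delta_induce[OF hom[OF that] that eqv[OF that]] by (simp add: \<gamma>_def)
    have "\<gamma> \<in> (\<Pi>\<^sub>E k\<in>{1..}. pHom S M (int k - 2) k)"
      using induce_pHom[OF hom _ eqv] by (auto simp: \<gamma>_def)
    then have "\<gamma> \<in> L_infinity_structures S M" by (rule L_infinity_if_delta[OF \<beta> _ delta])
    moreover have "\<beta> = (\<lambda>k\<in>{1..}. delta H act M k (\<gamma> k))"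
      using P delta by (auto simp: PiE_def extensional_def fun_eq_iff)
    ultimately show "\<beta> \<in> (\<lambda>\<beta>. \<lambda>k\<in>{1..}. delta H act M k (\<beta> k)) ` L_infinity_structures S M"
      by blast
  qed
qed

end

theorem theorem3p13:
  fixes H :: "('k::field, 'h::ab_group_add) hopf"
    and act :: "'g::{group_add,finite} \<Rightarrow> 'h \<Rightarrow> 'h"
    and M :: "('k, 'g \<Rightarrow>\<^sub>0 'h, 'l::ab_group_add) gmod"
  assumes "cocommutative_hopf_algebra H"
    and "hopf_action H act"
    and "graded_left_module (smash H act) M"
  shows "bij_betw (\<lambda>\<beta>. \<lambda>k\<in>{1..}. delta H act M k (\<beta> k))
           (L_infinity_structures (smash H act) M)
           {\<beta> \<in> L_infinity_structures H (underlying_module M). equivariant H act M \<beta>}"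
proof -
  interpret smash_module H act M
    using assms by (intro smash_module.intro smash_action.intro smash_action_axioms.intro)
  show ?thesis by (rule delta_bij_betw)
qed

end
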